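(* Let $I=\{i_1,\ldots,i_n\}\subseteq\widehat I=\{i_1,\ldots,i_n,i_{n+1},\ldots,i_N\}\subseteq J$ with $2\le n\le N=|\widehat I|$, and consider the linking structure $\mathcal{G}_{\widehat I,I}$ (with assumption (A) holding). Let $1\le m_1,m_2\le n$ satisfy $m_1+m_2\ge n$, let $t=m_1+m_2-n$, and set $$\widehat I_1=\{i_1,\ldots,i_{m_1},i_{n+1},\ldots,i_N\},\qquad \widehat I_2=\{i_{n-m_2+1},\ldots,i_n,i_{n+1},\ldots,i_N\},$$ and $V=\mathrm{Ker}(p'_{n,m_1})\cap\mathrm{Ker}(p''_{n,m_2})\subseteq\mathbb{U}_n$. Let $\rho_1\colon G_{\widehat I_1}\to\mathbb{U}_{m_1}$ and $\rho_2\colon G_{\widehat I_2}\to\mathbb{U}_{m_2}$ be globalizations for $\mathcal{G}_{\widehat I_1,\widehat I_1\cap I}$ and $\mathcal{G}_{\widehat I_2,\widehat I_2\cap I}$, respectively. Then: (a) There is a globalization $\bar\rho\colon G_{\widehat I}\to\mathbb{U}_{m_1}\times_{\mathbb{U}_t}\mathbb{U}_{m_2}$ for $\mathcal{G}_{\widehat I,I}/V$ which lifts both $\rho_1$ and $\rho_2$ with respect to the projection maps (that is, the composition of $\bar\rho$ with the projection to $\mathbb{U}_{m_k}$ equals the composition of the restriction $G_{\widehat I}\to G_{\widehat I_k}$ with $\rho_k$, for $k=1,2$). (b) If in addition $\mathcal{G}_{\widehat I,I}$ has a $V$-link type and $\rho_1,\rho_2$ are trivial on $\mathrm{res}_i(\bar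 Z_i)$ for all $i\in I$ (where $\mathrm{res}_i(\bar Z_i)$ is the image of $\bar Z_i$ in $G_{\widehat I_1}$, resp. $G_{\widehat I_2}$), then there is a surjective globalization $\rho\colon G_{\widehat I}\to\mathbb{U}_n$ for $\mathcal{G}_{\widehat I,I}$ which lifts both $\rho_1$ and $\rho_2$ (i.e. $p'_{n,m_1}\circ\rho$ and $p''_{n,m_2}\circ\rho$ are the compositions of the restrictions $G_{\widehat I}\to G_{\widehat I_1}$, $G_{\widehat I}\to G_{\widehat I_2}$ with $\rho_1$, $\rho_2$) and such that $\rho(\mathrm{res}_i(\bar Z_i))\subseteq V$ for all $i\in I$.
   Context: Unitriangular groups. $p$ is a prime and $R$ is a commutative unital pro-$p$ ring with additive group $R^+$. $\mathbb{U}_n$ is the group of unipotent upper-triangular $(n+1)\times(n+1)$ matrices over $R$ ($\mathbb{U}_0$ is trivial). For $m\le n$, $p'_{n,m},p''_{n,m}\colon\mathbb{U}_n\to\mathbb{U}_m$ are the homomorphisms projecting onto the upper-left, resp. lower-right, $(m+1)\times(m+1)$ submatrix. The fiber product $\mathbb{U}_{m_1}\times_{\mathbb{U}_t}\mathbb{U}_{m_2}$ is taken with respect to $p''_{m_1,t}$ and $p'_{m_2,t}$; it is identified with $\mathbb{U}_n/V$ via $(p'_{n,m_1},p''_{n,m_2})$. Linking structures. A pro-$p$ linking structure $\mathcal{G}=(G,U,Z_i,T_i,\lambda_i,\pi_i)_{i\in I}$ consists of pro-$p$ groups $G,U$; an index set $I$; for each $i\in I$ a pro-$p$ group $Z_i$,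 a closed normal subgroup $T_i$ with a fixed homomorphic section of $Z_i\to\bar Z_i:=Z_i/T_i$ (so $Z_i=T_i\rtimes\bar Z_i$ and $\bar Z_i\le Z_i$); and homomorphisms $\lambda_i\colon Z_i\to G$, $\pi_i\colon T_i\to U$ such that the $\lambda_i(T_i)$ generate the pro-$p$ group $G$. A globalization for $\mathcal{G}$ is a pro-$p$ homomorphism $\rho\colon G\to U$ with $\rho\circ\lambda_i|_{T_i}=\pi_i$ for all $i\in I$. For a closed normal subgroup $V$ of $U$, $\mathcal{G}/V=(G,U/V,Z_i,T_i,\lambda_i,\mathrm{pr}_{U,U/V}\circ\pi_i)_{i\in I}$. Let $\hat T=\star_{i\in I}T_i$ be the free pro-$p$ product, with induced maps $\hat\lambda_T\colon\hat T\to G$ and $\hat\pi\colon\hat T\to U$, and put $\hat Z_i=\hat\lambda_T^{-1}(\lambda_i(\bar Z_i))$. $\mathcal{G}$ has a $V$-link type if $\mathrm{Ker}(\hat\lambda_T)$ is generated as a closed normal subgroup of $\hat T$ by elements of $\mathrm{Ker}(\hat\pi)[\hat\pi^{-1}(C_U(V)),\hat Z_i]$ for certain indices $i\in I$ ($C_U(V)$ = centralizer, $[\cdot,\cdot]$ = closed commutator subgroup). The structures $\mathcal{G}_{\widehat I,I}$. Let $G$ be a pro-$p$ group and $Z_j,T_j$ ($j\in J$) closed subgroups of $G$ with $T_j$ normal in $Z_j$. Let $I=\{i_1,\ldots,i_n\}\subseteq J$ consist of $n$ distinct elements, with $Z_i=T_i\rtimes\bar Z_i$, $\bar Z_i=Z_i/T_i$,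 for $i\in I$. For $\widehat I\subseteq J$, $N_{\widehat I}$ is the closed normal subgroup of $G$ generated by all $T_j$, $j\in J\setminus\widehat I$, and $G_{\widehat I}=G/N_{\widehat I}$. For $I\subseteq\widehat I\subseteq J$, assumption (A) is: the images of $T_i$, $i\in I$, generate $G_{\widehat I}$. For each $j\in J$ an epimorphism $\bar\pi_j\colon T_j\to R^+$ is fixed, and $\pi_j\colon T_j\to\mathbb{U}_n$ is defined by $\pi_j(\tau)=\mathrm{Id}+\bar\pi_j(\tau)E_{l,l+1}$ if $j=i_l$, and $\pi_j(\tau)=\mathrm{Id}$ if $j\notin I$. Then $\mathcal{G}_{\widehat I,I}=(G_{\widehat I},\mathbb{U}_n,Z_i,T_i,\mathrm{res}_i,\pi_i)_{i\in I}$, where $\mathrm{res}_i\colon Z_i\to G_{\widehat I}$ is the natural map. Similarly (assumption (A) for these follows), $\mathcal{G}_{\widehat I_1,\widehat I_1\cap I}=(G_{\widehat I_1},\mathbb{U}_{m_1},Z_i,T_i,\mathrm{res}_i,p'_{n,m_1}\circ\pi_i)_{i\in\widehat I_1\cap I}$ and $\mathcal{G}_{\widehat I_2,\widehat I_2\cap I}=(G_{\widehat I_2},\mathbb{U}_{m_2},Z_i,T_i,\mathrm{res}_i,p''_{n,m_2}\circ\pi_i)_{i\in\widehat I_2\cap I}$, where $\mathrm{res}_i$ denotes the natural map from $Z_i$ to the relevant quotient of $G$. For $\widehat I'\subseteq\widehat I$, the restriction $G_{\widehat I}\to G_{\widehat I'}$ is the natural quotient map. *)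

theory Defs
  imports
    "HOL-Analysis.Analysis"
    "HOL-Computational_Algebra.Primes"
    "HOL-Algebra.QuotRing"
    "HOL-Algebra.Product_Groups"
begin

section \<open>Pro-\<open>p\<close> groups and rings\<close>

record 'a tgroup = "'a monoid" +
  gtop :: "'a topology"

record 'a tring = "'a ring" +
  rtop :: "'a topology"

definition topological_group :: "('a, 'b) tgroup_scheme \<Rightarrow> bool" where
  "topological_group G \<longleftrightarrow>
     group G \<and> topspace (gtop G) = carrier G \<and>
     continuous_map (prod_topology (gtop G) (gtop G)) (gtop G) (\<lambda>(x, y). x \<otimes>\<^bsub>G\<^esub> y) \<and>
     continuous_map (gtop G) (gtop G) (\<lambda>x. inv\<^bsub>G\<^esub> x)"

text \<open>Inverse limits of finite \<open>p\<close>-groups are described intrinsically: compact Hausdorff groups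
  whose open normal subgroups of \<open>p\<close>-power index form a neighbourhood base of the identity.
  The index is positive, so \<open>card\<close> is not applied to an infinite set here.\<close>

definition pro_p_group :: "nat \<Rightarrow> ('a, 'b) tgroup_scheme \<Rightarrow> bool" where
  "pro_p_group p G \<longleftrightarrow>
     topological_group G \<and> compact_space (gtop G) \<and> Hausdorff_space (gtop G) \<and>
     (\<forall>W. openin (gtop G) W \<and> \<one>\<^bsub>G\<^esub> \<in> W \<longrightarrow>
        (\<exists>N. N \<lhd> G \<and> openin (gtop G) N \<and> N \<subseteq> W \<and> (\<exists>k. finite (rcosets\<^bsub>G\<^esub> N) \<and> card (rcosets\<^bsub>G\<^esub> N) = p ^ k)))"

text \<open>Likewise for inverse limits of finite commutative unital rings of \<open>p\<close>-power order.
  The zero ring is allowed.\<close>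

definition pro_p_ring :: "nat \<Rightarrow> ('a, 'b) tring_scheme \<Rightarrow> bool" where
  "pro_p_ring p R \<longleftrightarrow>
     cring R \<and> topspace (rtop R) = carrier R \<and>
     continuous_map (prod_topology (rtop R) (rtop R)) (rtop R) (\<lambda>(x, y). x \<oplus>\<^bsub>R\<^esub> y) \<and>
     continuous_map (rtop R) (rtop R) (\<lambda>x. \<ominus>\<^bsub>R\<^esub> x) \<and>
     continuous_map (prod_topology (rtop R) (rtop R)) (rtop R) (\<lambda>(x, y). x \<otimes>\<^bsub>R\<^esub> y) \<and>
     compact_space (rtop R) \<and> Hausdorff_space (rtop R) \<and>
     (\<forall>W. openin (rtop R) W \<and> \<zero>\<^bsub>R\<^esub> \<in> W \<longrightarrow>
        (\<exists>A. ideal A R \<and> openin (rtop R) A \<and> A \<subseteq> W \<and>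
             (\<exists>k. finite (carrier (R Quot A)) \<and> card (carrier (R Quot A)) = p ^ k)))"

definition additive_tgroup :: "('a, 'b) tring_scheme \<Rightarrow> 'a tgroup" where
  "additive_tgroup R = \<lparr>carrier = carrier R, mult = add R, one = zero R, gtop = rtop R\<rparr>"

definition sub_tgroup :: "('a, 'b) tgroup_scheme \<Rightarrow> 'a set \<Rightarrow> 'a tgroup" where
  "sub_tgroup G H = \<lparr>carrier = H, mult = mult G, one = one G, gtop = subtopology (gtop G) H\<rparr>"

definition quot_tgroup :: "('a, 'b) tgroup_scheme \<Rightarrow> 'a set \<Rightarrow> 'a set tgroup" where
  "quot_tgroup G N =
     \<lparr>carrier = carrier (G Mod N), mult = mult (G Mod N), one = one (G Mod N),
      gtop = topology (\<lambda>W. W \<subseteq> carrier (G Mod N) \<and>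
                           openin (gtop G) {x \<in> carrier G. N #>\<^bsub>G\<^esub> x \<in> W})\<rparr>"

definition discrete_tgroup :: "('a, 'b) monoid_scheme \<Rightarrow> 'a tgroup" where
  "discrete_tgroup F =
     \<lparr>carrier = carrier F, mult = mult F, one = one F, gtop = discrete_topology (carrier F)\<rparr>"

text \<open>Homomorphisms between pro-\<open>p\<close> groups are always meant to be continuous.\<close>

definition chom :: "('a, 'c) tgroup_scheme \<Rightarrow> ('b, 'd) tgroup_scheme \<Rightarrow> ('a \<Rightarrow> 'b) set" where
  "chom G H = {h \<in> hom G H. continuous_map (gtop G) (gtop H) h}"

definition closed_subgroup :: "'a set \<Rightarrow> ('a, 'b) tgroup_scheme \<Rightarrow> bool" where
  "closed_subgroup H G \<longleftrightarrow> subgroup H G \<and> closedin (gtop G) H"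

definition closed_normal :: "'a set \<Rightarrow> ('a, 'b) tgroup_scheme \<Rightarrow> bool" where
  "closed_normal N G \<longleftrightarrow> N \<lhd> G \<and> closedin (gtop G) N"

text \<open>The closed (normal) subgroup generated by a subset of the carrier.\<close>

definition closed_generate :: "('a, 'b) tgroup_scheme \<Rightarrow> 'a set \<Rightarrow> 'a set" where
  "closed_generate G S = \<Inter>{H. closed_subgroup H G \<and> S \<subseteq> H}"

definition closed_normal_generate :: "('a, 'b) tgroup_scheme \<Rightarrow> 'a set \<Rightarrow> 'a set" where
  "closed_normal_generate G S = \<Inter>{N. closed_normal N G \<and> S \<subseteq> N}"

definition closed_commutator :: "('a, 'b) tgroup_scheme \<Rightarrow> 'a set \<Rightarrow> 'a set \<Rightarrow> 'a set" where
  "closed_commutator G A B =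
     closed_generate G {inv\<^bsub>G\<^esub> a \<otimes>\<^bsub>G\<^esub> inv\<^bsub>G\<^esub> b \<otimes>\<^bsub>G\<^esub> a \<otimes>\<^bsub>G\<^esub> b | a b. a \<in> A \<and> b \<in> B}"

definition centralizer_of :: "('a, 'b) monoid_scheme \<Rightarrow> 'a set \<Rightarrow> 'a set" where
  "centralizer_of G V = {x \<in> carrier G. \<forall>v\<in>V. x \<otimes>\<^bsub>G\<^esub> v = v \<otimes>\<^bsub>G\<^esub> x}"

text \<open>The fibre product of groups \<open>A\<close>, \<open>B\<close> over a common target of \<open>f\<close> and \<open>g\<close>.\<close>

definition fiber_product ::
    "('a, 'd) tgroup_scheme \<Rightarrow> ('b, 'e) tgroup_scheme \<Rightarrow> ('a \<Rightarrow> 'c) \<Rightarrow> ('b \<Rightarrow> 'c) \<Rightarrow> ('a \<times> 'b) tgroup" where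
  "fiber_product A B f g =
     (let C = {(a, b). a \<in> carrier A \<and> b \<in> carrier B \<and> f a = g b} in
      \<lparr>carrier = C, mult = (\<lambda>(a, b) (a', b'). (a \<otimes>\<^bsub>A\<^esub> a', b \<otimes>\<^bsub>B\<^esub> b')), one = (\<one>\<^bsub>A\<^esub>, \<one>\<^bsub>B\<^esub>),
       gtop = subtopology (prod_topology (gtop A) (gtop B)) C\<rparr>)"


section \<open>Free pro-\<open>p\<close> products\<close>

text \<open>The free pro-\<open>p\<close> product of the groups \<open>T i\<close> is the coproduct in the category of pro-\<open>p\<close>
  groups. It is constructed as the closed subgroup, topologically generated by the images of
  all \<open>T i\<close>, of the product of the targets of all families of continuous homomorphisms from the
  \<open>T i\<close> to a common finite \<open>p\<close>-group. As every finite group is isomorphic to one whose carrier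
  is a set of natural numbers, only such groups \<open>F\<close> need to be considered. The universal property
  with respect to pro-\<open>p\<close> groups of arbitrary type is theorem \<open>free_pro_p_product_universal\<close>. For
  an infinite index set this is the coproduct, with no convergence condition on the families.\<close>

definition finite_p_targets ::
    "nat \<Rightarrow> 'i set \<Rightarrow> ('i \<Rightarrow> 'a tgroup) \<Rightarrow> (nat monoid \<times> ('i \<Rightarrow> 'a \<Rightarrow> nat)) set" where
  "finite_p_targets p I T =
     {(F, \<phi>). group F \<and> finite (carrier F) \<and> (\<exists>k. order F = p ^ k) \<and>
              (\<forall>i\<in>I. \<phi> i \<in> chom (T i) (discrete_tgroup F))}"

definition product_tgroup :: "'d set \<Rightarrow> ('d \<Rightarrow> 'a tgroup) \<Rightarrow> ('d \<Rightarrow> 'a) tgroup" where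
  "product_tgroup D F =
     \<lparr>carrier = carrier (product_group D F), mult = mult (product_group D F),
      one = one (product_group D F), gtop = product_topology (\<lambda>d. gtop (F d)) D\<rparr>"

definition target_product ::
    "nat \<Rightarrow> 'i set \<Rightarrow> ('i \<Rightarrow> 'a tgroup) \<Rightarrow> (nat monoid \<times> ('i \<Rightarrow> 'a \<Rightarrow> nat) \<Rightarrow> nat) tgroup" where
  "target_product p I T = product_tgroup (finite_p_targets p I T) (\<lambda>d. discrete_tgroup (fst d))"

definition free_inclusion ::
    "nat \<Rightarrow> 'i set \<Rightarrow> ('i \<Rightarrow> 'a tgroup) \<Rightarrow> 'i \<Rightarrow> 'a \<Rightarrow> (nat monoid \<times> ('i \<Rightarrow> 'a \<Rightarrow> nat) \<Rightarrow> nat)" where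
  "free_inclusion p I T i x = (\<lambda>d\<in>finite_p_targets p I T. snd d i x)"

definition free_pro_p_product ::
    "nat \<Rightarrow> 'i set \<Rightarrow> ('i \<Rightarrow> 'a tgroup) \<Rightarrow> (nat monoid \<times> ('i \<Rightarrow> 'a \<Rightarrow> nat) \<Rightarrow> nat) tgroup" where
  "free_pro_p_product p I T =
     sub_tgroup (target_product p I T)
       (closed_generate (target_product p I T) (\<Union>i\<in>I. free_inclusion p I T i ` carrier (T i)))"

definition free_induced ::
    "nat \<Rightarrow> 'i set \<Rightarrow> ('i \<Rightarrow> 'a tgroup) \<Rightarrow> ('h, 'c) tgroup_scheme \<Rightarrow> ('i \<Rightarrow> 'a \<Rightarrow> 'h) \<Rightarrow>
     (nat monoid \<times> ('i \<Rightarrow> 'a \<Rightarrow> nat) \<Rightarrow> nat) \<Rightarrow> 'h" where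
  "free_induced p I T H \<phi> =
     (THE \<psi>. \<psi> \<in> chom (free_pro_p_product p I T) H \<and>
             \<psi> \<in> extensional (carrier (free_pro_p_product p I T)) \<and>
             (\<forall>i\<in>I. \<forall>x\<in>carrier (T i). \<psi> (free_inclusion p I T i x) = \<phi> i x))"

subsection \<open>The universal property\<close>

lemma discrete_tgroup_simps [simp]:
  "carrier (discrete_tgroup F) = carrier F" "mult (discrete_tgroup F) = mult F"
  "one (discrete_tgroup F) = one F" "gtop (discrete_tgroup F) = discrete_topology (carrier F)"
  by (simp_all add: discrete_tgroup_def)

lemma sub_tgroup_simps [simp]:
  "carrier (sub_tgroup G H) = H" "mult (sub_tgroup G H) = mult G"
  "one (sub_tgroup G H) = one G" "gtop (sub_tgroup G H) = subtopology (gtop G) H"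
  by (simp_all add: sub_tgroup_def)

lemma product_tgroup_simps [simp]:
  "carrier (product_tgroup D F) = (\<Pi>\<^sub>E d\<in>D. carrier (F d))"
  "mult (product_tgroup D F) = (\<lambda>x y. \<lambda>d\<in>D. x d \<otimes>\<^bsub>F d\<^esub> y d)"
  "one (product_tgroup D F) = (\<lambda>d\<in>D. \<one>\<^bsub>F d\<^esub>)"
  "gtop (product_tgroup D F) = product_topology (\<lambda>d. gtop (F d)) D"
  by (simp_all add: product_tgroup_def)

lemma group_cong:
  assumes "carrier G = carrier H" "mult G = mult H" "one G = one H" "group G"
  shows "group H"
proof -
  interpret group G by fact
  show ?thesis
    using assms(1-3) by (intro groupI) (auto simp: m_assoc simp flip: assms(1-3))
qed

lemma inv_cong:
  assumes "carrier G = carrier H" "mult G = mult H" "one G = one H"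
  shows "inv\<^bsub>G\<^esub> x = inv\<^bsub>H\<^esub> x"
  by (simp add: m_inv_def assms)

lemma group_discrete [simp]: "group (discrete_tgroup F) \<longleftrightarrow> group F"
  using group_cong[of F "discrete_tgroup F"] group_cong[of "discrete_tgroup F" F] by auto

lemma inv_sub_tgroup:
  assumes "group G" "subgroup H G" "x \<in> H"
  shows "inv\<^bsub>sub_tgroup G H\<^esub> x = inv\<^bsub>G\<^esub> x"
proof -
  have "inv\<^bsub>sub_tgroup G H\<^esub> x = inv\<^bsub>G\<lparr>carrier := H\<rparr>\<^esub> x"
    by (rule inv_cong) auto
  also have "\<dots> = inv\<^bsub>G\<^esub> x"
    using group.m_inv_consistent[OF assms] by simp
  finally show ?thesis .
qed

lemma group_sub_tgroup:
  assumes "group G" "subgroup H G"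
  shows "group (sub_tgroup G H)"
  using group.subgroup_imp_group[OF assms] by (rule group_cong[rotated 3]) auto

lemma topological_group_sub:
  assumes G: "topological_group G" and H: "subgroup H G"
  shows "topological_group (sub_tgroup G H)"
proof -
  have gG: "group G" and top: "topspace (gtop G) = carrier G"
    and cm: "continuous_map (prod_topology (gtop G) (gtop G)) (gtop G) (\<lambda>(x, y). x \<otimes>\<^bsub>G\<^esub> y)"
    and ci: "continuous_map (gtop G) (gtop G) (\<lambda>x. inv\<^bsub>G\<^esub> x)"
    using G by (auto simp: topological_group_def)
  have HG: "H \<subseteq> carrier G" using H by (rule subgroup.subset)
  have "continuous_map (subtopology (gtop G) H) (subtopology (gtop G) H) (\<lambda>x. inv\<^bsub>G\<^esub> x)"
    using ci H by (auto simp: continuous_map_in_subtopology continuous_map_from_subtopology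
        subgroup.m_inv_closed)
  then have "continuous_map (subtopology (gtop G) H) (subtopology (gtop G) H)
      (\<lambda>x. inv\<^bsub>sub_tgroup G H\<^esub> x)"
    by (rule continuous_map_eq) (use inv_sub_tgroup[OF gG H] in auto)
  moreover have "continuous_map (prod_topology (subtopology (gtop G) H) (subtopology (gtop G) H))
      (subtopology (gtop G) H) (\<lambda>(x, y). x \<otimes>\<^bsub>G\<^esub> y)"
    using cm H by (auto simp: continuous_map_in_subtopology continuous_map_from_subtopology
        prod_topology_subtopology subtopology_subtopology subgroup.m_closed)
  ultimately show ?thesis
    using HG top group_sub_tgroup[OF gG H] by (auto simp: topological_group_def)
qed

lemma topological_group_discrete:
  assumes "group F"
  shows "topological_group (discrete_tgroup F)"
proof -
  interpret group F by fact
  have "inv\<^bsub>discrete_tgroup F\<^esub> x = inv\<^bsub>F\<^esub> x" for x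
    by (rule inv_cong) auto
  then show ?thesis
    using assms by (auto simp: topological_group_def prod_topology_discrete_topology[symmetric])
qed

lemma group_product_tgroup:
  assumes "\<And>d. d \<in> D \<Longrightarrow> group (F d)"
  shows "group (product_tgroup D F)"
proof (rule group_cong)
  show "group (product_group D F)" using assms by (rule product_group)
qed (simp_all add: product_tgroup_def)

lemma topological_group_product:
  assumes F: "\<And>d. d \<in> D \<Longrightarrow> topological_group (F d)"
  shows "topological_group (product_tgroup D F)"
proof -
  let ?P = "product_topology (\<lambda>d. gtop (F d)) D"
  have gF: "group (F d)" and top: "topspace (gtop (F d)) = carrier (F d)"
    and cm: "continuous_map (prod_topology (gtop (F d)) (gtop (F d))) (gtop (F d)) (\<lambda>(x, y). x \<otimes>\<^bsub>F d\<^esub> y)"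
    and ci: "continuous_map (gtop (F d)) (gtop (F d)) (\<lambda>x. inv\<^bsub>F d\<^esub> x)" if "d \<in> D" for d
    using F[OF that] by (auto simp: topological_group_def)
  have top': "(\<Pi>\<^sub>E d\<in>D. topspace (gtop (F d))) = (\<Pi>\<^sub>E d\<in>D. carrier (F d))"
    using top by (intro PiE_cong) auto
  have inv: "inv\<^bsub>product_tgroup D F\<^esub> x = (\<lambda>d\<in>D. inv\<^bsub>F d\<^esub> x d)" if "x \<in> (\<Pi>\<^sub>E d\<in>D. carrier (F d))" for x
  proof -
    have "inv\<^bsub>product_tgroup D F\<^esub> x = inv\<^bsub>product_group D F\<^esub> x"
      by (rule inv_cong) auto
    then show ?thesis
      using inv_product_group[of x D F] that gF by auto
  qed
  have "continuous_map ?P (gtop (F d)) (\<lambda>x. inv\<^bsub>F d\<^esub> x d)" if "d \<in> D" for d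
    using continuous_map_compose[OF continuous_map_product_projection[OF that, of "\<lambda>d. gtop (F d)"] ci[OF that]]
    by (simp add: o_def)
  then have "continuous_map ?P ?P (\<lambda>x. \<lambda>d\<in>D. inv\<^bsub>F d\<^esub> x d)"
    unfolding continuous_map_componentwise by auto
  then have 1: "continuous_map ?P ?P (\<lambda>x. inv\<^bsub>product_tgroup D F\<^esub> x)"
    by (rule continuous_map_eq) (use inv top' in auto)
  have "continuous_map (prod_topology ?P ?P) (gtop (F d)) (\<lambda>z. fst z d \<otimes>\<^bsub>F d\<^esub> snd z d)" if "d \<in> D" for d
  proof -
    have "continuous_map (prod_topology ?P ?P) (prod_topology (gtop (F d)) (gtop (F d))) (\<lambda>z. (fst z d, snd z d))"
      by (intro continuous_map_pairedI
          continuous_map_compose[OF continuous_map_fst continuous_map_product_projection[OF that], unfolded o_def]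
          continuous_map_compose[OF continuous_map_snd continuous_map_product_projection[OF that], unfolded o_def])
    from continuous_map_compose[OF this cm[OF that]] show ?thesis by (simp add: o_def)
  qed
  then have 2: "continuous_map (prod_topology ?P ?P) ?P (\<lambda>z. \<lambda>d\<in>D. fst z d \<otimes>\<^bsub>F d\<^esub> snd z d)"
    unfolding continuous_map_componentwise by auto
  show ?thesis
    unfolding topological_group_def
    using 1 2 group_product_tgroup[of D F] gF top' by (simp add: case_prod_unfold)
qed

lemma pro_p_groupD:
  assumes "pro_p_group p G"
  shows "group G" "topspace (gtop G) = carrier G" "compact_space (gtop G)" "Hausdorff_space (gtop G)"
    "topological_group G"
  using assms by (auto simp: pro_p_group_def topological_group_def)

lemma openin_coset:
  assumes G: "topological_group G" and N: "subgroup N G" "openin (gtop G) N" and x: "x \<in> carrier G"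
  shows "openin (gtop G) (N #>\<^bsub>G\<^esub> x)"
proof -
  interpret group G using G by (simp add: topological_group_def)
  have top: "topspace (gtop G) = carrier G"
    and cm: "continuous_map (prod_topology (gtop G) (gtop G)) (gtop G) (\<lambda>(x, y). x \<otimes>\<^bsub>G\<^esub> y)"
    using G by (auto simp: topological_group_def)
  have "continuous_map (gtop G) (prod_topology (gtop G) (gtop G)) (\<lambda>y. (y, inv\<^bsub>G\<^esub> x))"
    using x top by (intro continuous_map_pairedI) auto
  from continuous_map_compose[OF this cm]
  have "continuous_map (gtop G) (gtop G) (\<lambda>y. y \<otimes>\<^bsub>G\<^esub> inv\<^bsub>G\<^esub> x)" by (simp add: o_def)
  then have "openin (gtop G) {y \<in> topspace (gtop G). y \<otimes>\<^bsub>G\<^esub> inv\<^bsub>G\<^esub> x \<in> N}"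
    using N(2) by (rule openin_continuous_map_preimage)
  moreover have "{y \<in> topspace (gtop G). y \<otimes>\<^bsub>G\<^esub> inv\<^bsub>G\<^esub> x \<in> N} = N #>\<^bsub>G\<^esub> x"
  proof (rule Set.set_eqI, rule iffI)
    fix y assume "y \<in> {y \<in> topspace (gtop G). y \<otimes>\<^bsub>G\<^esub> inv\<^bsub>G\<^esub> x \<in> N}"
    then have "y \<in> carrier G" "y \<otimes>\<^bsub>G\<^esub> inv\<^bsub>G\<^esub> x \<in> N" using top by auto
    then show "y \<in> N #>\<^bsub>G\<^esub> x"
      using x by (auto simp: r_coset_def m_assoc intro!: bexI[of _ "y \<otimes>\<^bsub>G\<^esub> inv\<^bsub>G\<^esub> x"])
  next
    fix y assume "y \<in> N #>\<^bsub>G\<^esub> x"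
    then show "y \<in> {y \<in> topspace (gtop G). y \<otimes>\<^bsub>G\<^esub> inv\<^bsub>G\<^esub> x \<in> N}"
      using x top subgroup.mem_carrier[OF N(1)] by (auto simp: r_coset_def m_assoc)
  qed
  ultimately show ?thesis by simp
qed

lemma chom_discrete_iff:
  assumes "topspace (gtop G) = carrier G"
  shows "h \<in> chom G (discrete_tgroup F) \<longleftrightarrow>
    h \<in> hom G F \<and> (\<forall>y\<in>carrier F. openin (gtop G) {x \<in> carrier G. h x = y})"
    (is "_ \<longleftrightarrow> ?R")
proof
  assume h: "h \<in> chom G (discrete_tgroup F)"
  have "openin (gtop G) {x \<in> carrier G. h x = y}" if "y \<in> carrier F" for y
  proof -
    have "openin (gtop G) {x \<in> topspace (gtop G). h x \<in> {y}}"
      by (rule openin_continuous_map_preimage[of _ "discrete_topology (carrier F)"])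
        (use h that in \<open>auto simp: chom_def\<close>)
    then show ?thesis by (simp add: assms)
  qed
  then show ?R using h by (auto simp: chom_def hom_def)
next
  assume R: ?R
  have "openin (gtop G) {x \<in> carrier G. h x \<in> W}" if "W \<subseteq> carrier F" for W
  proof -
    have "{x \<in> carrier G. h x \<in> W} = (\<Union>y\<in>W. {x \<in> carrier G. h x = y})" by auto
    then show ?thesis using R that by (auto intro!: openin_Union)
  qed
  then show "h \<in> chom G (discrete_tgroup F)"
    using R by (auto simp: chom_def hom_def continuous_map_def assms)
qed

lemma coset_chom:
  assumes G: "topological_group G" and N: "N \<lhd> G" "openin (gtop G) N"
  shows "(\<lambda>x. N #>\<^bsub>G\<^esub> x) \<in> chom G (discrete_tgroup (G Mod N))"
proof -
  have sub: "subgroup N G" using N(1) by (simp add: normal_def)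
  have top: "topspace (gtop G) = carrier G" using G by (simp add: topological_group_def)
  interpret normal N G by fact
  have "openin (gtop G) {x \<in> carrier G. N #>\<^bsub>G\<^esub> x = y}" if y: "y \<in> carrier (G Mod N)" for y
  proof -
    obtain a where a: "a \<in> carrier G" "y = N #>\<^bsub>G\<^esub> a"
      using y by (auto simp: carrier_FactGroup)
    have "{x \<in> carrier G. N #>\<^bsub>G\<^esub> x = y} = N #>\<^bsub>G\<^esub> a"
    proof (rule Set.set_eqI, rule iffI)
      fix x assume "x \<in> {x \<in> carrier G. N #>\<^bsub>G\<^esub> x = y}"
      then show "x \<in> N #>\<^bsub>G\<^esub> a" using rcos_self[OF _ sub, of x] a(2) by simp
    next
      fix x assume x: "x \<in> N #>\<^bsub>G\<^esub> a"
      then have "x \<in> carrier G" using r_coset_subset_G[OF subset a(1)] by blast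
      then show "x \<in> {x \<in> carrier G. N #>\<^bsub>G\<^esub> x = y}"
        using repr_independence[OF x a(1) sub] a(2) by simp
    qed
    then show ?thesis using openin_coset[OF G sub N(2) a(1)] by simp
  qed
  then show ?thesis
    unfolding chom_discrete_iff[OF top] using r_coset_hom_Mod by simp
qed

lemma pro_p_groupI:
  assumes p: "Factorial_Ring.prime p" and G: "topological_group G" "compact_space (gtop G)" "Hausdorff_space (gtop G)"
    and nb: "\<And>W. openin (gtop G) W \<Longrightarrow> \<one>\<^bsub>G\<^esub> \<in> W \<Longrightarrow>
        \<exists>(F::('f,'c) monoid_scheme) h k. group F \<and> finite (carrier F) \<and> order F = p ^ k \<and>
           h \<in> chom G (discrete_tgroup F) \<and> kernel G F h \<subseteq> W"
  shows "pro_p_group p G"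
  unfolding pro_p_group_def
proof (intro conjI G allI impI)
  fix W assume "openin (gtop G) W \<and> \<one>\<^bsub>G\<^esub> \<in> W"
  then obtain F :: "('f,'c) monoid_scheme" and h k where F: "group F" "finite (carrier F)" "order F = p ^ k"
    and h: "h \<in> chom G (discrete_tgroup F)" and W: "kernel G F h \<subseteq> W"
    using nb by blast
  have gG: "group G" and top: "topspace (gtop G) = carrier G"
    using G by (auto simp: topological_group_def)
  have hom: "h \<in> hom G F" using h by (simp add: chom_discrete_iff[OF top])
  then interpret h: group_hom G F h
    using F gG by (simp add: group_hom_def group_hom_axioms_def)
  let ?N = "kernel G F h"
  have "openin (gtop G) ?N"
    using h by (auto simp: chom_discrete_iff[OF top] kernel_def)
  have img: "subgroup (h ` carrier G) F" by (rule h.img_is_subgroup)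
  interpret h': group_hom G "F\<lparr>carrier := h ` carrier G\<rparr>" h
    using hom h.H.subgroup_imp_group[OF img] gG
    by (auto simp: group_hom_def group_hom_axioms_def hom_def)
  have ker: "kernel G (F\<lparr>carrier := h ` carrier G\<rparr>) h = ?N" by (simp add: kernel_def)
  have "(\<lambda>X. the_elem (h`X)) \<in> iso (G Mod ?N) (F\<lparr>carrier := h ` carrier G\<rparr>)"
    using h'.FactGroup_iso_set by (simp add: ker)
  then have bij: "bij_betw (\<lambda>X. the_elem (h`X)) (rcosets\<^bsub>G\<^esub> ?N) (h ` carrier G)"
    by (simp add: iso_def FactGroup_def)
  have fin: "finite (rcosets\<^bsub>G\<^esub> ?N)"
    using bij_betw_finite[OF bij] img F(2) subgroup.subset finite_subset by metis
  have "card (rcosets\<^bsub>G\<^esub> ?N) = card (h ` carrier G)" using bij by (rule bij_betw_same_card)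
  moreover have "card (h ` carrier G) dvd p ^ k"
    using h.H.lagrange[OF img] F(3) by (metis dvd_triv_right)
  ultimately obtain l where "card (rcosets\<^bsub>G\<^esub> ?N) = p ^ l"
    using p by (auto simp: divides_primepow_nat)
  then show "\<exists>N. N \<lhd> G \<and> openin (gtop G) N \<and> N \<subseteq> W \<and>
      (\<exists>k. finite (rcosets\<^bsub>G\<^esub> N) \<and> card (rcosets\<^bsub>G\<^esub> N) = p ^ k)"
    using h.normal_kernel \<open>openin (gtop G) ?N\<close> W fin by blast
qed

lemma pro_p_group_sub:
  assumes p: "Factorial_Ring.prime p" and G: "pro_p_group p G" and H: "closed_subgroup H G"
  shows "pro_p_group p (sub_tgroup G H)"
proof (rule pro_p_groupI[where 'f = "'a set" and 'c = unit, OF p])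
  note Gd = pro_p_groupD[OF G]
  have sub: "subgroup H G" and cl: "closedin (gtop G) H"
    using H by (auto simp: closed_subgroup_def)
  have HG: "H \<subseteq> carrier G" using sub by (rule subgroup.subset)
  show tgH: "topological_group (sub_tgroup G H)"
    by (rule topological_group_sub[OF Gd(5) sub])
  show "compact_space (gtop (sub_tgroup G H))"
    using closedin_compact_space[OF Gd(3) cl] by (simp add: compact_space_subtopology)
  show "Hausdorff_space (gtop (sub_tgroup G H))"
    using Gd(4) by (simp add: Hausdorff_space_subtopology)
  fix W assume "openin (gtop (sub_tgroup G H)) W" "\<one>\<^bsub>sub_tgroup G H\<^esub> \<in> W"
  then obtain W' where W': "openin (gtop G) W'" "\<one>\<^bsub>G\<^esub> \<in> W'" "W = W' \<inter> H"
    by (auto simp: openin_subtopology)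
  then obtain N k where N: "N \<lhd> G" "openin (gtop G) N" "N \<subseteq> W'" "finite (rcosets\<^bsub>G\<^esub> N)"
    "card (rcosets\<^bsub>G\<^esub> N) = p ^ k"
    using G by (auto simp: pro_p_group_def)
  interpret normal N G by fact
  let ?h = "\<lambda>x. N #>\<^bsub>G\<^esub> x"
  have h: "?h \<in> chom G (discrete_tgroup (G Mod N))"
    by (rule coset_chom[OF Gd(5) N(1,2)])
  have "?h \<in> hom (sub_tgroup G H) (discrete_tgroup (G Mod N))"
  proof (rule homI)
    fix x y assume "x \<in> carrier (sub_tgroup G H)" "y \<in> carrier (sub_tgroup G H)"
    then have "x \<in> carrier G" "y \<in> carrier G" using HG by auto
    then show "?h (x \<otimes>\<^bsub>sub_tgroup G H\<^esub> y) = ?h x \<otimes>\<^bsub>discrete_tgroup (G Mod N)\<^esub> ?h y"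
      using rcos_sum by (simp add: FactGroup_def)
  qed (use HG in \<open>auto simp: carrier_FactGroup\<close>)
  then have "?h \<in> chom (sub_tgroup G H) (discrete_tgroup (G Mod N))"
    using h unfolding chom_def by (simp add: continuous_map_from_subtopology)
  moreover have "kernel (sub_tgroup G H) (G Mod N) ?h \<subseteq> W"
  proof
    fix x assume "x \<in> kernel (sub_tgroup G H) (G Mod N) ?h"
    then have "x \<in> H" "N #>\<^bsub>G\<^esub> x = N" by (auto simp: kernel_def FactGroup_def)
    then have "x \<in> N" using rcos_self[of x N] HG subgroup_axioms by auto
    then show "x \<in> W" using N(3) W'(3) \<open>x \<in> H\<close> by auto
  qed
  ultimately show "\<exists>(F::'a set monoid) h k. group F \<and> finite (carrier F) \<and> order F = p ^ k \<and>
      h \<in> chom (sub_tgroup G H) (discrete_tgroup F) \<and> kernel (sub_tgroup G H) F h \<subseteq> W"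
    using factorgroup_is_group N(4,5)
    by (intro exI[of _ "G Mod N"] exI[of _ ?h] exI[of _ k]) (auto simp: FactGroup_def order_def)
qed

lemma pro_p_group_product_discrete:
  fixes F :: "'d \<Rightarrow> ('a, 'b) monoid_scheme"
  assumes p: "Factorial_Ring.prime p"
    and F: "\<And>d. d \<in> D \<Longrightarrow> group (F d) \<and> finite (carrier (F d)) \<and> (\<exists>k. order (F d) = p ^ k)"
  shows "pro_p_group p (product_tgroup D (\<lambda>d. discrete_tgroup (F d)))" (is "pro_p_group p ?P")
proof (rule pro_p_groupI[where 'f = "'d \<Rightarrow> 'a" and 'c = unit, OF p])
  show "topological_group ?P"
    using F topological_group_discrete by (intro topological_group_product) auto
  show "compact_space (gtop ?P)"
    using F by (auto simp: compact_space_product_topology compact_space_discrete_topology)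
  show "Hausdorff_space (gtop ?P)"
    by (auto simp: Hausdorff_space_product_topology)
  fix W assume W: "openin (gtop ?P) W" "\<one>\<^bsub>?P\<^esub> \<in> W"
  then obtain U where U: "finite {d \<in> D. U d \<noteq> carrier (F d)}" "\<forall>d\<in>D. U d \<subseteq> carrier (F d)"
    "(\<lambda>d\<in>D. \<one>\<^bsub>F d\<^esub>) \<in> Pi\<^sub>E D U" "Pi\<^sub>E D U \<subseteq> W"
    by (auto simp: openin_product_topology_alt)
  define K where "K = {d \<in> D. U d \<noteq> carrier (F d)}"
  have K: "finite K" "K \<subseteq> D" using U(1) by (auto simp: K_def)
  let ?F = "product_group K F" and ?h = "\<lambda>x. restrict x K"
  have gF: "group ?F" using K F by (intro product_group) auto
  have finF: "finite (carrier ?F)" using K F by (auto intro!: finite_PiE)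
  obtain k where k: "\<And>d. d \<in> D \<Longrightarrow> order (F d) = p ^ k d" using F by metis
  have "order ?F = (\<Prod>d\<in>K. p ^ k d)"
    using K k by (auto simp: order_def card_PiE intro!: prod.cong)
  then have ord: "order ?F = p ^ (\<Sum>d\<in>K. k d)" by (simp add: power_sum)
  have top: "topspace (gtop ?P) = carrier ?P" by simp
  have "?h \<in> hom ?P ?F"
    using K by (auto simp: hom_def PiE_iff restrict_def fun_eq_iff subset_iff)
  moreover have "openin (gtop ?P) {x \<in> carrier ?P. ?h x = y}" if "y \<in> carrier ?F" for y
  proof -
    have y: "y \<in> (\<Pi>\<^sub>E d\<in>K. carrier (F d))" using that by simp
    have "{x \<in> carrier ?P. ?h x = y} = (\<Pi>\<^sub>E d\<in>D. if d \<in> K then {y d} else carrier (F d))"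
    proof (rule Set.set_eqI, rule iffI)
      fix x assume x: "x \<in> (\<Pi>\<^sub>E d\<in>D. if d \<in> K then {y d} else carrier (F d))"
      have "x d \<in> carrier (F d)" if "d \<in> D" for d
        using PiE_mem[OF x that] y by (auto split: if_splits)
      moreover have "restrict x K = y"
      proof
        fix d show "restrict x K d = y d"
          using PiE_mem[OF x, of d] PiE_arb[OF y, of d] K(2) by (cases "d \<in> K") (simp_all add: subset_iff)
      qed
      ultimately show "x \<in> {x \<in> carrier ?P. ?h x = y}" using x by (auto simp: PiE_iff)
    qed (auto simp: PiE_iff)
    moreover have "finite {d \<in> D. (if d \<in> K then {y d} else carrier (F d)) \<noteq> carrier (F d)}"
      by (rule finite_subset[OF _ K(1)]) auto
    ultimately show ?thesis using y K(2) by (auto simp: openin_PiE_gen)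
  qed
  ultimately have "?h \<in> chom ?P (discrete_tgroup ?F)"
    using chom_discrete_iff[OF top] by blast
  moreover have "kernel ?P ?F ?h \<subseteq> W"
  proof
    fix x assume "x \<in> kernel ?P ?F ?h"
    then have x: "x \<in> (\<Pi>\<^sub>E d\<in>D. carrier (F d))" and h: "restrict x K = (\<lambda>d\<in>K. \<one>\<^bsub>F d\<^esub>)"
      by (auto simp: kernel_def)
    have "x d \<in> U d" if "d \<in> D" for d
    proof (cases "d \<in> K")
      case True
      then have "x d = \<one>\<^bsub>F d\<^esub>" using fun_cong[OF h, of d] by simp
      then show ?thesis using U(3) that by (auto simp: PiE_iff)
    next
      case False
      then show ?thesis using x that by (auto simp: K_def)
    qed
    then have "x \<in> Pi\<^sub>E D U" using x by (simp add: PiE_iff)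
    then show "x \<in> W" using U(4) by blast
  qed
  ultimately show "\<exists>(F::('d \<Rightarrow> 'a) monoid) h k. group F \<and> finite (carrier F) \<and> order F = p ^ k \<and>
      h \<in> chom ?P (discrete_tgroup F) \<and> kernel ?P F h \<subseteq> W"
    using gF finF ord by blast
qed

lemma closed_subgroup_generate:
  assumes G: "topological_group G" and S: "S \<subseteq> carrier G"
  shows "closed_subgroup (closed_generate G S) G" "S \<subseteq> closed_generate G S"
proof -
  have gG: "group G" and top: "topspace (gtop G) = carrier G"
    using G by (auto simp: topological_group_def)
  let ?\<H> = "{H. closed_subgroup H G \<and> S \<subseteq> H}"
  have "carrier G \<in> ?\<H>"
    using S closedin_topspace[of "gtop G"] group.subgroup_self[OF gG]
    by (simp add: closed_subgroup_def top)
  then have ne: "?\<H> \<noteq> {}" by blast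
  have "subgroup (\<Inter>?\<H>) G"
    by (rule group.subgroups_Inter[OF gG _ ne]) (simp add: closed_subgroup_def)
  moreover have "closedin (gtop G) (\<Inter>?\<H>)"
    by (rule closedin_Inter[OF ne]) (simp add: closed_subgroup_def)
  ultimately show "closed_subgroup (closed_generate G S) G"
    by (simp add: closed_generate_def closed_subgroup_def)
  show "S \<subseteq> closed_generate G S" by (auto simp: closed_generate_def)
qed

lemma closed_generate_subset: "closed_subgroup H G \<Longrightarrow> S \<subseteq> H \<Longrightarrow> closed_generate G S \<subseteq> H"
  by (auto simp: closed_generate_def)

lemma pro_p_group_target_product:
  assumes "Factorial_Ring.prime p"
  shows "pro_p_group p (target_product p I T)"
  unfolding target_product_def
  by (rule pro_p_group_product_discrete[OF assms]) (auto simp: finite_p_targets_def)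

lemma free_inclusion_carrier:
  assumes "i \<in> I" "x \<in> carrier (T i)"
  shows "free_inclusion p I T i x \<in> carrier (target_product p I T)"
  using assms
  by (force simp: free_inclusion_def target_product_def finite_p_targets_def chom_def hom_def)

lemma free_closed_subgroup:
  assumes "Factorial_Ring.prime p"
  shows "closed_subgroup (closed_generate (target_product p I T)
      (\<Union>i\<in>I. free_inclusion p I T i ` carrier (T i))) (target_product p I T)"
  using free_inclusion_carrier[of _ I _ T p]
  by (intro closed_subgroup_generate(1) pro_p_groupD(5)[OF pro_p_group_target_product[OF assms]]) auto

lemma pro_p_group_free_pro_p_product:
  assumes "Factorial_Ring.prime p"
  shows "pro_p_group p (free_pro_p_product p I T)"
  unfolding free_pro_p_product_def
  by (rule pro_p_group_sub[OF assms pro_p_group_target_product[OF assms] free_closed_subgroup[OF assms]])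

lemma free_inclusion_mem:
  assumes "i \<in> I" "x \<in> carrier (T i)"
  shows "free_inclusion p I T i x \<in> carrier (free_pro_p_product p I T)"
  using assms by (auto simp: free_pro_p_product_def closed_generate_def)

lemma free_inclusion_chom:
  assumes i: "i \<in> I" and T: "topological_group (T i)"
  shows "free_inclusion p I T i \<in> chom (T i) (free_pro_p_product p I T)"
proof -
  let ?D = "finite_p_targets p I T"
  have gT: "group (T i)" and top: "topspace (gtop (T i)) = carrier (T i)"
    using T by (auto simp: topological_group_def)
  have d: "snd d i \<in> chom (T i) (discrete_tgroup (fst d))" if "d \<in> ?D" for d
    using that i by (auto simp: finite_p_targets_def)
  have "free_inclusion p I T i \<in> hom (T i) (free_pro_p_product p I T)"
  proof (rule homI)
    fix x y assume xy: "x \<in> carrier (T i)" "y \<in> carrier (T i)"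
    then have "snd d i (x \<otimes>\<^bsub>T i\<^esub> y) = snd d i x \<otimes>\<^bsub>fst d\<^esub> snd d i y" if "d \<in> ?D" for d
      using d[OF that] by (auto simp: chom_def hom_def)
    then show "free_inclusion p I T i (x \<otimes>\<^bsub>T i\<^esub> y) =
        free_inclusion p I T i x \<otimes>\<^bsub>free_pro_p_product p I T\<^esub> free_inclusion p I T i y"
      by (auto simp: free_inclusion_def free_pro_p_product_def target_product_def intro!: restrict_ext)
  qed (rule free_inclusion_mem[OF i])
  moreover have "continuous_map (gtop (T i)) (gtop (free_pro_p_product p I T)) (free_inclusion p I T i)"
  proof -
    have "continuous_map (gtop (T i)) (discrete_topology (carrier (fst d))) (snd d i)" if "d \<in> ?D" for d
      using d[OF that] by (simp add: chom_def)
    then have "continuous_map (gtop (T i)) (gtop (target_product p I T)) (free_inclusion p I T i)"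
      unfolding target_product_def product_tgroup_simps continuous_map_componentwise free_inclusion_def
      by auto
    then show ?thesis
      using free_inclusion_mem[OF i, where T = T and p = p]
      by (auto simp: free_pro_p_product_def continuous_map_in_subtopology top)
  qed
  ultimately show ?thesis by (simp add: chom_def)
qed

lemma chom_eq_on_closed_generate:
  assumes G: "topological_group G" and H: "topological_group H" "Hausdorff_space (gtop H)"
    and f: "f \<in> chom G H" and g: "g \<in> chom G H" and eq: "\<And>x. x \<in> S \<Longrightarrow> f x = g x" and S: "S \<subseteq> carrier G"
    and x: "x \<in> closed_generate G S"
  shows "f x = g x"
proof -
  have gG: "group G" and gH: "group H" and top: "topspace (gtop G) = carrier G"
    using G H by (auto simp: topological_group_def)
  interpret f: group_hom G H f using f gG gH by (simp add: group_hom_def group_hom_axioms_def chom_def)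
  interpret g: group_hom G H g using g gG gH by (simp add: group_hom_def group_hom_axioms_def chom_def)
  let ?E = "{x \<in> carrier G. f x = g x}"
  have "closedin (gtop G) ?E"
    using closedin_continuous_maps_eq[OF H(2), of "gtop G" f g] f g by (simp add: chom_def top)
  moreover have "subgroup ?E G"
    by (rule group.subgroupI[OF gG]) auto
  ultimately have "closed_generate G S \<subseteq> ?E"
    using S eq by (intro closed_generate_subset) (auto simp: closed_subgroup_def)
  then show ?thesis using x by blast
qed

lemma closed_generate_sub:
  assumes G: "topological_group G" and S: "S \<subseteq> carrier G"
  defines "H \<equiv> closed_generate G S"
  shows "closed_generate (sub_tgroup G H) S = H"
proof
  have H: "closed_subgroup H G" and SH: "S \<subseteq> H"
    using closed_subgroup_generate[OF G S] by (auto simp: H_def)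
  have gG: "group G" using G by (simp add: topological_group_def)
  have sH: "subgroup H G" and cH: "closedin (gtop G) H" using H by (auto simp: closed_subgroup_def)
  have tH: "topological_group (sub_tgroup G H)" by (rule topological_group_sub[OF G sH])
  show "closed_generate (sub_tgroup G H) S \<subseteq> H"
    using closed_subgroup_generate(1)[OF tH, of S] SH subgroup.subset
    by (fastforce simp: closed_subgroup_def)
  have "closed_subgroup (closed_generate (sub_tgroup G H) S) G"
  proof -
    let ?K = "closed_generate (sub_tgroup G H) S"
    have K: "subgroup ?K (sub_tgroup G H)" "closedin (subtopology (gtop G) H) ?K"
      using closed_subgroup_generate(1)[OF tH, of S] SH by (auto simp: closed_subgroup_def)
    have KH: "?K \<subseteq> H" using subgroup.subset[OF K(1)] by simp
    have "subgroup ?K G"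
    proof (rule group.subgroupI[OF gG])
      show "?K \<subseteq> carrier G" using KH subgroup.subset[OF sH] by blast
      show "?K \<noteq> {}" using subgroup.one_closed[OF K(1)] by blast
      fix a b assume a: "a \<in> ?K"
      show "inv\<^bsub>G\<^esub> a \<in> ?K"
        using subgroup.m_inv_closed[OF K(1) a] inv_sub_tgroup[OF gG sH, of a] a KH by auto
      assume "b \<in> ?K"
      then show "a \<otimes>\<^bsub>G\<^esub> b \<in> ?K" using subgroup.m_closed[OF K(1) a] by simp
    qed
    moreover have "closedin (gtop G) ?K" using closedin_trans_full[OF K(2) cH] .
    ultimately show ?thesis by (simp add: closed_subgroup_def)
  qed
  moreover have "S \<subseteq> closed_generate (sub_tgroup G H) S" by (auto simp: closed_generate_def)
  ultimately show "H \<subseteq> closed_generate (sub_tgroup G H) S"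
    unfolding H_def by (rule closed_generate_subset)
qed

lemma free_pro_p_product_generated:
  assumes "Factorial_Ring.prime p"
  shows "closed_generate (free_pro_p_product p I T) (\<Union>i\<in>I. free_inclusion p I T i ` carrier (T i)) =
    carrier (free_pro_p_product p I T)"
  unfolding free_pro_p_product_def sub_tgroup_simps
  using free_inclusion_carrier[of _ I _ T p]
  by (intro closed_generate_sub pro_p_groupD(5)[OF pro_p_group_target_product[OF assms]]) auto

lemma chom_compose: "f \<in> chom G H \<Longrightarrow> g \<in> chom H K \<Longrightarrow> (\<lambda>x. g (f x)) \<in> chom G K"
  using continuous_map_compose[of "gtop G" "gtop H" f "gtop K" g]
  by (auto simp: chom_def hom_def o_def Pi_iff)

lemma free_pro_p_product_lift_exists:
  fixes H :: "('h, 'c) tgroup_scheme" and I :: "'i set" and T :: "'i \<Rightarrow> 'a tgroup"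
  assumes p: "Factorial_Ring.prime p" and H: "pro_p_group p H"
    and \<phi>: "\<And>i. i \<in> I \<Longrightarrow> \<phi> i \<in> chom (T i) H"
  shows "\<exists>\<psi>\<in>chom (free_pro_p_product p I T) H.
      \<forall>i\<in>I. \<forall>x\<in>carrier (T i). \<psi> (free_inclusion p I T i x) = \<phi> i x"
proof -
  note Hd = pro_p_groupD[OF H]
  interpret H: group H by (rule Hd(1))
  let ?D = "finite_p_targets p I T"
  let ?P = "target_product p I T"
  let ?FP = "free_pro_p_product p I T"
  note Pd = pro_p_groupD[OF pro_p_group_target_product[OF p, of I T]]
  define \<N> where "\<N> = {N. N \<lhd> H \<and> openin (gtop H) N \<and> (\<exists>k. finite (rcosets\<^bsub>H\<^esub> N) \<and> card (rcosets\<^bsub>H\<^esub> N) = p ^ k)}"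
  have "\<exists>e::'h set \<Rightarrow> nat. inj_on e (carrier (H Mod N))" if "N \<in> \<N>" for N
  proof -
    have "finite (carrier (H Mod N))" using that by (auto simp: \<N>_def FactGroup_def)
    then show ?thesis using finite_imp_inj_to_nat_seg by blast
  qed
  then obtain e :: "'h set \<Rightarrow> 'h set \<Rightarrow> nat" where e: "\<And>N. N \<in> \<N> \<Longrightarrow> inj_on (e N) (carrier (H Mod N))"
    by metis
  define F where "F N = flatten (H Mod N) (e N)" for N
  define q where "q N x = e N (N #>\<^bsub>H\<^esub> x)" for N x
  have gF: "group (F N)" and finF: "finite (carrier (F N))" and oF: "\<exists>k. order (F N) = p ^ k"
    and q: "q N \<in> chom H (discrete_tgroup (F N))"
    and qN: "\<And>x. x \<in> carrier H \<Longrightarrow> q N x = q N \<one>\<^bsub>H\<^esub> \<Longrightarrow> x \<in> N" if N: "N \<in> \<N>" for N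
  proof -
    have N': "N \<lhd> H" "openin (gtop H) N" using N by (auto simp: \<N>_def)
    interpret N: normal N H by fact
    show "group (F N)" unfolding F_def by (rule flatten_set_group[OF N.factorgroup_is_group e[OF N]])
    show "finite (carrier (F N))" using N by (auto simp: F_def flatten_def \<N>_def FactGroup_def)
    show "\<exists>k. order (F N) = p ^ k"
      using N card_image[OF e[OF N]] by (auto simp: F_def flatten_def \<N>_def FactGroup_def order_def)
    have "e N \<in> chom (discrete_tgroup (H Mod N)) (discrete_tgroup (F N))"
      using flatten_set_group_hom[OF N.factorgroup_is_group e[OF N]]
      by (auto simp: chom_def F_def hom_def)
    then show "q N \<in> chom H (discrete_tgroup (F N))"
      using chom_compose[OF coset_chom[OF Hd(5) N']] by (simp add: q_def[abs_def])
    fix x assume x: "x \<in> carrier H" and eq: "q N x = q N \<one>\<^bsub>H\<^esub>"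
    have "N #>\<^bsub>H\<^esub> y \<in> carrier (H Mod N)" if "y \<in> carrier H" for y
      using that unfolding carrier_FactGroup by (rule imageI)
    then have "N #>\<^bsub>H\<^esub> x = N #>\<^bsub>H\<^esub> \<one>\<^bsub>H\<^esub>"
      using inj_onD[OF e[OF N]] eq x H.one_closed unfolding q_def by blast
    then have "N #>\<^bsub>H\<^esub> x = N" using H.coset_mult_one[OF N.subset] by simp
    then show "x \<in> N" using H.rcos_self[OF x N.subgroup_axioms] by simp
  qed
  define c where "c N = (F N, \<lambda>i x. q N (\<phi> i x))" for N
  have c: "c N \<in> ?D" if "N \<in> \<N>" for N
    using gF[OF that] finF[OF that] oF[OF that] chom_compose[OF \<phi> q[OF that]]
    by (auto simp: c_def finite_p_targets_def)
  define Q where "Q = product_tgroup \<N> (\<lambda>N. discrete_tgroup (F N))"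
  have tQ: "topological_group Q"
    unfolding Q_def using gF by (intro topological_group_product topological_group_discrete)
  have hQ: "Hausdorff_space (gtop Q)"
    by (auto simp: Q_def Hausdorff_space_product_topology)
  have gQ: "group Q" using tQ by (simp add: topological_group_def)
  define \<alpha> where "\<alpha> x = (\<lambda>N\<in>\<N>. q N x)" for x
  define \<beta> where "\<beta> f = (\<lambda>N\<in>\<N>. f (c N))" for f :: "nat monoid \<times> ('i \<Rightarrow> 'a \<Rightarrow> nat) \<Rightarrow> nat"
  have \<alpha>: "\<alpha> \<in> chom H Q"
  proof -
    have "continuous_map (gtop H) (gtop Q) \<alpha>"
      unfolding Q_def product_tgroup_simps continuous_map_componentwise \<alpha>_def
      using q by (auto simp: chom_def)
    moreover have "\<alpha> \<in> hom H Q"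
      using q by (auto simp: Q_def \<alpha>_def chom_def hom_def Pi_iff intro!: restrict_ext)
    ultimately show ?thesis by (simp add: chom_def)
  qed
  have \<beta>: "\<beta> \<in> chom ?P Q"
  proof -
    have "continuous_map (gtop ?P) (discrete_topology (carrier (F N))) (\<lambda>f. f (c N))" if "N \<in> \<N>" for N
      using continuous_map_product_projection[OF c[OF that], of "\<lambda>d. discrete_topology (carrier (fst d))"]
      by (simp add: target_product_def c_def)
    then have "continuous_map (gtop ?P) (gtop Q) \<beta>"
      unfolding Q_def product_tgroup_simps continuous_map_componentwise \<beta>_def by auto
    moreover have "\<beta> \<in> hom ?P Q"
    proof (rule homI)
      fix f g assume fg: "f \<in> carrier ?P" "g \<in> carrier ?P"
      have "f \<in> (\<Pi>\<^sub>E d\<in>?D. carrier (fst d))" using fg(1) by (simp add: target_product_def)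
      from PiE_mem[OF this c] have "f (c N) \<in> carrier (F N)" if "N \<in> \<N>" for N
        using that by (simp add: c_def)
      then show "\<beta> f \<in> carrier Q" by (auto simp: Q_def \<beta>_def)
      show "\<beta> (f \<otimes>\<^bsub>?P\<^esub> g) = \<beta> f \<otimes>\<^bsub>Q\<^esub> \<beta> g"
        using c by (auto simp: Q_def \<beta>_def target_product_def c_def intro!: restrict_ext)
    qed
    ultimately show ?thesis by (simp add: chom_def)
  qed
  interpret \<alpha>: group_hom H Q \<alpha>
    using \<alpha> gQ by (simp add: group_hom_def group_hom_axioms_def chom_def H.is_group)
  interpret \<beta>: group_hom ?P Q \<beta>
    using \<beta> gQ Pd(1) by (simp add: group_hom_def group_hom_axioms_def chom_def)
  have ker: "x = \<one>\<^bsub>H\<^esub>" if x: "x \<in> carrier H" "\<alpha> x = \<one>\<^bsub>Q\<^esub>" for x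
  proof (rule ccontr)
    assume "x \<noteq> \<one>\<^bsub>H\<^esub>"
    then obtain U V where UV: "openin (gtop H) U" "openin (gtop H) V" "\<one>\<^bsub>H\<^esub> \<in> U" "x \<in> V" "disjnt U V"
      using Hd(2,4) x(1) H.one_closed unfolding Hausdorff_space_def by metis
    then obtain N where N: "N \<in> \<N>" "N \<subseteq> U"
      using H unfolding pro_p_group_def \<N>_def by blast
    have "\<alpha> x = \<alpha> \<one>\<^bsub>H\<^esub>" using x(2) \<alpha>.hom_one by simp
    then have "\<alpha> x N = \<alpha> \<one>\<^bsub>H\<^esub> N" by simp
    then have "q N x = q N \<one>\<^bsub>H\<^esub>" using N(1) by (simp add: \<alpha>_def)
    then have "x \<in> N" by (rule qN[OF N(1) x(1)])
    then show False using N(2) UV by (auto simp: disjnt_iff)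
  qed
  have inj: "inj_on \<alpha> (carrier H)"
    using ker by (intro \<alpha>.trivial_ker_imp_inj) (auto simp: kernel_def)
  define R where "R = \<alpha> ` carrier H"
  have closR: "closedin (gtop Q) R"
  proof -
    have "compactin (gtop Q) R"
      unfolding R_def using \<alpha> Hd(2,3)
      by (intro image_compactin[of "gtop H"]) (auto simp: chom_def compact_space_def)
    then show ?thesis by (rule compactin_imp_closedin[OF hQ])
  qed
  have sR: "subgroup R Q" unfolding R_def by (rule \<alpha>.img_is_subgroup)
  define g where "g = inv_into (carrier H) \<alpha>"
  have g: "g (\<alpha> x) = x" if "x \<in> carrier H" for x
    unfolding g_def using inv_into_f_f[OF inj that] .
  have g': "g y \<in> carrier H" "\<alpha> (g y) = y" if "y \<in> R" for y
    using that g by (auto simp: R_def)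
  have cg: "continuous_map (subtopology (gtop Q) R) (gtop H) g"
    using \<alpha> g by (intro continuous_inverse_map[OF Hd(3) hQ]) (auto simp: chom_def R_def Hd(2))
  have gen: "carrier ?FP \<subseteq> {f \<in> carrier ?P. \<beta> f \<in> R}"
    unfolding free_pro_p_product_def sub_tgroup_simps
  proof (rule closed_generate_subset)
    have "closedin (gtop ?P) {f \<in> topspace (gtop ?P). \<beta> f \<in> R}"
      using \<beta> closR by (intro closedin_continuous_map_preimage) (auto simp: chom_def)
    moreover have "subgroup {f \<in> carrier ?P. \<beta> f \<in> R} ?P"
      using subgroup.m_closed[OF sR] subgroup.m_inv_closed[OF sR] subgroup.one_closed[OF sR]
      by (intro group.subgroupI[OF Pd(1)]) auto
    ultimately show "closed_subgroup {f \<in> carrier ?P. \<beta> f \<in> R} ?P"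
      by (simp add: closed_subgroup_def Pd(2))
    have "\<beta> (free_inclusion p I T i x) = \<alpha> (\<phi> i x)" if "i \<in> I" "x \<in> carrier (T i)" for i x
      using c by (auto simp: \<beta>_def \<alpha>_def free_inclusion_def c_def intro!: restrict_ext)
    moreover have "\<phi> i x \<in> carrier H" if "i \<in> I" "x \<in> carrier (T i)" for i x
      using \<phi>[OF that(1)] that(2) by (auto simp: chom_def hom_def)
    ultimately show "(\<Union>i\<in>I. free_inclusion p I T i ` carrier (T i)) \<subseteq> {f \<in> carrier ?P. \<beta> f \<in> R}"
      using free_inclusion_carrier[of _ I _ T p] by (auto simp: R_def)
  qed
  define \<psi> where "\<psi> f = g (\<beta> f)" for f
  have "\<psi> \<in> hom ?FP H"
  proof (rule homI)
    fix x y assume "x \<in> carrier ?FP" "y \<in> carrier ?FP"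
    then have xy: "x \<in> carrier ?P" "y \<in> carrier ?P" "\<beta> x \<in> R" "\<beta> y \<in> R" using gen by auto
    show "\<psi> x \<in> carrier H" using g'(1)[OF xy(3)] by (simp add: \<psi>_def)
    have "\<beta> (x \<otimes>\<^bsub>?P\<^esub> y) = \<alpha> (g (\<beta> x) \<otimes>\<^bsub>H\<^esub> g (\<beta> y))"
      using xy g' by simp
    then show "\<psi> (x \<otimes>\<^bsub>?FP\<^esub> y) = \<psi> x \<otimes>\<^bsub>H\<^esub> \<psi> y"
      using g[of "g (\<beta> x) \<otimes>\<^bsub>H\<^esub> g (\<beta> y)"] g'(1)[OF xy(3)] g'(1)[OF xy(4)]
      by (simp add: \<psi>_def free_pro_p_product_def)
  qed
  moreover have "continuous_map (gtop ?FP) (gtop H) \<psi>"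
  proof -
    have "continuous_map (gtop ?FP) (subtopology (gtop Q) R) \<beta>"
      using \<beta> gen
      by (auto simp: free_pro_p_product_def chom_def continuous_map_in_subtopology continuous_map_from_subtopology)
    from continuous_map_compose[OF this cg] show ?thesis by (simp add: \<psi>_def[abs_def] o_def)
  qed
  moreover have "\<psi> (free_inclusion p I T i x) = \<phi> i x" if "i \<in> I" "x \<in> carrier (T i)" for i x
  proof -
    have "\<beta> (free_inclusion p I T i x) = \<alpha> (\<phi> i x)"
      using c by (auto simp: \<beta>_def \<alpha>_def free_inclusion_def c_def intro!: restrict_ext)
    moreover have "\<phi> i x \<in> carrier H"
      using \<phi>[OF that(1)] that(2) by (auto simp: chom_def hom_def)
    ultimately show ?thesis by (simp add: \<psi>_def g)
  qed
  ultimately show ?thesis by (auto simp: chom_def)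
qed

theorem free_pro_p_product_universal:
  fixes H :: "('h, 'c) tgroup_scheme" and I :: "'i set" and T :: "'i \<Rightarrow> 'a tgroup"
  assumes p: "Factorial_Ring.prime p" and H: "pro_p_group p H"
    and \<phi>: "\<And>i. i \<in> I \<Longrightarrow> \<phi> i \<in> chom (T i) H"
  shows "\<exists>!\<psi>. \<psi> \<in> chom (free_pro_p_product p I T) H \<and>
             \<psi> \<in> extensional (carrier (free_pro_p_product p I T)) \<and>
             (\<forall>i\<in>I. \<forall>x\<in>carrier (T i). \<psi> (free_inclusion p I T i x) = \<phi> i x)"
proof -
  let ?FP = "free_pro_p_product p I T"
  note Fd = pro_p_groupD[OF pro_p_group_free_pro_p_product[OF p, of I T]]
  note Hd = pro_p_groupD[OF H]
  have "\<exists>\<psi>\<in>chom ?FP H. \<forall>i\<in>I. \<forall>x\<in>carrier (T i). \<psi> (free_inclusion p I T i x) = \<phi> i x"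
    by (rule free_pro_p_product_lift_exists[OF p H \<phi>])
  then obtain \<psi> where \<psi>: "\<psi> \<in> chom ?FP H"
    "\<And>i x. i \<in> I \<Longrightarrow> x \<in> carrier (T i) \<Longrightarrow> \<psi> (free_inclusion p I T i x) = \<phi> i x"
    by blast
  show ?thesis
  proof (rule ex1I[of _ "restrict \<psi> (carrier ?FP)"], intro conjI ballI)
    have "restrict \<psi> (carrier ?FP) \<in> hom ?FP H"
      using \<psi>(1) group.is_monoid[OF Fd(1)] by (auto simp: chom_def hom_def monoid.m_closed)
    moreover have "continuous_map (gtop ?FP) (gtop H) (restrict \<psi> (carrier ?FP))"
      by (rule continuous_map_eq[of _ _ \<psi>]) (use \<psi>(1) Fd(2) in \<open>auto simp: chom_def\<close>)
    ultimately show "restrict \<psi> (carrier ?FP) \<in> chom ?FP H" by (simp add: chom_def)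
    show "restrict \<psi> (carrier ?FP) \<in> extensional (carrier ?FP)" by simp
    show "restrict \<psi> (carrier ?FP) (free_inclusion p I T i x) = \<phi> i x"
      if "i \<in> I" "x \<in> carrier (T i)" for i x
      using \<psi>(2)[OF that] free_inclusion_mem[of i I x T p] that by simp
  next
    fix \<theta> assume \<theta>: "\<theta> \<in> chom ?FP H \<and> \<theta> \<in> extensional (carrier ?FP) \<and>
      (\<forall>i\<in>I. \<forall>x\<in>carrier (T i). \<theta> (free_inclusion p I T i x) = \<phi> i x)"
    have eq: "\<theta> x = \<psi> x" if x: "x \<in> carrier ?FP" for x
    proof (rule chom_eq_on_closed_generate[OF Fd(5) Hd(5,4)])
      show "x \<in> closed_generate ?FP (\<Union>i\<in>I. free_inclusion p I T i ` carrier (T i))"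
        using x free_pro_p_product_generated[OF p] by metis
    qed (use \<theta> \<psi> free_inclusion_mem[of _ I _ T p] in auto)
    show "\<theta> = restrict \<psi> (carrier ?FP)"
    proof
      fix x show "\<theta> x = restrict \<psi> (carrier ?FP) x"
        using eq \<theta> by (cases "x \<in> carrier ?FP") (auto simp: extensional_def)
    qed
  qed
qed

corollary free_induced_works:
  assumes "Factorial_Ring.prime p" "pro_p_group p H" "\<And>i. i \<in> I \<Longrightarrow> \<phi> i \<in> chom (T i) H"
  shows "free_induced p I T H \<phi> \<in> chom (free_pro_p_product p I T) H \<and>
    free_induced p I T H \<phi> \<in> extensional (carrier (free_pro_p_product p I T)) \<and>
    (\<forall>i\<in>I. \<forall>x\<in>carrier (T i). free_induced p I T H \<phi> (free_inclusion p I T i x) = \<phi> i x)"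
  unfolding free_induced_def
  by (rule theI'[OF free_pro_p_product_universal]) (fact assms)+

section \<open>Linking structures\<close>

text \<open>The fixed data of a linking structure; the conditions on them are collected in
  \<open>pro_p_linking_structure\<close> and are part of every notion defined for linking structures.
  The section of \<open>Z i \<rightarrow> Z i / T i\<close> is part of the data; elements of \<open>Z i / T i\<close> are cosets.\<close>

record ('i, 'g, 'u, 'z) linking =
  lkG :: "'g tgroup"
  lkU :: "'u tgroup"
  lkI :: "'i set"
  lkZ :: "'i \<Rightarrow> 'z tgroup"
  lkT :: "'i \<Rightarrow> 'z set"
  lksec :: "'i \<Rightarrow> 'z set \<Rightarrow> 'z"
  lklam :: "'i \<Rightarrow> 'z \<Rightarrow> 'g"
  lkpi :: "'i \<Rightarrow> 'z \<Rightarrow> 'u"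

definition hom_section :: "('a, 'b) tgroup_scheme \<Rightarrow> 'a set \<Rightarrow> ('a set \<Rightarrow> 'a) \<Rightarrow> bool" where
  "hom_section Z T s \<longleftrightarrow>
     s \<in> chom (quot_tgroup Z T) Z \<and> (\<forall>C\<in>carrier (quot_tgroup Z T). T #>\<^bsub>Z\<^esub> s C = C)"

definition section_image :: "('a, 'b) tgroup_scheme \<Rightarrow> 'a set \<Rightarrow> ('a set \<Rightarrow> 'a) \<Rightarrow> 'a set" where
  "section_image Z T s = s ` carrier (quot_tgroup Z T)"

abbreviation lkZbar :: "('i, 'g, 'u, 'z) linking \<Rightarrow> 'i \<Rightarrow> 'z set" where
  "lkZbar L i \<equiv> section_image (lkZ L i) (lkT L i) (lksec L i)"

definition pro_p_linking_structure :: "nat \<Rightarrow> ('i, 'g, 'u, 'z) linking \<Rightarrow> bool" where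
  "pro_p_linking_structure p L \<longleftrightarrow>
     pro_p_group p (lkG L) \<and> pro_p_group p (lkU L) \<and>
     (\<forall>i\<in>lkI L. pro_p_group p (lkZ L i) \<and> closed_normal (lkT L i) (lkZ L i) \<and>
        hom_section (lkZ L i) (lkT L i) (lksec L i) \<and>
        lklam L i \<in> chom (lkZ L i) (lkG L) \<and>
        lkpi L i \<in> chom (sub_tgroup (lkZ L i) (lkT L i)) (lkU L)) \<and>
     closed_generate (lkG L) (\<Union>i\<in>lkI L. lklam L i ` lkT L i) = carrier (lkG L)"

definition globalization :: "nat \<Rightarrow> ('i, 'g, 'u, 'z) linking \<Rightarrow> ('g \<Rightarrow> 'u) \<Rightarrow> bool" where
  "globalization p L \<rho> \<longleftrightarrow>
     pro_p_linking_structure p L \<and> \<rho> \<in> chom (lkG L) (lkU L) \<and>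
     (\<forall>i\<in>lkI L. \<forall>\<tau>\<in>lkT L i. \<rho> (lklam L i \<tau>) = lkpi L i \<tau>)"

definition linking_quot :: "('i, 'g, 'u, 'z) linking \<Rightarrow> 'u set \<Rightarrow> ('i, 'g, 'u set, 'z) linking" where
  "linking_quot L V =
     \<lparr>lkG = lkG L, lkU = quot_tgroup (lkU L) V, lkI = lkI L, lkZ = lkZ L, lkT = lkT L,
      lksec = lksec L, lklam = lklam L, lkpi = (\<lambda>i \<tau>. V #>\<^bsub>lkU L\<^esub> lkpi L i \<tau>)\<rparr>"

definition V_link_type :: "nat \<Rightarrow> ('i, 'g, 'u, 'z) linking \<Rightarrow> 'u set \<Rightarrow> bool" where
  "V_link_type p L V \<longleftrightarrow>
     pro_p_linking_structure p L \<and> closed_normal V (lkU L) \<and>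
     (let T = (\<lambda>i. sub_tgroup (lkZ L i) (lkT L i));
          That = free_pro_p_product p (lkI L) T;
          lam = free_induced p (lkI L) T (lkG L) (lklam L);
          pih = free_induced p (lkI L) T (lkU L) (lkpi L);
          Zhat = (\<lambda>i. {x \<in> carrier That. lam x \<in> lklam L i ` lkZbar L i});
          A = {x \<in> carrier That. pih x \<in> centralizer_of (lkU L) V}
      in \<exists>S \<subseteq> (\<Union>i\<in>lkI L. kernel That (lkU L) pih <#>\<^bsub>That\<^esub> closed_commutator That A (Zhat i)).
           kernel That (lkG L) lam = closed_normal_generate That S)"


section \<open>Unitriangular groups\<close>

text \<open>Matrices of size \<open>n + 1\<close> are extensional functions on \<open>{1..n+1} \<times> {1..n+1}\<close>.\<close>

abbreviation mat_idx :: "nat \<Rightarrow> (nat \<times> nat) set" where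
  "mat_idx n \<equiv> {1..n+1} \<times> {1..n+1}"

definition unitri_carrier :: "('r, 'b) ring_scheme \<Rightarrow> nat \<Rightarrow> (nat \<times> nat \<Rightarrow> 'r) set" where
  "unitri_carrier R n =
     {A \<in> mat_idx n \<rightarrow>\<^sub>E carrier R.
        (\<forall>i\<in>{1..n+1}. A (i, i) = \<one>\<^bsub>R\<^esub>) \<and>
        (\<forall>i\<in>{1..n+1}. \<forall>j\<in>{1..n+1}. j < i \<longrightarrow> A (i, j) = \<zero>\<^bsub>R\<^esub>)}"

definition unitri :: "('r, 'b) tring_scheme \<Rightarrow> nat \<Rightarrow> (nat \<times> nat \<Rightarrow> 'r) tgroup" where
  "unitri R n =
     \<lparr>carrier = unitri_carrier R n,
      mult = (\<lambda>A B. \<lambda>(i, j)\<in>mat_idx n. \<Oplus>\<^bsub>R\<^esub>k\<in>{1..n+1}. A (i, k) \<otimes>\<^bsub>R\<^esub> B (k, j)),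
      one = (\<lambda>(i, j)\<in>mat_idx n. if i = j then \<one>\<^bsub>R\<^esub> else \<zero>\<^bsub>R\<^esub>),
      gtop = subtopology (product_topology (\<lambda>_. rtop R) (mat_idx n)) (unitri_carrier R n)\<rparr>"

text \<open>\<open>unitri_elem R n l a\<close> is \<open>Id + a E\<^sub>l\<^sub>,\<^sub>l\<^sub>+\<^sub>1\<close>.\<close>

definition unitri_elem :: "('r, 'b) ring_scheme \<Rightarrow> nat \<Rightarrow> nat \<Rightarrow> 'r \<Rightarrow> (nat \<times> nat \<Rightarrow> 'r)" where
  "unitri_elem R n l a =
     (\<lambda>(i, j)\<in>mat_idx n. if i = j then \<one>\<^bsub>R\<^esub> else if i = l \<and> j = l + 1 then a else \<zero>\<^bsub>R\<^esub>)"

definition proj_ul :: "nat \<Rightarrow> nat \<Rightarrow> (nat \<times> nat \<Rightarrow> 'r) \<Rightarrow> (nat \<times> nat \<Rightarrow> 'r)" where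
  "proj_ul n m A = (\<lambda>(i, j)\<in>mat_idx m. A (i, j))"

definition proj_lr :: "nat \<Rightarrow> nat \<Rightarrow> (nat \<times> nat \<Rightarrow> 'r) \<Rightarrow> (nat \<times> nat \<Rightarrow> 'r)" where
  "proj_lr n m A = (\<lambda>(i, j)\<in>mat_idx m. A (i + (n - m), j + (n - m)))"

definition unitri_fiber ::
    "('r, 'b) tring_scheme \<Rightarrow> nat \<Rightarrow> nat \<Rightarrow> nat \<Rightarrow> ((nat \<times> nat \<Rightarrow> 'r) \<times> (nat \<times> nat \<Rightarrow> 'r)) tgroup" where
  "unitri_fiber R m1 m2 t =
     fiber_product (unitri R m1) (unitri R m2) (proj_lr m1 t) (proj_ul m2 t)"

definition unitri_V :: "('r, 'b) tring_scheme \<Rightarrow> nat \<Rightarrow> nat \<Rightarrow> nat \<Rightarrow> (nat \<times> nat \<Rightarrow> 'r) set" where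
  "unitri_V R n m1 m2 =
     kernel (unitri R n) (unitri R m1) (proj_ul n m1) \<inter> kernel (unitri R n) (unitri R m2) (proj_lr n m2)"

text \<open>The identification of the quotient by \<open>V\<close> with the fibre product: the value on a coset of
  the map induced by the pair of projections.\<close>

definition unitri_ident ::
    "nat \<Rightarrow> nat \<Rightarrow> nat \<Rightarrow> (nat \<times> nat \<Rightarrow> 'r) set \<Rightarrow> (nat \<times> nat \<Rightarrow> 'r) \<times> (nat \<times> nat \<Rightarrow> 'r)" where
  "unitri_ident n m1 m2 C = the_elem ((\<lambda>A. (proj_ul n m1 A, proj_lr n m2 A)) ` C)"


section \<open>The linking structures attached to a group with subgroups\<close>

definition N_sub :: "('g, 'b) tgroup_scheme \<Rightarrow> ('j \<Rightarrow> 'g set) \<Rightarrow> 'j set \<Rightarrow> 'j set \<Rightarrow> 'g set" where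
  "N_sub G T J Ih = closed_normal_generate G (\<Union>j\<in>J - Ih. T j)"

definition G_quot :: "('g, 'b) tgroup_scheme \<Rightarrow> ('j \<Rightarrow> 'g set) \<Rightarrow> 'j set \<Rightarrow> 'j set \<Rightarrow> 'g set tgroup" where
  "G_quot G T J Ih = quot_tgroup G (N_sub G T J Ih)"

definition res :: "('g, 'b) tgroup_scheme \<Rightarrow> ('j \<Rightarrow> 'g set) \<Rightarrow> 'j set \<Rightarrow> 'j set \<Rightarrow> 'g \<Rightarrow> 'g set" where
  "res G T J Ih x = N_sub G T J Ih #>\<^bsub>G\<^esub> x"

text \<open>The natural map from a quotient \<open>G_quot G T J Ih\<close> to \<open>G_quot G T J Ih'\<close> with \<open>Ih' \<subseteq> Ih\<close>.\<close>

definition restriction ::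
    "('g, 'b) tgroup_scheme \<Rightarrow> ('j \<Rightarrow> 'g set) \<Rightarrow> 'j set \<Rightarrow> 'j set \<Rightarrow> 'g set \<Rightarrow> 'g set" where
  "restriction G T J Ih' C = N_sub G T J Ih' <#>\<^bsub>G\<^esub> C"

text \<open>The maps \<open>T\<^sub>j \<rightarrow> \<bbbU>\<^sub>n\<close>, where \<open>e 1, \<dots>, e n\<close> enumerate the elements of \<open>I\<close>.\<close>

definition elementary_pi ::
    "('r, 'b) tring_scheme \<Rightarrow> nat \<Rightarrow> (nat \<Rightarrow> 'j) \<Rightarrow> ('j \<Rightarrow> 'g \<Rightarrow> 'r) \<Rightarrow> 'j \<Rightarrow> 'g \<Rightarrow> (nat \<times> nat \<Rightarrow> 'r)" where
  "elementary_pi R n e pibar j \<tau> =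
     (if j \<in> e ` {1..n} then unitri_elem R n (the_inv_into {1..n} e j) (pibar j \<tau>)
      else \<one>\<^bsub>unitri R n\<^esub>)"

definition quot_linking ::
    "('g, 'b) tgroup_scheme \<Rightarrow> ('j \<Rightarrow> 'g set) \<Rightarrow> ('j \<Rightarrow> 'g set) \<Rightarrow> ('j \<Rightarrow> 'g set \<Rightarrow> 'g) \<Rightarrow> 'j set \<Rightarrow>
     'j set \<Rightarrow> 'j set \<Rightarrow> 'u tgroup \<Rightarrow> ('j \<Rightarrow> 'g \<Rightarrow> 'u) \<Rightarrow> ('j, 'g set, 'u, 'g) linking" where
  "quot_linking G Z T s J Ih I U \<pi> =
     \<lparr>lkG = G_quot G T J Ih, lkU = U, lkI = I, lkZ = (\<lambda>i. sub_tgroup G (Z i)), lkT = T,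
      lksec = s, lklam = (\<lambda>i. res G T J Ih), lkpi = \<pi>\<rparr>"

end

theory Submission
  imports Defs
begin

text \<open>The given globalizations already determine the wanted homomorphism modulo \<open>V\<close>. Composed with
the restrictions they are homomorphisms \<open>r1\<close>, \<open>r2\<close> from \<open>G\<^sub>I\<^sub>h\<close> to the upper-left and the
lower-right unitriangular group. On the image of \<open>T\<^sub>i\<close>, where \<open>i = e l\<close>, they are the upper-left
and the lower-right block of \<open>\<pi>\<^sub>i\<close>: if \<open>i\<close> belongs to the smaller index set, this is the
globalization property; otherwise \<open>T\<^sub>i\<close> dies in the smaller quotient, and the block misses the
position \<open>(l, l + 1)\<close>, the only one where \<open>\<pi>\<^sub>i\<close> differs from the identity. By assumption (A) these
images generate \<open>G\<^sub>I\<^sub>h\<close> topologically, so \<open>r1\<close> and \<open>r2\<close> have the same overlap block everywhere and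
define a homomorphism into the fibre product. A compatible pair of blocks can be glued to a
matrix, so the fibre product is \<open>U\<^sub>n / V\<close> (\<open>unitri_fiber\<close>), and the homomorphism becomes a
globalization \<open>\<sigma>\<close> of the quotient linking structure. This is part (a).

For part (b) the lift of \<open>\<sigma>\<close> to \<open>U\<^sub>n\<close> exists for a reason that has nothing to do with matrices
(\<open>globalization_lift\<close>). On the free pro-\<open>p\<close> product of the \<open>T\<^sub>i\<close>, the maps \<open>\<sigma> \<circ> \<lambda>\<close> and \<open>\<pi>\<close>
modulo \<open>V\<close> agree, because they agree on each factor. As \<open>\<sigma>\<close> is trivial on the complements
\<open>Zbar\<^sub>i\<close>, the map \<open>\<pi>\<close> sends the preimage of \<open>\<lambda>(Zbar\<^sub>i)\<close> into \<open>V\<close>. Its values there commute with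
everything that \<open>\<pi>\<close> sends into the centralizer of \<open>V\<close>, so the commutators occurring in a
\<open>V\<close>-link type are killed by \<open>\<pi>\<close>. Hence so is the kernel of \<open>\<lambda>\<close>, and \<open>\<pi>\<close> factors through the
surjection \<open>\<lambda>\<close> onto \<open>G\<^sub>I\<^sub>h\<close>. The factor is \<open>\<rho>\<close>. It lifts \<open>\<sigma>\<close>, so it lifts both given maps and
sends the complements into \<open>V\<close>. Its image is a subgroup that contains all \<open>Id + a E\<^sub>l\<^sub>,\<^sub>l\<^sub>+\<^sub>1\<close>,
and these generate \<open>U\<^sub>n\<close> (\<open>unitri_generated_by_superdiagonal\<close>).

The statements need the groups involved to be pro-\<open>p\<close>. For quotients and fibre products this
comes from the fact that a Hausdorff continuous image of a pro-\<open>p\<close> group is pro-\<open>p\<close>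
(\<open>pro_p_group_image\<close>), for \<open>U\<^sub>n\<close> from reducing matrices modulo the open ideals of the ring
(\<open>pro_p_group_unitri\<close>).\<close>

section \<open>Continuous homomorphisms between compact groups\<close>

lemma chomD:
  assumes "h \<in> chom G H"
  shows "h \<in> hom G H" "continuous_map (gtop G) (gtop H) h"
  using assms by (auto simp: chom_def)

lemma chom_carrier: "h \<in> chom G H \<Longrightarrow> x \<in> carrier G \<Longrightarrow> h x \<in> carrier H"
  by (auto simp: chom_def hom_def)

lemma chom_group_hom: "h \<in> chom G H \<Longrightarrow> group G \<Longrightarrow> group H \<Longrightarrow> group_hom G H h"
  by (simp add: chom_def group_hom_def group_hom_axioms_def)

lemma topological_groupD:
  assumes "topological_group G"
  shows "group G" "topspace (gtop G) = carrier G"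
    "continuous_map (prod_topology (gtop G) (gtop G)) (gtop G) (\<lambda>(x, y). x \<otimes>\<^bsub>G\<^esub> y)"
    "continuous_map (gtop G) (gtop G) (\<lambda>x. inv\<^bsub>G\<^esub> x)"
  using assms by (auto simp: topological_group_def)

lemma chom_cong:
  assumes "f \<in> chom G H" "group G" "topspace (gtop G) = carrier G" "\<And>x. x \<in> carrier G \<Longrightarrow> g x = f x"
  shows "g \<in> chom G H"
proof -
  interpret group G by fact
  have "g \<in> hom G H" using assms(1,4) by (auto simp: chom_def hom_def)
  moreover have "continuous_map (gtop G) (gtop H) g"
    by (rule continuous_map_eq[OF chomD(2)[OF assms(1)]]) (use assms(3,4) in auto)
  ultimately show ?thesis by (simp add: chom_def)
qed

lemma sub_sub_tgroup:
  assumes "T \<subseteq> Z"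
  shows "sub_tgroup (sub_tgroup G Z) T = sub_tgroup G T"
  using assms by (simp add: sub_tgroup_def subtopology_subtopology Int_absorb1)

lemma chom_sub:
  assumes "f \<in> chom G H" "S \<subseteq> carrier G"
  shows "f \<in> chom (sub_tgroup G S) H"
  using assms by (auto simp: chom_def hom_def continuous_map_from_subtopology)

lemma continuous_right_mult:
  assumes G: "topological_group G" and a: "a \<in> carrier G"
  shows "continuous_map (gtop G) (gtop G) (\<lambda>x. x \<otimes>\<^bsub>G\<^esub> a)"
proof -
  note Gd = topological_groupD[OF G]
  have "continuous_map (gtop G) (prod_topology (gtop G) (gtop G)) (\<lambda>x. (x, a))"
    using a Gd(2) by (intro continuous_map_pairedI) auto
  from continuous_map_compose[OF this Gd(3)] show ?thesis by (simp add: o_def)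
qed

text \<open>In a compact Hausdorff group with continuous multiplication, \<open>(x, y) \<mapsto> (x, x y)\<close> is a continuous
bijection between compact Hausdorff spaces, hence a homeomorphism. Its inverse sends \<open>(x, 1)\<close> to
\<open>(x, x\<^sup>-\<^sup>1)\<close>, so inversion is continuous.\<close>

lemma topological_groupI_compact:
  assumes G: "group G" "topspace (gtop G) = carrier G" "compact_space (gtop G)" "Hausdorff_space (gtop G)"
    and m: "continuous_map (prod_topology (gtop G) (gtop G)) (gtop G) (\<lambda>(x, y). x \<otimes>\<^bsub>G\<^esub> y)"
  shows "topological_group G"
proof -
  interpret group G by fact
  let ?X = "prod_topology (gtop G) (gtop G)"
  let ?h = "\<lambda>(x, y). (x, x \<otimes>\<^bsub>G\<^esub> y)"
  have "homeomorphic_map ?X ?X ?h"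
  proof (rule continuous_imp_homeomorphic_map)
    show "continuous_map ?X ?X ?h"
      using continuous_map_pairedI[OF continuous_map_fst m] by (simp add: case_prod_unfold)
    show "?h ` topspace ?X = topspace ?X"
    proof
      show "topspace ?X \<subseteq> ?h ` topspace ?X"
      proof
        fix z assume "z \<in> topspace ?X"
        then have "z = ?h (fst z, inv\<^bsub>G\<^esub> fst z \<otimes>\<^bsub>G\<^esub> snd z)"
          "(fst z, inv\<^bsub>G\<^esub> fst z \<otimes>\<^bsub>G\<^esub> snd z) \<in> topspace ?X"
          by (auto simp: G(2) m_assoc[symmetric])
        then show "z \<in> ?h ` topspace ?X" by (rule image_eqI)
      qed
    qed (auto simp: G(2))
    show "inj_on ?h (topspace ?X)" by (auto simp: inj_on_def G(2))
  qed (use G in \<open>auto simp: compact_space_prod_topology Hausdorff_space_prod_topology\<close>)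
  then obtain k where k: "homeomorphic_maps ?X ?X ?h k" by (auto simp: homeomorphic_map_maps)
  have "k (x, \<one>\<^bsub>G\<^esub>) = (x, inv\<^bsub>G\<^esub> x)" if "x \<in> carrier G" for x
  proof -
    have "\<forall>z\<in>topspace ?X. k (?h z) = z" using k by (simp add: homeomorphic_maps_def)
    from bspec[OF this, of "(x, inv\<^bsub>G\<^esub> x)"] show ?thesis using that by (simp add: G(2))
  qed
  moreover have "continuous_map (gtop G) (gtop G) (\<lambda>x. snd (k (x, \<one>\<^bsub>G\<^esub>)))"
  proof -
    have "continuous_map (gtop G) ?X (\<lambda>x. (x, \<one>\<^bsub>G\<^esub>))"
      by (intro continuous_map_pairedI) (auto simp: G(2))
    moreover have "continuous_map ?X ?X k" using k by (simp add: homeomorphic_maps_def)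
    ultimately show ?thesis
      using continuous_map_compose[OF continuous_map_compose continuous_map_snd, of "gtop G" ?X "\<lambda>x. (x, \<one>\<^bsub>G\<^esub>)" "gtop G" "gtop G" k]
      by (simp add: o_def)
  qed
  ultimately have "continuous_map (gtop G) (gtop G) (\<lambda>x. inv\<^bsub>G\<^esub> x)"
    by (rule_tac continuous_map_eq[of _ _ "\<lambda>x. snd (k (x, \<one>\<^bsub>G\<^esub>))"]) (auto simp: G(2))
  then show ?thesis using G m by (simp add: topological_group_def)
qed

lemma closed_subgroup_image:
  assumes G: "topological_group G" "compact_space (gtop G)"
    and H: "group H" "Hausdorff_space (gtop H)" and f: "f \<in> chom G H"
  shows "closed_subgroup (f ` carrier G) H"
proof -
  note Gd = topological_groupD[OF G(1)]
  interpret f: group_hom G H f using f Gd(1) H(1) by (rule chom_group_hom)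
  have "compactin (gtop H) (f ` carrier G)"
    using image_compactin[OF G(2)[unfolded compact_space_def] chomD(2)[OF f]] Gd(2) by simp
  then show ?thesis
    using compactin_imp_closedin[OF H(2)] f.img_is_subgroup by (simp add: closed_subgroup_def)
qed

text \<open>Such a set is a union of cosets of an open subgroup.\<close>

lemma openin_coset_closed:
  assumes G: "topological_group G" and N: "subgroup N G" "openin (gtop G) N"
    and P: "P \<subseteq> carrier G" "\<And>n x. n \<in> N \<Longrightarrow> x \<in> P \<Longrightarrow> n \<otimes>\<^bsub>G\<^esub> x \<in> P"
  shows "openin (gtop G) P"
proof -
  interpret group G using topological_groupD(1)[OF G] .
  have "P = (\<Union>x\<in>P. N #>\<^bsub>G\<^esub> x)"
  proof
    show "P \<subseteq> (\<Union>x\<in>P. N #>\<^bsub>G\<^esub> x)"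
      using rcos_self[OF _ N(1)] P(1) by blast
    show "(\<Union>x\<in>P. N #>\<^bsub>G\<^esub> x) \<subseteq> P"
      using P(2) by (auto simp: r_coset_def)
  qed
  moreover have "openin (gtop G) (N #>\<^bsub>G\<^esub> x)" if "x \<in> P" for x
    using openin_coset[OF G N] that P(1) by blast
  ultimately show ?thesis
    using openin_Union[of "(\<lambda>x. N #>\<^bsub>G\<^esub> x) ` P" "gtop G"] by auto
qed

text \<open>Compactness makes a continuous surjection onto a Hausdorff group a closed map. Continuity out of
the target can therefore be tested on the source, which is how every induced map below gets its
continuity.\<close>

lemma quotient_map_chom:
  assumes "f \<in> chom G K" "compact_space (gtop G)" "Hausdorff_space (gtop K)"
    "topspace (gtop G) = carrier G" "topspace (gtop K) = carrier K" "f ` carrier G = carrier K"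
  shows "quotient_map (gtop G) (gtop K) f"
  using assms by (intro continuous_imp_quotient_map) (auto simp: chom_def)

text \<open>The isomorphism theorem with topology; the induced map is continuous because the surjection is a
quotient map.\<close>

lemma chom_factor:
  assumes G: "pro_p_group p G" and K: "pro_p_group p K" and H: "topological_group H"
    and f: "f \<in> chom G K" "f ` carrier G = carrier K" and g: "g \<in> chom G H"
    and ker: "kernel G K f \<subseteq> kernel G H g"
  obtains h where "h \<in> chom K H" "\<And>x. x \<in> carrier G \<Longrightarrow> h (f x) = g x"
proof -
  note Gd = pro_p_groupD[OF G] and Kd = pro_p_groupD[OF K] and Hd = topological_groupD[OF H]
  interpret f: group_hom G K f using f(1) Gd(1) Kd(1) by (rule chom_group_hom)
  interpret g: group_hom G H g using g Gd(1) Hd(1) by (rule chom_group_hom)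
  have fact: "g x = g y" if "x \<in> carrier G" "y \<in> carrier G" "f x = f y" for x y
  proof -
    have "x \<otimes>\<^bsub>G\<^esub> inv\<^bsub>G\<^esub> y \<in> kernel G K f" using that by (auto simp: kernel_def)
    then have "g (x \<otimes>\<^bsub>G\<^esub> inv\<^bsub>G\<^esub> y) = \<one>\<^bsub>H\<^esub>" using ker by (auto simp: kernel_def)
    then show ?thesis using that g.H.inv_solve_right'[of "\<one>\<^bsub>H\<^esub>" "g x" "g y"] by simp
  qed
  obtain h where h: "\<And>x. x \<in> carrier G \<Longrightarrow> g x = h (f x)"
    using fact function_factors_left_gen[of "\<lambda>x. x \<in> carrier G" f g] by blast
  have "h \<in> hom K H"
  proof (rule homI)
    fix a b assume "a \<in> carrier K" "b \<in> carrier K"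
    then obtain x y where xy: "x \<in> carrier G" "y \<in> carrier G" "a = f x" "b = f y"
      using f(2) by (metis imageE)
    show "h a \<in> carrier H" using xy h[of x] by (metis g.hom_closed)
    show "h (a \<otimes>\<^bsub>K\<^esub> b) = h a \<otimes>\<^bsub>H\<^esub> h b"
      using xy h[of "x \<otimes>\<^bsub>G\<^esub> y"] h[of x] h[of y] by simp
  qed
  moreover have "continuous_map (gtop K) (gtop H) h"
  proof (rule continuous_compose_quotient_map)
    show "quotient_map (gtop G) (gtop K) f"
      using f Gd Kd by (intro quotient_map_chom)
    show "continuous_map (gtop G) (gtop H) (h \<circ> f)"
      by (rule continuous_map_eq[of _ _ g]) (use h g Gd(2) in \<open>auto simp: chom_def\<close>)
  qed
  ultimately show ?thesis using h that by (auto simp: chom_def)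
qed

lemma order_image_prime_power:
  assumes p: "Factorial_Ring.prime p" and h: "group_hom A B h" "h ` carrier A = carrier B"
    and A: "finite (carrier A)" "card (carrier A) = p ^ k"
  shows "\<exists>l. order B = p ^ l"
proof -
  interpret group_hom A B h by fact
  let ?K = "kernel A B h"
  have "bij_betw (\<lambda>X. the_elem (h`X)) (rcosets\<^bsub>A\<^esub> ?K) (carrier B)"
    using FactGroup_iso_set[OF h(2)] by (simp add: iso_def FactGroup_def)
  then have "card (rcosets\<^bsub>A\<^esub> ?K) = order B" by (simp add: bij_betw_same_card order_def)
  then have "order B dvd p ^ k"
    using G.lagrange[OF subgroup_kernel] A(2) by (metis dvd_triv_left order_def)
  then show ?thesis using p by (auto simp: divides_primepow_nat)
qed

lemma topological_group_image:
  assumes G: "topological_group G" "compact_space (gtop G)" and H: "group H" "topspace (gtop H) = carrier H"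
    "Hausdorff_space (gtop H)" and f: "f \<in> chom G H" "f ` carrier G = carrier H"
  shows "topological_group H"
proof -
  note Gd = topological_groupD[OF G(1)]
  interpret f: group_hom G H f using f(1) Gd(1) H(1) by (rule chom_group_hom)
  have q: "quotient_map (gtop G) (gtop H) f"
    using f G Gd H by (intro quotient_map_chom)
  have cf: "continuous_map (gtop G) (gtop H) f" using f(1) by (rule chomD)
  have "continuous_map (gtop G) (gtop H) ((\<lambda>x. inv\<^bsub>H\<^esub> x) \<circ> f)"
    by (rule continuous_map_eq[OF continuous_map_compose[OF Gd(4) cf]]) (auto simp: Gd(2))
  then have ci: "continuous_map (gtop H) (gtop H) (\<lambda>x. inv\<^bsub>H\<^esub> x)"
    by (rule continuous_compose_quotient_map[OF q])
  let ?ff = "\<lambda>(x, y). (f x, f y)"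
  have qq: "quotient_map (prod_topology (gtop G) (gtop G)) (prod_topology (gtop H) (gtop H)) ?ff"
  proof (rule continuous_imp_quotient_map)
    show "continuous_map (prod_topology (gtop G) (gtop G)) (prod_topology (gtop H) (gtop H)) ?ff"
      using cf by (auto simp: continuous_map_prod_top)
    show "?ff ` topspace (prod_topology (gtop G) (gtop G)) = topspace (prod_topology (gtop H) (gtop H))"
      using f(2) by (simp add: Gd(2) H(2) image_paired_Times)
  qed (use G H in \<open>auto simp: compact_space_prod_topology Hausdorff_space_prod_topology\<close>)
  have "continuous_map (prod_topology (gtop G) (gtop G)) (gtop H) ((\<lambda>(x, y). x \<otimes>\<^bsub>H\<^esub> y) \<circ> ?ff)"
    by (rule continuous_map_eq[OF continuous_map_compose[OF Gd(3) cf]]) (auto simp: Gd(2))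
  then have cm: "continuous_map (prod_topology (gtop H) (gtop H)) (gtop H) (\<lambda>(x, y). x \<otimes>\<^bsub>H\<^esub> y)"
    by (rule continuous_compose_quotient_map[OF qq])
  show ?thesis using H ci cm by (simp add: topological_group_def)
qed

text \<open>An open neighbourhood of the identity in the image pulls back to one that contains an open normal
subgroup \<open>N\<close> of \<open>p\<close>-power index. Then \<open>f N\<close> is open, since its preimage is a union of cosets of
\<open>N\<close>, and the quotient by \<open>f N\<close> is a homomorphic image of \<open>G / N\<close>, so its order is again a power
of \<open>p\<close>.\<close>

lemma pro_p_group_image:
  fixes G :: "('a, 'b) tgroup_scheme" and H :: "('h, 'c) tgroup_scheme"
  assumes p: "Factorial_Ring.prime p" and G: "pro_p_group p G"
    and H: "group H" "topspace (gtop H) = carrier H" "Hausdorff_space (gtop H)"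
    and f: "f \<in> chom G H" "f ` carrier G = carrier H"
  shows "pro_p_group p H"
proof -
  note Gd = pro_p_groupD[OF G]
  interpret f: group_hom G H f using f(1) Gd(1) H(1) by (rule chom_group_hom)
  have q: "quotient_map (gtop G) (gtop H) f"
    using f Gd H by (intro quotient_map_chom)
  have tH: "topological_group H" by (rule topological_group_image[OF Gd(5,3) H f])
  have cf: "continuous_map (gtop G) (gtop H) f" using f(1) by (rule chomD)
  show ?thesis
  proof (rule pro_p_groupI[where 'f = "'h set" and 'c = unit, OF p tH _ H(3)])
    show "compact_space (gtop H)"
      using image_compactin[OF Gd(3)[unfolded compact_space_def] cf] f(2) H(2) Gd(2)
      by (simp add: compact_space_def)
    fix W assume W: "openin (gtop H) W" "\<one>\<^bsub>H\<^esub> \<in> W"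
    have "openin (gtop G) {x \<in> topspace (gtop G). f x \<in> W}"
      using openin_continuous_map_preimage[OF cf W(1)] .
    moreover have "\<one>\<^bsub>G\<^esub> \<in> {x \<in> topspace (gtop G). f x \<in> W}" using W(2) Gd(2) by simp
    ultimately obtain N k where N: "N \<lhd> G" "openin (gtop G) N" "N \<subseteq> {x \<in> topspace (gtop G). f x \<in> W}"
        "finite (rcosets\<^bsub>G\<^esub> N)" "card (rcosets\<^bsub>G\<^esub> N) = p ^ k"
      using G unfolding pro_p_group_def by blast
    interpret N: normal N G by fact
    let ?M = "f ` N"
    have M: "?M \<lhd> H" by (rule N.surj_hom_normal_subgroup[OF f.group_hom_axioms f(2)])
    interpret M: normal ?M H by fact
    have Mopen: "openin (gtop H) ?M"
    proof -
      let ?P = "{x \<in> carrier G. f x \<in> ?M}"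
      have "openin (gtop G) ?P"
        by (rule openin_coset_closed[OF Gd(5) N.subgroup_axioms N(2)]) (auto intro: M.m_closed)
      moreover have "?M \<subseteq> topspace (gtop H)" using M.subset H(2) by simp
      ultimately show ?thesis using q Gd(2) by (simp add: quotient_map_def)
    qed
    have "\<exists>l. order (H Mod ?M) = p ^ l"
    proof -
      let ?c = "\<lambda>x. ?M #>\<^bsub>H\<^esub> f x"
      have c: "?c \<in> hom G (H Mod ?M)"
        using hom_compose[OF f.homh M.r_coset_hom_Mod] by (simp add: o_def)
      have c1: "?c x = \<one>\<^bsub>H Mod ?M\<^esub>" if "x \<in> N" for x
        using that M.subgroup_axioms f.H.coset_join2[of "f x" ?M] N.mem_carrier by (simp add: FactGroup_def)
      interpret c: group_hom G "H Mod ?M" ?c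
        using c M.factorgroup_is_group f.G.is_group by (simp add: group_hom_def group_hom_axioms_def)
      have "N \<subseteq> kernel G (H Mod ?M) ?c" using c1 N.subset by (auto simp: kernel_def)
      then obtain h where h: "h \<in> hom (G Mod N) (H Mod ?M)" "\<And>x. x \<in> carrier G \<Longrightarrow> h (N #>\<^bsub>G\<^esub> x) = ?c x"
        by (rule c.FactGroup_universal_kernel[OF N(1)]) blast
      have "h ` carrier (G Mod N) = carrier (H Mod ?M)"
        unfolding carrier_FactGroup image_image f(2)[symmetric] using h(2) by (rule image_cong[OF refl])
      moreover have "group_hom (G Mod N) (H Mod ?M) h"
        using h(1) M.factorgroup_is_group N.factorgroup_is_group by (simp add: group_hom_def group_hom_axioms_def)
      ultimately show ?thesis
        using N(4,5) by (intro order_image_prime_power[OF p, of "G Mod N" _ h]) (auto simp: FactGroup_def)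
    qed
    then obtain l where l: "order (H Mod ?M) = p ^ l" by blast
    have fin: "finite (carrier (H Mod ?M))"
      using l p card.infinite[of "carrier (H Mod ?M)"] by (auto simp: order_def)
    have "kernel H (H Mod ?M) (\<lambda>x. ?M #>\<^bsub>H\<^esub> x) \<subseteq> W"
    proof
      fix x assume "x \<in> kernel H (H Mod ?M) (\<lambda>x. ?M #>\<^bsub>H\<^esub> x)"
      then have "x \<in> carrier H" "?M #>\<^bsub>H\<^esub> x = ?M" by (auto simp: kernel_def FactGroup_def)
      then have "x \<in> ?M" using f.H.rcos_self[of x ?M] M.subgroup_axioms by simp
      then show "x \<in> W" using N(3) by auto
    qed
    then show "\<exists>(F::'h set monoid) h k. group F \<and> finite (carrier F) \<and> order F = p ^ k \<and>
        h \<in> chom H (discrete_tgroup F) \<and> kernel H F h \<subseteq> W"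
      using M.factorgroup_is_group fin l coset_chom[OF tH M Mopen]
      by (intro exI[of _ "H Mod ?M"] exI[of _ "\<lambda>x. ?M #>\<^bsub>H\<^esub> x"] exI[of _ l]) simp
  qed
qed

section \<open>Quotients and closed normal subgroups\<close>

lemma quot_tgroup_simps [simp]:
  "carrier (quot_tgroup G N) = carrier (G Mod N)" "mult (quot_tgroup G N) = mult (G Mod N)"
  "one (quot_tgroup G N) = one (G Mod N)"
  by (simp_all add: quot_tgroup_def)

lemma group_quot_tgroup:
  assumes "N \<lhd> G" shows "group (quot_tgroup G N)"
  using normal.factorgroup_is_group[OF assms] by (rule group_cong[rotated 3]) auto

lemma openin_quot_tgroup:
  "openin (gtop (quot_tgroup G N)) W \<longleftrightarrow>
     W \<subseteq> carrier (G Mod N) \<and> openin (gtop G) {x \<in> carrier G. N #>\<^bsub>G\<^esub> x \<in> W}"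
proof -
  let ?P = "\<lambda>W. {x \<in> carrier G. N #>\<^bsub>G\<^esub> x \<in> W}"
  have "?P (\<Union>\<K>) = (\<Union>W\<in>\<K>. ?P W)" and "?P (S \<inter> T) = ?P S \<inter> ?P T" for \<K> S T by auto
  then have "istopology (\<lambda>W. W \<subseteq> carrier (G Mod N) \<and> openin (gtop G) (?P W))"
    unfolding istopology_def by (auto intro!: openin_Union)
  then show ?thesis by (simp add: quot_tgroup_def topology_inverse')
qed

lemma rcoset_eq_iff:
  assumes "N \<lhd> G" "x \<in> carrier G" "y \<in> carrier G"
  shows "N #>\<^bsub>G\<^esub> x = N #>\<^bsub>G\<^esub> y \<longleftrightarrow> x \<otimes>\<^bsub>G\<^esub> inv\<^bsub>G\<^esub> y \<in> N"
proof -
  interpret normal N G by fact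
  show ?thesis
    using assms(2,3) rcos_module_imp[of y x] rcos_module_rev[of y x] rcos_self[OF _ subgroup_axioms, of x]
      repr_independence[OF _ _ subgroup_axioms, of x y] by (metis is_group)
qed

lemma rcoset_eq_self_iff:
  assumes "N \<lhd> G" "x \<in> carrier G"
  shows "N #>\<^bsub>G\<^esub> x = N \<longleftrightarrow> x \<in> N"
proof -
  interpret normal N G by fact
  show ?thesis using rcos_const[OF is_group, of x] rcos_self[OF assms(2) subgroup_axioms] by auto
qed

lemma coset_chom_quot:
  assumes G: "topological_group G" and N: "N \<lhd> G"
  shows "topspace (gtop (quot_tgroup G N)) = carrier (quot_tgroup G N)"
    "(\<lambda>x. N #>\<^bsub>G\<^esub> x) \<in> chom G (quot_tgroup G N)"
    "(\<lambda>x. N #>\<^bsub>G\<^esub> x) ` carrier G = carrier (quot_tgroup G N)"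
proof -
  interpret normal N G by fact
  note Gd = topological_groupD[OF G]
  have *: "N #>\<^bsub>G\<^esub> x \<in> carrier (G Mod N)" if "x \<in> carrier G" for x
    using that by (auto simp: carrier_FactGroup)
  have "{x \<in> carrier G. N #>\<^bsub>G\<^esub> x \<in> carrier (G Mod N)} = topspace (gtop G)"
    using * Gd(2) by auto
  then have "openin (gtop (quot_tgroup G N)) (carrier (G Mod N))"
    unfolding openin_quot_tgroup by simp
  then show top: "topspace (gtop (quot_tgroup G N)) = carrier (quot_tgroup G N)"
    unfolding topspace_def by (auto simp: openin_quot_tgroup)
  show "(\<lambda>x. N #>\<^bsub>G\<^esub> x) \<in> chom G (quot_tgroup G N)"
    using r_coset_hom_Mod * Gd(2) top
    by (auto simp: chom_def hom_def continuous_map_def openin_quot_tgroup)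
  show "(\<lambda>x. N #>\<^bsub>G\<^esub> x) ` carrier G = carrier (quot_tgroup G N)"
    by (simp add: carrier_FactGroup)
qed

text \<open>The point is that the quotient is Hausdorff. If \<open>x\<close> and \<open>y\<close> lie in different cosets of \<open>N\<close>, then
\<open>x y\<^sup>-\<^sup>1\<close> is outside the closed set \<open>N\<close>, so some open normal subgroup \<open>M\<close> satisfies
\<open>M x y\<^sup>-\<^sup>1 \<inter> N = {}\<close>; the images of \<open>M x\<close> and \<open>M y\<close> separate the two cosets.\<close>

lemma pro_p_group_quot:
  assumes p: "Factorial_Ring.prime p" and G: "pro_p_group p G" and N: "closed_normal N G"
  shows "pro_p_group p (quot_tgroup G N)"
proof -
  note Gd = pro_p_groupD[OF G]
  have nN: "N \<lhd> G" and cN: "closedin (gtop G) N" using N by (auto simp: closed_normal_def)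
  interpret N: normal N G by fact
  note q = coset_chom_quot[OF Gd(5) nN]
  let ?q = "\<lambda>x. N #>\<^bsub>G\<^esub> x"
  let ?Q = "quot_tgroup G N"
  interpret q: group_hom G ?Q ?q
    using q(2) Gd(1) group_quot_tgroup[OF nN] by (rule chom_group_hom)
  have "Hausdorff_space (gtop ?Q)"
    unfolding Hausdorff_space_def q(1)
  proof (intro allI impI)
    fix X Y assume "X \<in> carrier ?Q \<and> Y \<in> carrier ?Q \<and> X \<noteq> Y"
    then obtain x y where xy: "x \<in> carrier G" "y \<in> carrier G" "X = ?q x" "Y = ?q y"
      and "?q x \<noteq> ?q y" using q(3) by (metis imageE)
    then have notin: "x \<otimes>\<^bsub>G\<^esub> inv\<^bsub>G\<^esub> y \<notin> N" using rcoset_eq_iff[OF nN] by blast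
    let ?a = "x \<otimes>\<^bsub>G\<^esub> inv\<^bsub>G\<^esub> y"
    have a: "?a \<in> carrier G" using xy by simp
    have "openin (gtop G) {g \<in> topspace (gtop G). g \<otimes>\<^bsub>G\<^esub> ?a \<in> topspace (gtop G) - N}"
      by (rule openin_continuous_map_preimage[OF continuous_right_mult[OF Gd(5) a]])
        (use cN in blast)
    moreover have "\<one>\<^bsub>G\<^esub> \<in> {g \<in> topspace (gtop G). g \<otimes>\<^bsub>G\<^esub> ?a \<in> topspace (gtop G) - N}"
      using notin a Gd(2) by simp
    ultimately obtain M where M: "M \<lhd> G" "openin (gtop G) M"
      "M \<subseteq> {g \<in> topspace (gtop G). g \<otimes>\<^bsub>G\<^esub> ?a \<in> topspace (gtop G) - N}"
      using G unfolding pro_p_group_def by blast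
    interpret M: normal M G by fact
    have op: "openin (gtop ?Q) ((\<lambda>m. ?q (m \<otimes>\<^bsub>G\<^esub> z)) ` M)" if z: "z \<in> carrier G" for z
      unfolding openin_quot_tgroup
    proof
      show "(\<lambda>m. ?q (m \<otimes>\<^bsub>G\<^esub> z)) ` M \<subseteq> carrier (G Mod N)"
        unfolding carrier_FactGroup using z M.mem_carrier by (intro image_subsetI imageI) simp
      show "openin (gtop G) {x \<in> carrier G. ?q x \<in> (\<lambda>m. ?q (m \<otimes>\<^bsub>G\<^esub> z)) ` M}"
      proof (rule openin_coset_closed[OF Gd(5) M.subgroup_axioms M(2)])
        fix n x assume n: "n \<in> M" and "x \<in> {x \<in> carrier G. ?q x \<in> (\<lambda>m. ?q (m \<otimes>\<^bsub>G\<^esub> z)) ` M}"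
        then obtain m where m: "x \<in> carrier G" "m \<in> M" "?q x = ?q (m \<otimes>\<^bsub>G\<^esub> z)" by blast
        have "?q (n \<otimes>\<^bsub>G\<^esub> x) = ?q n \<otimes>\<^bsub>?Q\<^esub> ?q x"
          using q.hom_mult[of n x] m n M.mem_carrier by blast
        also have "\<dots> = ?q n \<otimes>\<^bsub>?Q\<^esub> ?q (m \<otimes>\<^bsub>G\<^esub> z)" by (simp only: m(3))
        also have "\<dots> = ?q (n \<otimes>\<^bsub>G\<^esub> (m \<otimes>\<^bsub>G\<^esub> z))"
          using q.hom_mult[of n "m \<otimes>\<^bsub>G\<^esub> z"] m n z M.mem_carrier by simp
        also have "\<dots> = ?q (n \<otimes>\<^bsub>G\<^esub> m \<otimes>\<^bsub>G\<^esub> z)"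
          using m n z M.mem_carrier by (simp add: N.m_assoc)
        finally have "?q (n \<otimes>\<^bsub>G\<^esub> x) \<in> (\<lambda>m. ?q (m \<otimes>\<^bsub>G\<^esub> z)) ` M"
          using M.m_closed[OF n m(2)] by (rule image_eqI)
        then show "n \<otimes>\<^bsub>G\<^esub> x \<in> {x \<in> carrier G. ?q x \<in> (\<lambda>m. ?q (m \<otimes>\<^bsub>G\<^esub> z)) ` M}"
          using m(1) n M.mem_carrier by simp
      qed auto
    qed
    have self: "?q z \<in> (\<lambda>m. ?q (m \<otimes>\<^bsub>G\<^esub> z)) ` M" if "z \<in> carrier G" for z
      using that M.one_closed by (intro image_eqI[of _ _ "\<one>\<^bsub>G\<^esub>"]) auto
    have "disjnt ((\<lambda>m. ?q (m \<otimes>\<^bsub>G\<^esub> x)) ` M) ((\<lambda>m. ?q (m \<otimes>\<^bsub>G\<^esub> y)) ` M)"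
      unfolding disjnt_iff
    proof (intro allI notI)
      fix C assume "C \<in> (\<lambda>m. ?q (m \<otimes>\<^bsub>G\<^esub> x)) ` M \<and> C \<in> (\<lambda>m. ?q (m \<otimes>\<^bsub>G\<^esub> y)) ` M"
      then obtain m k where m: "m \<in> M" "k \<in> M" "?q (m \<otimes>\<^bsub>G\<^esub> x) = ?q (k \<otimes>\<^bsub>G\<^esub> y)" by blast
      note c = M.mem_carrier[OF m(1)] M.mem_carrier[OF m(2)]
      have "(m \<otimes>\<^bsub>G\<^esub> x) \<otimes>\<^bsub>G\<^esub> inv\<^bsub>G\<^esub> (k \<otimes>\<^bsub>G\<^esub> y) \<in> N"
        by (rule iffD1[OF rcoset_eq_iff[OF nN] m(3)]) (use c xy in simp_all)
      then have "inv\<^bsub>G\<^esub> k \<otimes>\<^bsub>G\<^esub> ((m \<otimes>\<^bsub>G\<^esub> x) \<otimes>\<^bsub>G\<^esub> inv\<^bsub>G\<^esub> (k \<otimes>\<^bsub>G\<^esub> y)) \<otimes>\<^bsub>G\<^esub> k \<in> N"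
        by (rule N.inv_op_closed1[OF c(2)])
      then have "(inv\<^bsub>G\<^esub> k \<otimes>\<^bsub>G\<^esub> m) \<otimes>\<^bsub>G\<^esub> ?a \<in> N"
        using c xy by (simp add: N.inv_mult_group N.m_assoc)
      moreover have "inv\<^bsub>G\<^esub> k \<otimes>\<^bsub>G\<^esub> m \<in> M" using m M.m_closed M.m_inv_closed by blast
      ultimately show False using M(3) by blast
    qed
    then show "\<exists>U V. openin (gtop ?Q) U \<and> openin (gtop ?Q) V \<and> X \<in> U \<and> Y \<in> V \<and> disjnt U V"
      using op[OF xy(1)] op[OF xy(2)] self[OF xy(1)] self[OF xy(2)] unfolding xy(3,4) by blast
  qed
  from pro_p_group_image[OF p G group_quot_tgroup[OF nN] q(1) this q(2,3)] show ?thesis .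
qed

lemma closed_normal_kernel:
  assumes G: "topological_group G" and H: "group H" "topspace (gtop H) = carrier H" "Hausdorff_space (gtop H)"
    and f: "f \<in> chom G H"
  shows "closed_normal (kernel G H f) G"
proof -
  note Gd = topological_groupD[OF G]
  interpret f: group_hom G H f using f Gd(1) H(1) by (rule chom_group_hom)
  have "closedin (gtop H) {\<one>\<^bsub>H\<^esub>}" using H by (simp add: closedin_Hausdorff_singleton)
  from closedin_continuous_map_preimage[OF chomD(2)[OF f] this]
  have "closedin (gtop G) (kernel G H f)" by (simp add: Gd(2) kernel_def)
  then show ?thesis using f.normal_kernel by (simp add: closed_normal_def)
qed

lemma closed_normal_Inter:
  assumes G: "group G" and \<N>: "\<And>N. N \<in> \<N> \<Longrightarrow> closed_normal N G" "\<N> \<noteq> {}"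
  shows "closed_normal (\<Inter>\<N>) G"
proof -
  interpret group G by fact
  have nor: "N \<lhd> G" if "N \<in> \<N>" for N using \<N>(1)[OF that] by (simp add: closed_normal_def)
  have "\<Inter>\<N> \<lhd> G"
  proof (rule normal_invI)
    show "subgroup (\<Inter>\<N>) G"
      using nor normal_imp_subgroup \<N>(2) by (intro subgroups_Inter) blast+
  qed (use nor normal_invE(2) in blast)
  moreover have "closedin (gtop G) (\<Inter>\<N>)"
    using \<N> by (intro closedin_Inter) (auto simp: closed_normal_def)
  ultimately show ?thesis by (simp add: closed_normal_def)
qed

lemma closed_normal_generate:
  assumes G: "topological_group G" and S: "S \<subseteq> carrier G"
  shows "closed_normal (closed_normal_generate G S) G"
  unfolding closed_normal_generate_def
proof (rule closed_normal_Inter)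
  note Gd = topological_groupD[OF G]
  show "group G" by (rule Gd)
  have "closed_normal (carrier G) G"
    using group.normal_self[OF Gd(1)] closedin_topspace[of "gtop G"] Gd(2) by (simp add: closed_normal_def)
  then show "{N. closed_normal N G \<and> S \<subseteq> N} \<noteq> {}" using S by blast
qed auto

lemma closed_normal_generate_superset: "S \<subseteq> closed_normal_generate G S"
  by (auto simp: closed_normal_generate_def)

lemma closed_normal_generate_subset:
  "closed_normal N G \<Longrightarrow> S \<subseteq> N \<Longrightarrow> closed_normal_generate G S \<subseteq> N"
  by (auto simp: closed_normal_generate_def)

section \<open>Fibre products\<close>

lemma fiber_product_simps:
  "carrier (fiber_product A B f g) = {(a, b). a \<in> carrier A \<and> b \<in> carrier B \<and> f a = g b}"
  "x \<otimes>\<^bsub>fiber_product A B f g\<^esub> y = (fst x \<otimes>\<^bsub>A\<^esub> fst y, snd x \<otimes>\<^bsub>B\<^esub> snd y)"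
  "\<one>\<^bsub>fiber_product A B f g\<^esub> = (\<one>\<^bsub>A\<^esub>, \<one>\<^bsub>B\<^esub>)"
  "gtop (fiber_product A B f g) = subtopology (prod_topology (gtop A) (gtop B)) {(a, b). a \<in> carrier A \<and> b \<in> carrier B \<and> f a = g b}"
  by (simp_all add: fiber_product_def Let_def case_prod_unfold)

lemma group_fiber_product:
  assumes f: "group_hom A K f" and g: "group_hom B K g"
  shows "group (fiber_product A B f g)"
proof -
  interpret f: group_hom A K f by fact
  interpret g: group_hom B K g by fact
  show ?thesis
  proof (rule groupI)
    fix x assume "x \<in> carrier (fiber_product A B f g)"
    then have "(inv\<^bsub>A\<^esub> fst x, inv\<^bsub>B\<^esub> snd x) \<in> carrier (fiber_product A B f g)
        \<and> (inv\<^bsub>A\<^esub> fst x, inv\<^bsub>B\<^esub> snd x) \<otimes>\<^bsub>fiber_product A B f g\<^esub> x = \<one>\<^bsub>fiber_product A B f g\<^esub>"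
      by (auto simp: fiber_product_simps)
    then show "\<exists>y\<in>carrier (fiber_product A B f g). y \<otimes>\<^bsub>fiber_product A B f g\<^esub> x = \<one>\<^bsub>fiber_product A B f g\<^esub>"
      by blast
  qed (auto simp: fiber_product_simps f.G.m_assoc g.G.m_assoc)
qed

lemma chom_fiber_product:
  assumes f: "f \<in> chom G A" and g: "g \<in> chom G B" and top: "topspace (gtop G) = carrier G"
    and eq: "\<And>x. x \<in> carrier G \<Longrightarrow> h (f x) = k (g x)"
  shows "(\<lambda>x. (f x, g x)) \<in> chom G (fiber_product A B h k)"
proof -
  have "(\<lambda>x. (f x, g x)) \<in> hom G (fiber_product A B h k)"
    using f g eq by (auto simp: hom_def chom_def fiber_product_simps)
  moreover have "continuous_map (gtop G) (gtop (fiber_product A B h k)) (\<lambda>x. (f x, g x))"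
    unfolding fiber_product_simps continuous_map_in_subtopology
    using f g eq top by (auto intro: continuous_map_pairedI simp: chom_def hom_def)
  ultimately show ?thesis by (simp add: chom_def)
qed

section \<open>Lifting a globalization through the quotient by a subgroup\<close>

lemma linking_quot_simps [simp]:
  "lkG (linking_quot L V) = lkG L" "lkU (linking_quot L V) = quot_tgroup (lkU L) V"
  "lkI (linking_quot L V) = lkI L" "lkZ (linking_quot L V) = lkZ L" "lkT (linking_quot L V) = lkT L"
  "lksec (linking_quot L V) = lksec L" "lklam (linking_quot L V) = lklam L"
  "lkpi (linking_quot L V) = (\<lambda>i \<tau>. V #>\<^bsub>lkU L\<^esub> lkpi L i \<tau>)"
  by (simp_all add: linking_quot_def)

lemma pro_p_linking_structure_quot:
  assumes p: "Factorial_Ring.prime p" and L: "pro_p_linking_structure p L"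
    and V: "closed_normal V (lkU L)"
  shows "pro_p_linking_structure p (linking_quot L V)"
proof -
  have U: "pro_p_group p (lkU L)" using L by (simp add: pro_p_linking_structure_def)
  have nV: "V \<lhd> lkU L" using V by (simp add: closed_normal_def)
  show ?thesis
    using L pro_p_group_quot[OF p U V] coset_chom_quot(2)[OF pro_p_groupD(5)[OF U] nV]
    by (auto simp: pro_p_linking_structure_def intro: chom_compose)
qed

text \<open>A globalization of the quotient structure that vanishes on the complements lifts: the induced map
from the free product to \<open>U\<close> kills the relations of \<open>G\<close>, since these are built from commutators of
elements mapping into the centralizer of \<open>V\<close> with elements mapping into \<open>V\<close>.\<close>

theorem globalization_lift:
  fixes L :: "('i, 'g, 'u, 'z) linking"
  assumes p: "Factorial_Ring.prime p" and link: "V_link_type p L V"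
    and \<sigma>: "globalization p (linking_quot L V) \<sigma>"
    and triv: "\<And>i z. i \<in> lkI L \<Longrightarrow> z \<in> lkZbar L i \<Longrightarrow> \<sigma> (lklam L i z) = V"
  obtains \<rho> where "globalization p L \<rho>" "\<And>x. x \<in> carrier (lkG L) \<Longrightarrow> V #>\<^bsub>lkU L\<^esub> \<rho> x = \<sigma> x"
proof -
  let ?G = "lkG L" and ?U = "lkU L" and ?I = "lkI L"
  define T where "T i = sub_tgroup (lkZ L i) (lkT L i)" for i
  define F where "F = free_pro_p_product p ?I T"
  define lam where "lam = free_induced p ?I T ?G (lklam L)"
  define pih where "pih = free_induced p ?I T ?U (lkpi L)"
  define Zhat where "Zhat i = {x \<in> carrier F. lam x \<in> lklam L i ` lkZbar L i}" for i
  define A where "A = {x \<in> carrier F. pih x \<in> centralizer_of ?U V}"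
  have L: "pro_p_linking_structure p L" and V: "closed_normal V ?U"
    using link by (simp_all add: V_link_type_def)
  obtain S where S: "S \<subseteq> (\<Union>i\<in>?I. kernel F ?U pih <#>\<^bsub>F\<^esub> closed_commutator F A (Zhat i))"
    "kernel F ?G lam = closed_normal_generate F S"
    using link by (auto simp: V_link_type_def Let_def T_def[abs_def] F_def lam_def pih_def Zhat_def[abs_def] A_def)
  have G: "pro_p_group p ?G" and U: "pro_p_group p ?U"
    and gen: "closed_generate ?G (\<Union>i\<in>?I. lklam L i ` lkT L i) = carrier ?G"
    using L by (simp_all add: pro_p_linking_structure_def)
  have nV: "V \<lhd> ?U" using V by (simp add: closed_normal_def)
  note Gd = pro_p_groupD[OF G] and Ud = pro_p_groupD[OF U]
  note Fp = pro_p_group_free_pro_p_product[OF p, of ?I T, folded F_def]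
  note Fd = pro_p_groupD[OF Fp]
  let ?Q = "quot_tgroup ?U V"
  note Qd = pro_p_groupD[OF pro_p_group_quot[OF p U V]]
  have Tc: "carrier (T i) = lkT L i" for i by (simp add: T_def)
  have lamT: "lklam L i \<in> chom (T i) ?G" if "i \<in> ?I" for i
  proof -
    have "lkT L i \<lhd> lkZ L i" "lklam L i \<in> chom (lkZ L i) ?G"
      using L that by (simp_all add: pro_p_linking_structure_def closed_normal_def)
    then show ?thesis
      unfolding T_def by (intro chom_sub subgroup.subset normal_imp_subgroup)
  qed
  have piT: "lkpi L i \<in> chom (T i) ?U" if "i \<in> ?I" for i
    using L that by (simp add: pro_p_linking_structure_def T_def)
  have lam: "lam \<in> chom F ?G" "\<And>i \<tau>. i \<in> ?I \<Longrightarrow> \<tau> \<in> lkT L i \<Longrightarrow> lam (free_inclusion p ?I T i \<tau>) = lklam L i \<tau>"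
    using free_induced_works[OF p G, of ?I "lklam L" T] lamT by (auto simp: lam_def F_def Tc)
  have pih: "pih \<in> chom F ?U" "\<And>i \<tau>. i \<in> ?I \<Longrightarrow> \<tau> \<in> lkT L i \<Longrightarrow> pih (free_inclusion p ?I T i \<tau>) = lkpi L i \<tau>"
    using free_induced_works[OF p U, of ?I "lkpi L" T] piT by (auto simp: pih_def F_def Tc)
  have inc: "free_inclusion p ?I T i \<tau> \<in> carrier F" if "i \<in> ?I" "\<tau> \<in> lkT L i" for i \<tau>
    using free_inclusion_mem[of i ?I \<tau> T p] that by (simp add: F_def Tc)
  interpret lam: group_hom F ?G lam using lam(1) Fd(1) Gd(1) by (rule chom_group_hom)
  interpret pih: group_hom F ?U pih using pih(1) Fd(1) Ud(1) by (rule chom_group_hom)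
  interpret V: normal V ?U by fact
  have surj: "lam ` carrier F = carrier ?G"
  proof
    show "carrier ?G \<subseteq> lam ` carrier F"
      unfolding gen[symmetric]
    proof (rule closed_generate_subset)
      show "closed_subgroup (lam ` carrier F) ?G"
        by (rule closed_subgroup_image[OF Fd(5,3) Gd(1,4) lam(1)])
      show "(\<Union>i\<in>?I. lklam L i ` lkT L i) \<subseteq> lam ` carrier F"
        using lam(2) inc by (metis (no_types, lifting) UN_least image_eqI image_subsetI)
    qed
  qed auto
  have s: "\<sigma> \<in> chom ?G ?Q" "\<And>i \<tau>. i \<in> ?I \<Longrightarrow> \<tau> \<in> lkT L i \<Longrightarrow> \<sigma> (lklam L i \<tau>) = V #>\<^bsub>?U\<^esub> lkpi L i \<tau>"
    using \<sigma> by (auto simp: globalization_def)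
  have agree: "\<sigma> (lam x) = V #>\<^bsub>?U\<^esub> pih x" if "x \<in> carrier F" for x
  proof (rule chom_eq_on_closed_generate[OF Fd(5) Qd(5,4)])
    show "(\<lambda>x. \<sigma> (lam x)) \<in> chom F ?Q" by (rule chom_compose[OF lam(1) s(1)])
    show "(\<lambda>x. V #>\<^bsub>?U\<^esub> pih x) \<in> chom F ?Q"
      by (rule chom_compose[OF pih(1) coset_chom_quot(2)[OF Ud(5) nV]])
    show "x \<in> closed_generate F (\<Union>i\<in>?I. free_inclusion p ?I T i ` lkT L i)"
      using that free_pro_p_product_generated[OF p, of ?I T] by (simp add: F_def Tc)
    show "(\<Union>i\<in>?I. free_inclusion p ?I T i ` lkT L i) \<subseteq> carrier F" using inc by blast
    fix y assume "y \<in> (\<Union>i\<in>?I. free_inclusion p ?I T i ` lkT L i)"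
    then show "\<sigma> (lam y) = V #>\<^bsub>?U\<^esub> pih y" using lam(2) pih(2) s(2) by auto
  qed
  have Zhat: "pih x \<in> V" if "i \<in> ?I" "x \<in> Zhat i" for i x
  proof -
    have "x \<in> carrier F" "\<sigma> (lam x) = V" using that triv by (auto simp: Zhat_def)
    then show ?thesis using agree[of x] rcoset_eq_self_iff[OF nV, of "pih x"] by simp
  qed
  have ker_pih: "closed_normal (kernel F ?U pih) F"
    by (rule closed_normal_kernel[OF Fd(5) Ud(1,2,4) pih(1)])
  have comm: "closed_commutator F A (Zhat i) \<subseteq> kernel F ?U pih" if i: "i \<in> ?I" for i
    unfolding closed_commutator_def
  proof (rule closed_generate_subset)
    show "closed_subgroup (kernel F ?U pih) F"
      using ker_pih by (simp add: closed_normal_def closed_subgroup_def normal_imp_subgroup)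
    show "{inv\<^bsub>F\<^esub> a \<otimes>\<^bsub>F\<^esub> inv\<^bsub>F\<^esub> b \<otimes>\<^bsub>F\<^esub> a \<otimes>\<^bsub>F\<^esub> b | a b. a \<in> A \<and> b \<in> Zhat i} \<subseteq> kernel F ?U pih"
    proof clarify
      fix a b assume a: "a \<in> A" and b: "b \<in> Zhat i"
      have c: "a \<in> carrier F" "b \<in> carrier F" "pih a \<otimes>\<^bsub>?U\<^esub> pih b = pih b \<otimes>\<^bsub>?U\<^esub> pih a"
        using a b Zhat[OF i b] by (auto simp: A_def Zhat_def centralizer_of_def)
      have "pih (inv\<^bsub>F\<^esub> a \<otimes>\<^bsub>F\<^esub> inv\<^bsub>F\<^esub> b \<otimes>\<^bsub>F\<^esub> a \<otimes>\<^bsub>F\<^esub> b)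
          = inv\<^bsub>?U\<^esub> pih a \<otimes>\<^bsub>?U\<^esub> (inv\<^bsub>?U\<^esub> pih b \<otimes>\<^bsub>?U\<^esub> (pih a \<otimes>\<^bsub>?U\<^esub> pih b))"
        using c(1,2) by (simp add: pih.H.m_assoc)
      also have "\<dots> = \<one>\<^bsub>?U\<^esub>"
        unfolding c(3) using c(1,2) by (simp add: pih.H.m_assoc[symmetric])
      finally show "inv\<^bsub>F\<^esub> a \<otimes>\<^bsub>F\<^esub> inv\<^bsub>F\<^esub> b \<otimes>\<^bsub>F\<^esub> a \<otimes>\<^bsub>F\<^esub> b \<in> kernel F ?U pih"
        using c(1,2) by (simp add: kernel_def)
    qed
  qed
  \<comment> \<open>Every relator is an element of the kernel of \<open>pih\<close> times a product of killed commutators.\<close>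
  have "S \<subseteq> kernel F ?U pih"
  proof
    fix x assume "x \<in> S"
    then obtain i where i: "i \<in> ?I" "x \<in> kernel F ?U pih <#>\<^bsub>F\<^esub> closed_commutator F A (Zhat i)"
      using S(1) by blast
    then obtain k c where "k \<in> kernel F ?U pih" "c \<in> kernel F ?U pih" "x = k \<otimes>\<^bsub>F\<^esub> c"
      using comm[OF i(1)] by (auto simp: set_mult_def)
    then show "x \<in> kernel F ?U pih" using subgroup.m_closed[OF pih.subgroup_kernel] by simp
  qed
  then have "kernel F ?G lam \<subseteq> kernel F ?U pih"
    unfolding S(2) by (rule closed_normal_generate_subset[OF ker_pih])
  then obtain \<rho> where \<rho>: "\<rho> \<in> chom ?G ?U" "\<And>x. x \<in> carrier F \<Longrightarrow> \<rho> (lam x) = pih x"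
    by (rule chom_factor[OF Fp G Ud(5) lam(1) surj pih(1)]) blast
  have "\<rho> (lklam L i \<tau>) = lkpi L i \<tau>" if "i \<in> ?I" "\<tau> \<in> lkT L i" for i \<tau>
    using \<rho>(2)[OF inc[OF that]] lam(2)[OF that] pih(2)[OF that] by simp
  then have "globalization p L \<rho>" using L \<rho>(1) by (simp add: globalization_def)
  moreover have "V #>\<^bsub>?U\<^esub> \<rho> x = \<sigma> x" if "x \<in> carrier ?G" for x
  proof -
    have "x \<in> lam ` carrier F" using that surj by simp
    then obtain y where y: "y \<in> carrier F" "x = lam y" by (elim imageE) blast
    then show ?thesis using agree[OF y(1)] \<rho>(2)[OF y(1)] by simp
  qed
  ultimately show ?thesis by (rule that)
qed

lemma section_image_subset:
  assumes "hom_section Z T s" shows "section_image Z T s \<subseteq> carrier Z"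
  using assms by (auto simp: hom_section_def section_image_def chom_def hom_def)

section \<open>The algebra of unitriangular matrices\<close>

lemma (in abelian_monoid) finsum_single:
  assumes "finite S" "i \<in> S" "f i \<in> carrier G" "\<And>k. k \<in> S \<Longrightarrow> k \<noteq> i \<Longrightarrow> f k = \<zero>"
  shows "finsum G f S = f i"
proof -
  have "finsum G f S = (\<Oplus>k\<in>S. if i = k then f i else \<zero>)"
    using assms by (intro finsum_cong') auto
  also have "\<dots> = f i" using add.finprod_singleton[OF assms(2,1), of "\<lambda>_. f i"] assms(3) by simp
  finally show ?thesis .
qed

lemma (in abelian_monoid) finsum_swap:
  assumes "finite A" "finite B" "\<And>a b. a \<in> A \<Longrightarrow> b \<in> B \<Longrightarrow> f a b \<in> carrier G"
  shows "(\<Oplus>a\<in>A. \<Oplus>b\<in>B. f a b) = (\<Oplus>b\<in>B. \<Oplus>a\<in>A. f a b)"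
  using assms(1,3)
proof (induction A rule: finite_induct)
  case (insert x A)
  then have "(\<Oplus>a\<in>insert x A. \<Oplus>b\<in>B. f a b) = (\<Oplus>b\<in>B. f x b) \<oplus> (\<Oplus>b\<in>B. \<Oplus>a\<in>A. f a b)"
    by (subst finsum_insert) (auto intro!: finsum_closed)
  also have "\<dots> = (\<Oplus>b\<in>B. f x b \<oplus> (\<Oplus>a\<in>A. f a b))"
    using insert by (intro finsum_addf[symmetric]) (auto intro!: finsum_closed)
  also have "\<dots> = (\<Oplus>b\<in>B. \<Oplus>a\<in>insert x A. f a b)"
    using insert by (intro finsum_cong') (auto intro!: finsum_closed finsum_insert[symmetric])
  finally show ?case .
qed simp

text \<open>The elementary matrix \<open>Id + a E\<^sub>i\<^sub>j\<close> for arbitrary \<open>i \<noteq> j\<close>; the matrices \<open>unitri_elem\<close> only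
cover the first superdiagonal.\<close>

definition transvection :: "('r, 'b) ring_scheme \<Rightarrow> nat \<Rightarrow> nat \<Rightarrow> nat \<Rightarrow> 'r \<Rightarrow> (nat \<times> nat \<Rightarrow> 'r)" where
  "transvection R n i j a =
     (\<lambda>(r, s)\<in>mat_idx n. if r = s then \<one>\<^bsub>R\<^esub> else if r = i \<and> s = j then a else \<zero>\<^bsub>R\<^esub>)"

lemma unitri_elem_eq_transvection: "unitri_elem R n l a = transvection R n l (l + 1) a"
  by (simp only: unitri_elem_def transvection_def)

lemma unitri_simps [simp]:
  "carrier (unitri R n) = unitri_carrier R n"
  "one (unitri R n) = (\<lambda>(i, j)\<in>mat_idx n. if i = j then \<one>\<^bsub>R\<^esub> else \<zero>\<^bsub>R\<^esub>)"
  "gtop (unitri R n) = subtopology (product_topology (\<lambda>_. rtop R) (mat_idx n)) (unitri_carrier R n)"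
  by (simp_all add: unitri_def)

lemma unitri_mult_apply:
  "i \<in> {1..n+1} \<Longrightarrow> j \<in> {1..n+1} \<Longrightarrow>
    (A \<otimes>\<^bsub>unitri R n\<^esub> B) (i, j) = (\<Oplus>\<^bsub>R\<^esub>k\<in>{1..n+1}. A (i, k) \<otimes>\<^bsub>R\<^esub> B (k, j))"
  by (simp add: unitri_def)

lemma unitri_mult_extensional: "A \<otimes>\<^bsub>unitri R n\<^esub> B \<in> extensional (mat_idx n)"
  by (simp add: unitri_def)

lemma mat_eqI:
  assumes "A \<in> extensional (mat_idx n)" "B \<in> extensional (mat_idx n)"
    "\<And>i j. i \<in> {1..n+1} \<Longrightarrow> j \<in> {1..n+1} \<Longrightarrow> A (i, j) = B (i, j)"
  shows "A = B"
  using assms by (intro extensionalityI[of A "mat_idx n"]) auto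

lemma unitri_carrierD:
  assumes "A \<in> unitri_carrier R n"
  shows "A \<in> extensional (mat_idx n)"
    "\<And>i j. i \<in> {1..n+1} \<Longrightarrow> j \<in> {1..n+1} \<Longrightarrow> A (i, j) \<in> carrier R"
    "\<And>i. i \<in> {1..n+1} \<Longrightarrow> A (i, i) = \<one>\<^bsub>R\<^esub>"
    "\<And>i j. i \<in> {1..n+1} \<Longrightarrow> j \<in> {1..n+1} \<Longrightarrow> j < i \<Longrightarrow> A (i, j) = \<zero>\<^bsub>R\<^esub>"
  using assms by (auto simp: unitri_carrier_def PiE_iff)

lemma unitri_carrierI:
  assumes "A \<in> extensional (mat_idx n)"
    "\<And>i j. i \<in> {1..n+1} \<Longrightarrow> j \<in> {1..n+1} \<Longrightarrow> A (i, j) \<in> carrier R"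
    "\<And>i. i \<in> {1..n+1} \<Longrightarrow> A (i, i) = \<one>\<^bsub>R\<^esub>"
    "\<And>i j. i \<in> {1..n+1} \<Longrightarrow> j \<in> {1..n+1} \<Longrightarrow> j < i \<Longrightarrow> A (i, j) = \<zero>\<^bsub>R\<^esub>"
  shows "A \<in> unitri_carrier R n"
  using assms by (auto simp: unitri_carrier_def PiE_iff)

context
  fixes R :: "('r, 'b) tring_scheme" (structure) and n :: nat
  assumes R: "cring R"
begin

interpretation cring R by (rule R)

lemma one_in_unitri: "\<one>\<^bsub>unitri R n\<^esub> \<in> unitri_carrier R n"
  by (rule unitri_carrierI) auto

lemma transvection_in_unitri:
  "a \<in> carrier R \<Longrightarrow> i < j \<Longrightarrow> transvection R n i j a \<in> unitri_carrier R n"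
  by (rule unitri_carrierI) (auto simp: transvection_def)

lemma unitri_mult_closed:
  assumes A: "A \<in> unitri_carrier R n" and B: "B \<in> unitri_carrier R n"
  shows "A \<otimes>\<^bsub>unitri R n\<^esub> B \<in> unitri_carrier R n"
proof (rule unitri_carrierI)
  note Ad = unitri_carrierD[OF A] and Bd = unitri_carrierD[OF B]
  show "A \<otimes>\<^bsub>unitri R n\<^esub> B \<in> extensional (mat_idx n)" by (rule unitri_mult_extensional)
  have zero: "A (i, k) \<otimes> B (k, j) = \<zero>"
    if "i \<in> {1..n+1}" "j \<in> {1..n+1}" "k \<in> {1..n+1}" "k < i \<or> j < k" for i j k
    using that(4) Ad(2,4)[OF that(1,3)] Bd(2,4)[OF that(3,2)] by auto
  show "(A \<otimes>\<^bsub>unitri R n\<^esub> B) (i, j) \<in> carrier R" if "i \<in> {1..n+1}" "j \<in> {1..n+1}" for i j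
    unfolding unitri_mult_apply[OF that] using that Ad(2) Bd(2) by (intro finsum_closed) auto
  show "(A \<otimes>\<^bsub>unitri R n\<^esub> B) (i, i) = \<one>" if i: "i \<in> {1..n+1}" for i
  proof -
    have "(\<Oplus>k\<in>{1..n+1}. A (i, k) \<otimes> B (k, i)) = A (i, i) \<otimes> B (i, i)"
      using i zero[OF i i] Ad(3)[OF i] Bd(3)[OF i] by (intro finsum_single) (auto simp: neq_iff)
    then show ?thesis unfolding unitri_mult_apply[OF i i] using Ad(3)[OF i] Bd(3)[OF i] by simp
  qed
  show "(A \<otimes>\<^bsub>unitri R n\<^esub> B) (i, j) = \<zero>" if i: "i \<in> {1..n+1}" "j \<in> {1..n+1}" "j < i" for i j
  proof -
    have "(\<Oplus>k\<in>{1..n+1}. A (i, k) \<otimes> B (k, j)) = (\<Oplus>k\<in>{1..n+1}. \<zero>)"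
    proof (intro finsum_cong')
      fix k assume "k \<in> {1..n+1}"
      then show "A (i, k) \<otimes> B (k, j) = \<zero>"
        using zero[OF i(1,2), of k] i(3) by (cases "k < i") auto
    qed auto
    then show ?thesis unfolding unitri_mult_apply[OF i(1,2)] by simp
  qed
qed

lemma unitri_mult_assoc:
  assumes A: "A \<in> unitri_carrier R n" and B: "B \<in> unitri_carrier R n" and C: "C \<in> unitri_carrier R n"
  shows "A \<otimes>\<^bsub>unitri R n\<^esub> B \<otimes>\<^bsub>unitri R n\<^esub> C = A \<otimes>\<^bsub>unitri R n\<^esub> (B \<otimes>\<^bsub>unitri R n\<^esub> C)"
proof (rule mat_eqI[OF unitri_mult_extensional unitri_mult_extensional])
  fix i j assume ij: "i \<in> {1..n+1}" "j \<in> {1..n+1}"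
  let ?S = "{1..n+1}"
  note Ad = unitri_carrierD(2)[OF A] and Bd = unitri_carrierD(2)[OF B] and Cd = unitri_carrierD(2)[OF C]
  have "(A \<otimes>\<^bsub>unitri R n\<^esub> B \<otimes>\<^bsub>unitri R n\<^esub> C) (i, j) = (\<Oplus>k\<in>?S. (\<Oplus>l\<in>?S. A (i, l) \<otimes> B (l, k)) \<otimes> C (k, j))"
    unfolding unitri_mult_apply[OF ij]
    by (intro finsum_cong') (use ij Ad Bd Cd in \<open>auto simp: unitri_mult_apply intro!: finsum_closed\<close>)
  also have "\<dots> = (\<Oplus>k\<in>?S. \<Oplus>l\<in>?S. A (i, l) \<otimes> B (l, k) \<otimes> C (k, j))"
    by (intro finsum_cong' finsum_ldistr) (use ij Ad Bd Cd in \<open>auto intro!: finsum_closed\<close>)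
  also have "\<dots> = (\<Oplus>l\<in>?S. \<Oplus>k\<in>?S. A (i, l) \<otimes> B (l, k) \<otimes> C (k, j))"
    by (intro finsum_swap) (use ij Ad Bd Cd in auto)
  also have "\<dots> = (\<Oplus>l\<in>?S. \<Oplus>k\<in>?S. A (i, l) \<otimes> (B (l, k) \<otimes> C (k, j)))"
    by (intro finsum_cong') (use ij Ad Bd Cd in \<open>auto simp: m_assoc intro!: finsum_closed\<close>)
  also have "\<dots> = (\<Oplus>l\<in>?S. A (i, l) \<otimes> (\<Oplus>k\<in>?S. B (l, k) \<otimes> C (k, j)))"
    by (intro finsum_cong' finsum_rdistr[symmetric]) (use ij Ad Bd Cd in \<open>auto intro!: finsum_closed\<close>)
  also have "\<dots> = (A \<otimes>\<^bsub>unitri R n\<^esub> (B \<otimes>\<^bsub>unitri R n\<^esub> C)) (i, j)"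
    unfolding unitri_mult_apply[OF ij]
    by (intro finsum_cong') (use ij Ad Bd Cd in \<open>auto simp: unitri_mult_apply intro!: finsum_closed\<close>)
  finally show "(A \<otimes>\<^bsub>unitri R n\<^esub> B \<otimes>\<^bsub>unitri R n\<^esub> C) (i, j) = (A \<otimes>\<^bsub>unitri R n\<^esub> (B \<otimes>\<^bsub>unitri R n\<^esub> C)) (i, j)" .
qed

text \<open>Multiplication by an elementary matrix on the right is a column operation.\<close>

lemma unitri_mult_transvection:
  assumes A: "A \<in> unitri_carrier R n" and a: "a \<in> carrier R"
    and ij: "i \<in> {1..n+1}" "j \<in> {1..n+1}" "i \<noteq> j" and rs: "r \<in> {1..n+1}" "s \<in> {1..n+1}"
  shows "(A \<otimes>\<^bsub>unitri R n\<^esub> transvection R n i j a) (r, s)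
    = (if s = j then A (r, j) \<oplus> A (r, i) \<otimes> a else A (r, s))"
proof -
  let ?S = "{1..n+1}" and ?E = "transvection R n i j a"
  note Ad = unitri_carrierD(2)[OF A]
  have "(\<Oplus>k\<in>?S. A (r, k) \<otimes> ?E (k, s)) = (if s = j then A (r, j) \<oplus> A (r, i) \<otimes> a else A (r, s))"
  proof (cases "s = j")
    case False
    then have "(\<Oplus>k\<in>?S. A (r, k) \<otimes> ?E (k, s)) = A (r, s) \<otimes> ?E (s, s)"
      using rs Ad by (intro finsum_single) (auto simp: transvection_def)
    then show ?thesis using False rs Ad by (simp add: transvection_def)
  next
    case True
    have "(\<Oplus>k\<in>?S. A (r, k) \<otimes> ?E (k, s))
        = (\<Oplus>k\<in>?S. (if k = j then A (r, j) else \<zero>) \<oplus> (if k = i then A (r, i) \<otimes> a else \<zero>))"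
      using rs ij Ad a True by (intro finsum_cong') (auto simp: transvection_def)
    also have "\<dots> = (\<Oplus>k\<in>?S. if k = j then A (r, j) else \<zero>) \<oplus> (\<Oplus>k\<in>?S. if k = i then A (r, i) \<otimes> a else \<zero>)"
      using rs ij Ad a by (intro finsum_addf) auto
    also have "(\<Oplus>k\<in>?S. if k = j then A (r, j) else \<zero>) = A (r, j)"
      using rs ij Ad finsum_single[of ?S j "\<lambda>k. if k = j then A (r, j) else \<zero>"] by simp
    also have "(\<Oplus>k\<in>?S. if k = i then A (r, i) \<otimes> a else \<zero>) = A (r, i) \<otimes> a"
      using rs ij a Ad finsum_single[of ?S i "\<lambda>k. if k = i then A (r, i) \<otimes> a else \<zero>"] by simp
    finally show ?thesis using True by simp
  qed
  then show ?thesis unfolding unitri_mult_apply[OF rs] .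
qed

lemma transvection_add:
  assumes "a \<in> carrier R" "b \<in> carrier R" "1 \<le> i" "i < j" "j \<le> n + 1"
  shows "transvection R n i j a \<otimes>\<^bsub>unitri R n\<^esub> transvection R n i j b = transvection R n i j (a \<oplus> b)"
proof (rule mat_eqI[OF unitri_mult_extensional])
  fix r s assume "r \<in> {1..n+1}" "s \<in> {1..n+1}"
  then show "(transvection R n i j a \<otimes>\<^bsub>unitri R n\<^esub> transvection R n i j b) (r, s) = transvection R n i j (a \<oplus> b) (r, s)"
    using assms transvection_in_unitri by (subst unitri_mult_transvection) (auto simp: transvection_def)
qed (simp add: transvection_def)

lemma transvection_zero: "transvection R n i j \<zero> = \<one>\<^bsub>unitri R n\<^esub>"
  by (rule mat_eqI[of _ n]) (auto simp: transvection_def)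

text \<open>Clear the entries above the diagonal row by row from the top. Once the rows above row \<open>i\<close> are
clear, column \<open>i\<close> is the unit vector \<open>e\<^sub>i\<close>, so subtracting a multiple of it from column \<open>j\<close> changes
the entry \<open>(i, j)\<close> and nothing else. Each step thus lowers the number of nonzero entries by one.
The principle serves twice: to find inverses before \<open>U\<^sub>n\<close> is known to be a group, and to show that
elementary matrices generate it.\<close>

lemma unitri_transvection_induct [consumes 1, case_names one mult]:
  assumes "A \<in> unitri_carrier R n"
    and one: "P \<one>\<^bsub>unitri R n\<^esub>"
    and mult: "\<And>B i j a. B \<in> unitri_carrier R n \<Longrightarrow> P B \<Longrightarrow> 1 \<le> i \<Longrightarrow> i < j \<Longrightarrow> j \<le> n + 1 \<Longrightarrow>
      a \<in> carrier R \<Longrightarrow> P (B \<otimes>\<^bsub>unitri R n\<^esub> transvection R n i j a)"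
  shows "P A"
proof -
  define supp where "supp A = {(i, j) \<in> mat_idx n. i < j \<and> A (i, j) \<noteq> \<zero>}" for A :: "nat \<times> nat \<Rightarrow> 'r"
  have fin: "finite (supp A)" for A
    by (rule finite_subset[of _ "mat_idx n"]) (auto simp: supp_def)
  show ?thesis using assms(1)
  proof (induction "card (supp A)" arbitrary: A rule: less_induct)
    case less
    note A = unitri_carrierD[OF less.prems]
    show ?case
    proof (cases "supp A = {}")
      case True
      have "A = \<one>\<^bsub>unitri R n\<^esub>"
      proof (rule mat_eqI[of _ n])
        fix i j assume ij: "i \<in> {1..n+1}" "j \<in> {1..n+1}"
        then have "i < j \<Longrightarrow> A (i, j) = \<zero>" using True by (auto simp: supp_def)
        then show "A (i, j) = \<one>\<^bsub>unitri R n\<^esub> (i, j)"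
          using ij A(3,4) by (cases i j rule: linorder_cases) auto
      qed (use A in auto)
      then show ?thesis using one by simp
    next
      case False
      \<comment> \<open>The first row that is not yet clear.\<close>
      define i where "i = Min (fst ` supp A)"
      have "i \<in> fst ` supp A" unfolding i_def using False fin by (intro Min_in) auto
      then obtain j where j: "(i, j) \<in> supp A" by auto
      have min: "i \<le> r" if "(r, s) \<in> supp A" for r s
        unfolding i_def using that fin[of A] by (intro Min_le) force+
      have ij: "i \<in> {1..n+1}" "j \<in> {1..n+1}" "i < j" using j by (auto simp: supp_def)
      define B where "B = A((i, j) := \<zero>)"
      have B: "B \<in> unitri_carrier R n"
        using A ij by (intro unitri_carrierI) (auto simp: B_def extensional_def)
      have "supp B = supp A - {(i, j)}" by (auto simp: supp_def B_def)
      then have "card (supp B) < card (supp A)" using j fin[of A] by (metis card_Diff1_less)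
      then have PB: "P B" using less.hyps B by blast
      have "A = B \<otimes>\<^bsub>unitri R n\<^esub> transvection R n i j (A (i, j))"
      proof (rule mat_eqI[OF A(1) unitri_mult_extensional])
        fix r s assume rs: "r \<in> {1..n+1}" "s \<in> {1..n+1}"
        have "r < i \<Longrightarrow> A (r, i) = \<zero>" using min[of r i] rs ij by (force simp: supp_def)
        then have "B (r, i) = (if r = i then \<one> else \<zero>)" if "r \<le> i \<or> i < r"
          using that A(3,4) rs(1) ij by (auto simp: B_def)
        then have c: "B (r, i) = (if r = i then \<one> else \<zero>)" by linarith
        show "A (r, s) = (B \<otimes>\<^bsub>unitri R n\<^esub> transvection R n i j (A (i, j))) (r, s)"
          using ij rs A(2) by (subst unitri_mult_transvection[OF B]) (auto simp: c, auto simp: B_def)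
      qed
      then show ?thesis using mult[OF B PB, of i j "A (i, j)"] ij A(2) by simp
    qed
  qed
qed

text \<open>Elementary matrices are invertible, and every unitriangular matrix is a product of them; this
yields inverses without a formula for them.\<close>

lemma group_unitri: "group (unitri R n)"
proof (rule groupI)
  have l_one: "\<one>\<^bsub>unitri R n\<^esub> \<otimes>\<^bsub>unitri R n\<^esub> A = A" if A: "A \<in> unitri_carrier R n" for A
  proof (rule mat_eqI[OF unitri_mult_extensional unitri_carrierD(1)[OF A]])
    fix i j assume ij: "i \<in> {1..n+1}" "j \<in> {1..n+1}"
    have "(\<Oplus>k\<in>{1..n+1}. \<one>\<^bsub>unitri R n\<^esub> (i, k) \<otimes> A (k, j)) = \<one>\<^bsub>unitri R n\<^esub> (i, i) \<otimes> A (i, j)"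
      using ij unitri_carrierD(2)[OF A] by (intro finsum_single) auto
    then show "(\<one>\<^bsub>unitri R n\<^esub> \<otimes>\<^bsub>unitri R n\<^esub> A) (i, j) = A (i, j)"
      unfolding unitri_mult_apply[OF ij] using ij unitri_carrierD(2)[OF A] by simp
  qed
  show "\<one>\<^bsub>unitri R n\<^esub> \<otimes>\<^bsub>unitri R n\<^esub> A = A" if "A \<in> carrier (unitri R n)" for A
    using l_one that by (simp del: unitri_simps(2))
  show "\<exists>B\<in>carrier (unitri R n). B \<otimes>\<^bsub>unitri R n\<^esub> A = \<one>\<^bsub>unitri R n\<^esub>" if "A \<in> carrier (unitri R n)" for A
    using that unfolding unitri_simps(1)
  proof (induction A rule: unitri_transvection_induct)
    case one
    then show ?case using l_one one_in_unitri by blast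
  next
    case (mult B i j a)
    then obtain B' where B': "B' \<in> unitri_carrier R n" "B' \<otimes>\<^bsub>unitri R n\<^esub> B = \<one>\<^bsub>unitri R n\<^esub>" by blast
    let ?E = "transvection R n i j a" and ?E' = "transvection R n i j (\<ominus> a)"
    have E: "?E \<in> unitri_carrier R n" "?E' \<in> unitri_carrier R n"
      using mult by (auto intro: transvection_in_unitri)
    have "(?E' \<otimes>\<^bsub>unitri R n\<^esub> B') \<otimes>\<^bsub>unitri R n\<^esub> (B \<otimes>\<^bsub>unitri R n\<^esub> ?E)
        = ?E' \<otimes>\<^bsub>unitri R n\<^esub> ((B' \<otimes>\<^bsub>unitri R n\<^esub> B) \<otimes>\<^bsub>unitri R n\<^esub> ?E)"
      using E B'(1) mult by (simp add: unitri_mult_assoc unitri_mult_closed del: unitri_simps(2))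
    also have "\<dots> = \<one>\<^bsub>unitri R n\<^esub>"
      using mult unfolding B'(2) l_one[OF E(1)] by (simp add: transvection_add l_neg transvection_zero)
    finally show ?case using E B'(1) unitri_mult_closed by blast
  qed
qed (use unitri_mult_closed unitri_mult_assoc one_in_unitri in \<open>simp_all del: unitri_simps(2)\<close>)

text \<open>The commutator relation between \<open>Id + a E\<^sub>i\<^sub>k\<close> and \<open>Id + E\<^sub>k\<^sub>,\<^sub>k\<^sub>+\<^sub>1\<close> produces \<open>Id + a E\<^sub>i\<^sub>,\<^sub>k\<^sub>+\<^sub>1\<close>,
so all elementary matrices are reached from those on the first superdiagonal.\<close>

lemma unitri_generated_by_superdiagonal:
  assumes H: "subgroup H (unitri R n)"
    and elem: "\<And>l a. l \<in> {1..n} \<Longrightarrow> a \<in> carrier R \<Longrightarrow> unitri_elem R n l a \<in> H"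
  shows "H = carrier (unitri R n)"
proof
  interpret U: group "unitri R n" by (rule group_unitri)
  have E: "transvection R n i j a \<in> H" if "1 \<le> i" "i < j" "j \<le> n + 1" "a \<in> carrier R" for i j a
    using that
  proof (induction j)
    case (Suc k)
    show ?case
    proof (cases "k = i")
      case True
      then show ?thesis using elem[of i a] Suc.prems by (simp add: unitri_elem_eq_transvection)
    next
      case False
      then have k: "i < k" using Suc.prems by simp
      let ?X = "transvection R n k (Suc k) \<one>" and ?Y = "transvection R n i (Suc k) a"
        and ?Z = "transvection R n i k a"
      have c: "?X \<in> unitri_carrier R n" "?Y \<in> unitri_carrier R n" "?Z \<in> unitri_carrier R n"
        using Suc.prems k by (auto intro: transvection_in_unitri)
      have X: "?X \<in> H" using elem[of k \<one>] Suc.prems k by (simp add: unitri_elem_eq_transvection)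
      have Z: "?Z \<in> H" using Suc.IH Suc.prems k by simp
      \<comment> \<open>The commutator relation, free of inverses so that it can be checked entry by entry.\<close>
      have "?X \<otimes>\<^bsub>unitri R n\<^esub> ?Y \<otimes>\<^bsub>unitri R n\<^esub> ?Z = ?Z \<otimes>\<^bsub>unitri R n\<^esub> ?X"
      proof (rule mat_eqI[OF unitri_mult_extensional unitri_mult_extensional])
        fix r s assume "r \<in> {1..n+1}" "s \<in> {1..n+1}"
        then show "(?X \<otimes>\<^bsub>unitri R n\<^esub> ?Y \<otimes>\<^bsub>unitri R n\<^esub> ?Z) (r, s) = (?Z \<otimes>\<^bsub>unitri R n\<^esub> ?X) (r, s)"
          using Suc.prems k c
          by (simp add: unitri_mult_transvection unitri_mult_closed) (auto simp: transvection_def)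
      qed
      then have "?Y = inv\<^bsub>unitri R n\<^esub> ?X \<otimes>\<^bsub>unitri R n\<^esub> (?Z \<otimes>\<^bsub>unitri R n\<^esub> ?X \<otimes>\<^bsub>unitri R n\<^esub> inv\<^bsub>unitri R n\<^esub> ?Z)"
        using c U.m_assoc U.inv_solve_right U.inv_solve_left by (metis U.m_closed unitri_simps(1))
      then show ?thesis
        using X Z subgroup.m_closed[OF H] subgroup.m_inv_closed[OF H] by metis
    qed
  qed simp
  show "carrier (unitri R n) \<subseteq> H"
  proof
    fix A assume "A \<in> carrier (unitri R n)"
    then have "A \<in> unitri_carrier R n" by simp
    then show "A \<in> H"
      by (induction A rule: unitri_transvection_induct)
        (use E subgroup.one_closed[OF H] subgroup.m_closed[OF H] in \<open>auto simp del: unitri_simps(2)\<close>)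
  qed
qed (rule subgroup.subset[OF H])

end

section \<open>Unitriangular matrices over a pro-\<open>p\<close> ring form a pro-\<open>p\<close> group\<close>

lemma pro_p_ringD:
  assumes "pro_p_ring p R"
  shows "cring R" "topspace (rtop R) = carrier R"
    "continuous_map (prod_topology (rtop R) (rtop R)) (rtop R) (\<lambda>(x, y). x \<oplus>\<^bsub>R\<^esub> y)"
    "continuous_map (rtop R) (rtop R) (\<lambda>x. \<ominus>\<^bsub>R\<^esub> x)"
    "continuous_map (prod_topology (rtop R) (rtop R)) (rtop R) (\<lambda>(x, y). x \<otimes>\<^bsub>R\<^esub> y)"
    "compact_space (rtop R)" "Hausdorff_space (rtop R)"
  using assms by (auto simp: pro_p_ring_def)

lemma additive_tgroup_simps [simp]:
  "carrier (additive_tgroup R) = carrier R" "mult (additive_tgroup R) = add R"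
  "one (additive_tgroup R) = zero R" "gtop (additive_tgroup R) = rtop R"
  by (simp_all add: additive_tgroup_def)

lemma a_r_coset_additive: "A +>\<^bsub>R\<^esub> x = A #>\<^bsub>additive_tgroup R\<^esub> x"
  by (simp add: a_r_coset_def r_coset_def)

lemma inv_additive_tgroup: "inv\<^bsub>additive_tgroup R\<^esub> x = \<ominus>\<^bsub>R\<^esub> x"
  by (simp add: a_inv_def inv_cong[of "additive_tgroup R" "add_monoid R"])

lemma topological_group_additive:
  assumes "pro_p_ring p R"
  shows "topological_group (additive_tgroup R)"
proof -
  note Rd = pro_p_ringD[OF assms]
  interpret cring R by (rule Rd)
  have "group (additive_tgroup R)"
    by (rule group_cong[OF _ _ _ a_group]) simp_all
  then show ?thesis using Rd by (simp add: topological_group_def inv_additive_tgroup)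
qed

lemma ideal_normal_additive:
  assumes "ideal A R" shows "A \<lhd> additive_tgroup R"
proof -
  interpret ideal A R by fact
  have g: "group (additive_tgroup R)"
    by (rule group_cong[OF _ _ _ a_group]) simp_all
  show ?thesis
  proof (rule group.normal_invI[OF g])
    show "subgroup A (additive_tgroup R)"
    proof (rule group.subgroupI[OF g])
      show "A \<noteq> {}" using additive_subgroup.zero_closed[OF additive_subgroup_axioms] by blast
    qed (use a_subset a_closed a_inv_closed in \<open>auto simp: inv_additive_tgroup\<close>)
    fix x h assume "x \<in> carrier (additive_tgroup R)" "h \<in> A"
    then have "x \<oplus>\<^bsub>R\<^esub> h \<oplus>\<^bsub>R\<^esub> \<ominus>\<^bsub>R\<^esub> x = h" using Icarr by (simp add: a_ac r_neg r_neg1 r_neg2)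
    then show "x \<otimes>\<^bsub>additive_tgroup R\<^esub> h \<otimes>\<^bsub>additive_tgroup R\<^esub> inv\<^bsub>additive_tgroup R\<^esub> x \<in> A"
      using \<open>h \<in> A\<close> by (simp add: inv_additive_tgroup)
  qed
qed

lemma continuous_map_finsum:
  assumes R: "pro_p_ring p R" and S: "finite S" "\<And>k. k \<in> S \<Longrightarrow> continuous_map X (rtop R) (f k)"
  shows "continuous_map X (rtop R) (\<lambda>x. \<Oplus>\<^bsub>R\<^esub>k\<in>S. f k x)"
proof -
  note Rd = pro_p_ringD[OF R]
  interpret cring R by (rule Rd)
  show ?thesis using S
  proof (induction S rule: finite_induct)
    case (insert k S)
    have "continuous_map X (prod_topology (rtop R) (rtop R)) (\<lambda>x. (f k x, \<Oplus>\<^bsub>R\<^esub>k\<in>S. f k x))"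
      using insert by (intro continuous_map_pairedI) auto
    from continuous_map_compose[OF this Rd(3)]
    have "continuous_map X (rtop R) (\<lambda>x. f k x \<oplus>\<^bsub>R\<^esub> (\<Oplus>\<^bsub>R\<^esub>k\<in>S. f k x))" by (simp add: o_def)
    moreover have "f l x \<in> carrier R" if "x \<in> topspace X" "l \<in> insert k S" for x l
      using insert.prems[OF that(2)] that(1) Rd(2) by (auto simp: continuous_map_def)
    ultimately show ?case
      by (rule_tac continuous_map_eq[of _ _ "\<lambda>x. f k x \<oplus>\<^bsub>R\<^esub> (\<Oplus>\<^bsub>R\<^esub>k\<in>S. f k x)"])
        (use insert.hyps in \<open>auto intro!: finsum_insert[symmetric]\<close>)
  qed (use Rd(2) in simp)
qed

lemma unitri_carrier_eq_PiE:
  assumes "cring R"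
  shows "unitri_carrier R n = (\<Pi>\<^sub>E (i, j)\<in>mat_idx n. if i = j then {\<one>\<^bsub>R\<^esub>} else if j < i then {\<zero>\<^bsub>R\<^esub>} else carrier R)"
proof -
  interpret cring R by fact
  show ?thesis
    by (rule Set.set_eqI) (force simp: unitri_carrier_def PiE_iff split: if_splits)
qed

lemma continuous_map_unitri_component:
  assumes "i \<in> {1..n+1}" "j \<in> {1..n+1}"
  shows "continuous_map (gtop (unitri R n)) (rtop R) (\<lambda>A. A (i, j))"
  using continuous_map_product_projection[of "(i, j)" "mat_idx n" "\<lambda>_. rtop R"] assms
  by (auto intro: continuous_map_from_subtopology)

lemma continuous_map_into_unitri:
  assumes "\<And>x. x \<in> topspace X \<Longrightarrow> f x \<in> unitri_carrier R n"
    and "\<And>i j. i \<in> {1..n+1} \<Longrightarrow> j \<in> {1..n+1} \<Longrightarrow> continuous_map X (rtop R) (\<lambda>x. f x (i, j))"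
  shows "continuous_map X (gtop (unitri R n)) f"
  unfolding unitri_simps continuous_map_in_subtopology continuous_map_componentwise
  using assms by (auto simp: unitri_carrier_def PiE_iff)

text \<open>As a set \<open>U\<^sub>n\<close> is a product of copies of the ring and of points, so it is compact; multiplication is
polynomial in the entries.\<close>

lemma topological_group_unitri:
  assumes R: "pro_p_ring p R"
  shows "topological_group (unitri R n)" "compact_space (gtop (unitri R n))"
    "Hausdorff_space (gtop (unitri R n))"
proof -
  note Rd = pro_p_ringD[OF R]
  interpret cring R by (rule Rd)
  have sub: "unitri_carrier R n \<subseteq> (\<Pi>\<^sub>E x\<in>mat_idx n. carrier R)"
    by (auto simp: unitri_carrier_def)
  have top: "topspace (gtop (unitri R n)) = carrier (unitri R n)"
    using sub Rd(2) by (auto simp: PiE_def)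
  show H: "Hausdorff_space (gtop (unitri R n))"
    using Rd(7) by (simp add: Hausdorff_space_subtopology Hausdorff_space_product_topology)
  have "compactin (rtop R) (carrier R)" using Rd(2,6) by (simp add: compact_space_def)
  then have "compactin (product_topology (\<lambda>_. rtop R) (mat_idx n)) (unitri_carrier R n)"
    unfolding unitri_carrier_eq_PiE[OF Rd(1)] compactin_PiE by (auto simp: Rd(2))
  then show C: "compact_space (gtop (unitri R n))" by (simp add: compact_space_subtopology)
  have m: "continuous_map (prod_topology (gtop (unitri R n)) (gtop (unitri R n))) (gtop (unitri R n))
      (\<lambda>(A, B). A \<otimes>\<^bsub>unitri R n\<^esub> B)"
  proof (rule continuous_map_into_unitri)
    show "(case z of (A, B) \<Rightarrow> A \<otimes>\<^bsub>unitri R n\<^esub> B) \<in> unitri_carrier R n"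
      if "z \<in> topspace (prod_topology (gtop (unitri R n)) (gtop (unitri R n)))" for z
      using that unitri_mult_closed[OF Rd(1)] unfolding topspace_prod_topology top by auto
    fix i j assume ij: "i \<in> {1..n+1}" "j \<in> {1..n+1}"
    let ?X = "prod_topology (gtop (unitri R n)) (gtop (unitri R n))"
    have "continuous_map ?X (rtop R) (\<lambda>z. \<Oplus>\<^bsub>R\<^esub>k\<in>{1..n+1}. fst z (i, k) \<otimes>\<^bsub>R\<^esub> snd z (k, j))"
    proof (rule continuous_map_finsum[OF R])
      fix k assume k: "k \<in> {1..n+1}"
      have "continuous_map ?X (prod_topology (rtop R) (rtop R)) (\<lambda>z. (fst z (i, k), snd z (k, j)))"
        using continuous_map_compose[OF continuous_map_fst continuous_map_unitri_component[OF ij(1) k]]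
          continuous_map_compose[OF continuous_map_snd continuous_map_unitri_component[OF k ij(2)]]
        by (intro continuous_map_pairedI) (auto simp: o_def)
      from continuous_map_compose[OF this Rd(5)]
      show "continuous_map ?X (rtop R) (\<lambda>z. fst z (i, k) \<otimes>\<^bsub>R\<^esub> snd z (k, j))" by (simp add: o_def)
    qed simp
    then show "continuous_map ?X (rtop R) (\<lambda>z. (case z of (A, B) \<Rightarrow> A \<otimes>\<^bsub>unitri R n\<^esub> B) (i, j))"
      unfolding case_prod_unfold unitri_mult_apply[OF ij] .
  qed
  show "topological_group (unitri R n)"
    by (rule topological_groupI_compact[OF group_unitri[OF Rd(1)] top C H m])
qed

lemma unitri_map_hom:
  fixes R :: "('r, 'b) tring_scheme" and S :: "('s, 'c) tring_scheme"
  assumes h: "ring_hom_cring R S h"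
  shows "(\<lambda>A. \<lambda>x\<in>mat_idx n. h (A x)) \<in> hom (unitri R n) (unitri S n)"
proof -
  interpret ring_hom_cring R S h by fact
  let ?h = "\<lambda>A. \<lambda>x\<in>mat_idx n. h (A x)"
  show ?thesis
  proof (rule homI)
    fix A assume "A \<in> carrier (unitri R n)"
    then have A: "A \<in> unitri_carrier R n" by simp
    show "?h A \<in> carrier (unitri S n)"
      unfolding unitri_simps(1) using unitri_carrierD[OF A] by (intro unitri_carrierI) auto
    fix B assume "B \<in> carrier (unitri R n)"
    then have B: "B \<in> unitri_carrier R n" by simp
    show "?h (A \<otimes>\<^bsub>unitri R n\<^esub> B) = ?h A \<otimes>\<^bsub>unitri S n\<^esub> ?h B"
    proof (rule mat_eqI[OF _ unitri_mult_extensional])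
      fix i j assume ij: "i \<in> {1..n+1}" "j \<in> {1..n+1}"
      have "h (\<Oplus>\<^bsub>R\<^esub>k\<in>{1..n+1}. A (i, k) \<otimes>\<^bsub>R\<^esub> B (k, j)) = (\<Oplus>\<^bsub>S\<^esub>k\<in>{1..n+1}. ?h A (i, k) \<otimes>\<^bsub>S\<^esub> ?h B (k, j))"
        using ij unitri_carrierD(2)[OF A] unitri_carrierD(2)[OF B]
        by (subst hom_finsum) (auto intro!: S.finsum_cong')
      then show "?h (A \<otimes>\<^bsub>unitri R n\<^esub> B) (i, j) = (?h A \<otimes>\<^bsub>unitri S n\<^esub> ?h B) (i, j)"
        unfolding unitri_mult_apply[OF ij] using ij by (simp add: unitri_def)
    qed simp
  qed
qed

text \<open>The entries above the diagonal are free and the others are fixed.\<close>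

lemma card_unitri_carrier:
  assumes "cring R" "card (carrier R) = p ^ k"
  shows "\<exists>l. card (unitri_carrier R n) = p ^ l"
proof -
  have "card (unitri_carrier R n)
      = (\<Prod>x\<in>mat_idx n. card (case x of (i, j) \<Rightarrow> if i = j then {\<one>\<^bsub>R\<^esub>} else if j < i then {\<zero>\<^bsub>R\<^esub>} else carrier R))"
    unfolding unitri_carrier_eq_PiE[OF assms(1)] by (rule card_PiE) simp
  also have "\<dots> = (\<Prod>x\<in>mat_idx n. p ^ (case x of (i, j) \<Rightarrow> if i \<ge> j then 0 else k))"
    by (rule prod.cong) (auto simp: assms(2))
  finally show ?thesis by (auto simp: power_sum[symmetric])
qed

text \<open>Unitriangular groups are defined over topological rings, so a finite quotient ring has to be
given a topology before matrices over it can be formed.\<close>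

definition discrete_tring :: "'a ring \<Rightarrow> 'a tring" where
  "discrete_tring S = ring.extend S (tring.fields (discrete_topology (carrier S)))"

lemma discrete_tring_simps [simp]:
  "carrier (discrete_tring S) = carrier S" "mult (discrete_tring S) = mult S"
  "one (discrete_tring S) = one S" "add (discrete_tring S) = add S" "zero (discrete_tring S) = zero S"
  by (simp_all add: discrete_tring_def ring.defs)

lemma ring_hom_cring_discrete:
  assumes "ring_hom_cring R S h"
  shows "ring_hom_cring R (discrete_tring S) h"
proof -
  have "cring (discrete_tring S)" if "cring S"
  proof -
    interpret S: cring S by fact
    have "abelian_group (discrete_tring S)"
      by (rule abelian_groupI) (auto simp: S.a_ac intro: S.l_neg)
    moreover have "comm_monoid (discrete_tring S)"
      by (rule comm_monoidI) (auto simp: S.m_ac)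
    ultimately show ?thesis by (rule cringI) (simp add: S.l_distr)
  qed
  then show ?thesis using assms
    by (simp add: ring_hom_cring_def ring_hom_cring_axioms_def ring_hom_def)
qed

text \<open>A basic neighbourhood of the identity constrains finitely many entries, and translating these
constraints to \<open>0\<close> gives one neighbourhood of \<open>0\<close> in the ring. It contains an open ideal \<open>A\<close> of
\<open>p\<close>-power index. Reduction modulo \<open>A\<close> maps \<open>U\<^sub>n\<close> to the finite \<open>p\<close>-group of unitriangular matrices
over the quotient ring, and its kernel satisfies all the constraints.\<close>

theorem pro_p_group_unitri:
  fixes R :: "('r, 'b) tring_scheme"
  assumes p: "Factorial_Ring.prime p" and R: "pro_p_ring p R"
  shows "pro_p_group p (unitri R n)"
proof (rule pro_p_groupI[where 'f = "nat \<times> nat \<Rightarrow> 'r set" and 'c = "((nat \<times> nat \<Rightarrow> 'r set), unit) tgroup_ext", OF p topological_group_unitri[OF R]])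
  note Rd = pro_p_ringD[OF R]
  note Ud = topological_groupD[OF topological_group_unitri(1)[OF R, of n]]
  interpret cring R by (rule Rd)
  fix W assume "openin (gtop (unitri R n)) W" "\<one>\<^bsub>unitri R n\<^esub> \<in> W"
  then obtain W' where W': "openin (product_topology (\<lambda>_. rtop R) (mat_idx n)) W'" "W = W' \<inter> unitri_carrier R n"
      "\<one>\<^bsub>unitri R n\<^esub> \<in> W'"
    by (auto simp: openin_subtopology)
  let ?one = "\<one>\<^bsub>unitri R n\<^esub>"
  obtain X where X0: "finite {x \<in> mat_idx n. X x \<noteq> topspace (rtop R)} \<and> (\<forall>x\<in>mat_idx n. openin (rtop R) (X x)) \<and>
      ?one \<in> Pi\<^sub>E (mat_idx n) X \<and> Pi\<^sub>E (mat_idx n) X \<subseteq> W'"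
    by (rule exE[OF bspec[OF iffD1[OF openin_product_topology_alt W'(1)] W'(3)]])
  have X: "\<And>x. x \<in> mat_idx n \<Longrightarrow> openin (rtop R) (X x)" "?one \<in> Pi\<^sub>E (mat_idx n) X"
      "Pi\<^sub>E (mat_idx n) X \<subseteq> W'"
    using X0 by (simp_all only:)
  have oneR: "?one x \<in> carrier R" if "x \<in> mat_idx n" for x using that by auto
  define W0 where "W0 = (\<Inter>x\<in>mat_idx n. {r \<in> topspace (rtop R). r \<oplus>\<^bsub>R\<^esub> ?one x \<in> X x})"
  have "openin (rtop R) W0"
    unfolding W0_def
  proof (rule openin_INT2)
    fix x assume x: "x \<in> mat_idx n"
    show "openin (rtop R) {r \<in> topspace (rtop R). r \<oplus>\<^bsub>R\<^esub> ?one x \<in> X x}"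
      using openin_continuous_map_preimage[OF continuous_right_mult[OF topological_group_additive[OF R]], of "?one x" "X x"]
        oneR[OF x] X(1)[OF x] by simp
  qed auto
  moreover have "\<zero>\<^bsub>R\<^esub> \<in> W0"
    using X(2) oneR by (auto simp: W0_def Rd(2) PiE_iff simp del: unitri_simps(2))
  ultimately obtain A k where A: "ideal A R" "openin (rtop R) A" "A \<subseteq> W0"
      "finite (carrier (R Quot A))" "card (carrier (R Quot A)) = p ^ k"
    using R unfolding pro_p_ring_def by blast
  let ?S = "discrete_tring (R Quot A)"
  let ?F = "unitri ?S n" and ?h = "\<lambda>M. \<lambda>x\<in>mat_idx n. A +>\<^bsub>R\<^esub> M x"
  have rh: "ring_hom_cring R ?S (\<lambda>x. A +>\<^bsub>R\<^esub> x)"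
    by (rule ring_hom_cring_discrete[OF ideal.rcos_ring_hom_cring[OF A(1) Rd(1)]])
  then have cS: "cring ?S" by (simp add: ring_hom_cring_def)
  interpret F: group ?F by (rule group_unitri[OF cS])
  have hom: "?h \<in> hom (unitri R n) ?F" by (rule unitri_map_hom[OF rh])
  interpret h: group_hom "unitri R n" ?F ?h
    using hom Ud(1) by (simp add: group_hom_def group_hom_axioms_def F.is_group del: unitri_simps)
  have nA: "A \<lhd> additive_tgroup R" by (rule ideal_normal_additive[OF A(1)])
  have coset: "(\<lambda>r. A #>\<^bsub>additive_tgroup R\<^esub> r) \<in> chom (additive_tgroup R) (discrete_tgroup (additive_tgroup R Mod A))"
    using coset_chom[OF topological_group_additive[OF R] nA] A(2) by simp
  have opc: "openin (rtop R) {r \<in> carrier R. A +>\<^bsub>R\<^esub> r = C}" if "C \<in> carrier (R Quot A)" for C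
  proof -
    have "C \<in> carrier (additive_tgroup R Mod A)"
      using that by (auto simp: FactRing_def A_RCOSETS_def' carrier_FactGroup a_r_coset_additive)
    then show ?thesis
      using coset chom_discrete_iff[of "additive_tgroup R" "\<lambda>r. A #>\<^bsub>additive_tgroup R\<^esub> r" "additive_tgroup R Mod A"] Rd(2)
      by (simp add: a_r_coset_additive)
  qed
  have "openin (gtop (unitri R n)) {M \<in> carrier (unitri R n). ?h M = Y}" if Y: "Y \<in> carrier ?F" for Y
  proof -
    have Yd: "Y \<in> extensional (mat_idx n)" "\<And>x. x \<in> mat_idx n \<Longrightarrow> Y x \<in> carrier (R Quot A)"
      using Y unitri_carrierD(1,2)[of Y ?S n] by auto
    let ?P = "\<Pi>\<^sub>E x\<in>mat_idx n. {r \<in> carrier R. A +>\<^bsub>R\<^esub> r = Y x}"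
    have "openin (product_topology (\<lambda>_. rtop R) (mat_idx n)) ?P"
      using opc Yd(2) by (subst openin_PiE) auto
    moreover have "{M \<in> carrier (unitri R n). ?h M = Y} = ?P \<inter> unitri_carrier R n"
    proof (intro Set.set_eqI iffI)
      fix M assume M: "M \<in> {M \<in> carrier (unitri R n). ?h M = Y}"
      then have "A +>\<^bsub>R\<^esub> M x = Y x" if "x \<in> mat_idx n" for x using that by auto
      then show "M \<in> ?P \<inter> unitri_carrier R n" using M by (auto simp: unitri_carrier_def PiE_iff)
    next
      fix M assume M: "M \<in> ?P \<inter> unitri_carrier R n"
      then have "?h M = Y" by (intro extensionalityI[OF _ Yd(1)]) (auto simp: PiE_iff)
      then show "M \<in> {M \<in> carrier (unitri R n). ?h M = Y}" using M by simp
    qed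
    ultimately show ?thesis by (auto simp: openin_subtopology)
  qed
  then have "?h \<in> chom (unitri R n) (discrete_tgroup ?F)"
    using hom chom_discrete_iff[OF Ud(2)] by blast
  moreover have "kernel (unitri R n) ?F ?h \<subseteq> W"
  proof
    fix M assume M: "M \<in> kernel (unitri R n) ?F ?h"
    then have Mc: "M \<in> unitri_carrier R n" and hM: "?h M = ?h ?one"
      using h.hom_one by (auto simp: kernel_def simp del: unitri_simps(2))
    have eq: "A +>\<^bsub>R\<^esub> M x = A +>\<^bsub>R\<^esub> ?one x" if "x \<in> mat_idx n" for x
      using fun_cong[OF hM, of x] that by (simp del: unitri_simps(2))
    have "M x \<in> X x" if x: "x \<in> mat_idx n" for x
    proof -
      have Mx: "M x \<in> carrier R" using Mc x by (auto simp: unitri_carrier_def PiE_iff)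
      have "M x \<oplus>\<^bsub>R\<^esub> \<ominus>\<^bsub>R\<^esub> ?one x \<in> A"
        using eq[OF x] rcoset_eq_iff[OF nA, of "M x" "?one x"] Mx oneR[OF x]
        by (simp add: a_r_coset_additive inv_additive_tgroup del: unitri_simps(2))
      then have "M x \<oplus>\<^bsub>R\<^esub> \<ominus>\<^bsub>R\<^esub> ?one x \<oplus>\<^bsub>R\<^esub> ?one x \<in> X x"
        using A(3) x by (auto simp: W0_def simp del: unitri_simps(2))
      then show ?thesis using Mx oneR[OF x] by (simp add: a_assoc l_neg del: unitri_simps(2))
    qed
    then have "M \<in> Pi\<^sub>E (mat_idx n) X" using unitri_carrierD(1)[OF Mc] by (simp add: PiE_iff)
    then show "M \<in> W" using X(3) W'(2) Mc by blast
  qed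
  moreover obtain l where l: "card (unitri_carrier ?S n) = p ^ l"
    using card_unitri_carrier[OF cS, of p k n] A(5) by auto
  moreover have "finite (carrier ?F)"
    using l p card.infinite[of "unitri_carrier ?S n"] by auto
  ultimately show "\<exists>(F::(nat \<times> nat \<Rightarrow> 'r set) tgroup) h k. group F \<and> finite (carrier F) \<and> order F = p ^ k \<and>
      h \<in> chom (unitri R n) (discrete_tgroup F) \<and> kernel (unitri R n) F h \<subseteq> W"
    using F.is_group by (intro exI[of _ ?F] exI[of _ ?h] exI[of _ l]) (simp add: order_def)
qed

lemma unitri_elem_chom:
  fixes R :: "('r, 'b) tring_scheme"
  assumes R: "pro_p_ring p R" and l: "l \<in> {1..n}"
  shows "unitri_elem R n l \<in> chom (additive_tgroup R) (unitri R n)"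
proof -
  note Rd = pro_p_ringD[OF R]
  interpret cring R by (rule Rd)
  have mem: "unitri_elem R n l a \<in> unitri_carrier R n" if "a \<in> carrier R" for a
    unfolding unitri_elem_eq_transvection by (rule transvection_in_unitri[OF Rd(1) that]) simp
  have "unitri_elem R n l \<in> hom (additive_tgroup R) (unitri R n)"
    by (rule homI) (use mem l transvection_add[OF Rd(1), of _ _ l "l + 1" n] in \<open>auto simp: unitri_elem_eq_transvection\<close>)
  moreover have "continuous_map (rtop R) (gtop (unitri R n)) (unitri_elem R n l)"
  proof (rule continuous_map_into_unitri)
    fix i j assume "i \<in> {1..n+1}" "j \<in> {1..n+1}"
    then have "(\<lambda>a. unitri_elem R n l a (i, j))
        = (if i = j then (\<lambda>a. \<one>\<^bsub>R\<^esub>) else if i = l \<and> j = l + 1 then (\<lambda>a. a) else (\<lambda>a. \<zero>\<^bsub>R\<^esub>))"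
      by (auto simp: unitri_elem_def)
    then show "continuous_map (rtop R) (rtop R) (\<lambda>a. unitri_elem R n l a (i, j))"
      by (auto simp: Rd(2))
  qed (use mem Rd(2) in simp)
  ultimately show ?thesis by (simp add: chom_def)
qed

section \<open>Diagonal blocks and the fibre product of unitriangular groups\<close>

text \<open>Both \<open>proj_ul\<close> and \<open>proj_lr\<close> are of this form, with offsets \<open>0\<close> and \<open>n - m\<close>, which lets
their properties be proved once.\<close>

definition diagonal_block :: "nat \<Rightarrow> nat \<Rightarrow> (nat \<times> nat \<Rightarrow> 'r) \<Rightarrow> (nat \<times> nat \<Rightarrow> 'r)" where
  "diagonal_block d m A = (\<lambda>(i, j)\<in>mat_idx m. A (i + d, j + d))"

lemma proj_ul_eq_diagonal_block: "proj_ul n m = diagonal_block 0 m"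
  by (simp add: fun_eq_iff proj_ul_def diagonal_block_def)

lemma proj_lr_eq_diagonal_block: "proj_lr n m = diagonal_block (n - m) m"
  by (rule ext) (simp only: proj_lr_def diagonal_block_def)

lemma diagonal_block_apply:
  "i \<in> {1..m+1} \<Longrightarrow> j \<in> {1..m+1} \<Longrightarrow> diagonal_block d m A (i, j) = A (i + d, j + d)"
  by (simp add: diagonal_block_def)

lemma diagonal_block_extensional: "diagonal_block d m A \<in> extensional (mat_idx m)"
  by (simp add: diagonal_block_def)

lemma diagonal_block_diagonal_block:
  assumes "d + k \<le> m"
  shows "diagonal_block d k (diagonal_block e m A) = diagonal_block (d + e) k A"
  by (rule mat_eqI[OF diagonal_block_extensional diagonal_block_extensional])
    (use assms in \<open>simp add: diagonal_block_apply add.assoc\<close>)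

text \<open>In a product of upper triangular matrices, an entry inside a diagonal block only involves indices
between its row and its column, hence only entries of that block.\<close>

lemma diagonal_block_chom:
  fixes R :: "('r, 'b) tring_scheme"
  assumes R: "pro_p_ring p R" and d: "d + m \<le> n"
  shows "diagonal_block d m \<in> chom (unitri R n) (unitri R m)"
proof -
  interpret cring R using pro_p_ringD(1)[OF R] .
  have top: "topspace (gtop (unitri R n)) = unitri_carrier R n"
    using topological_groupD(2)[OF topological_group_unitri(1)[OF R]] by simp
  have cl: "diagonal_block d m A \<in> unitri_carrier R m" if "A \<in> unitri_carrier R n" for A
    using unitri_carrierD[OF that] d
    by (intro unitri_carrierI diagonal_block_extensional) (auto simp: diagonal_block_apply)
  have "diagonal_block d m \<in> hom (unitri R n) (unitri R m)"
  proof (rule homI)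
    fix A B assume "A \<in> carrier (unitri R n)" "B \<in> carrier (unitri R n)"
    then have A: "A \<in> unitri_carrier R n" and B: "B \<in> unitri_carrier R n" by auto
    note Ad = unitri_carrierD[OF A] and Bd = unitri_carrierD[OF B]
    show "diagonal_block d m (A \<otimes>\<^bsub>unitri R n\<^esub> B) = diagonal_block d m A \<otimes>\<^bsub>unitri R m\<^esub> diagonal_block d m B"
    proof (rule mat_eqI[OF diagonal_block_extensional unitri_mult_extensional])
      fix i j assume ij: "i \<in> {1..m+1}" "j \<in> {1..m+1}"
      have ij': "i + d \<in> {1..n+1}" "j + d \<in> {1..n+1}" using ij d by auto
      let ?f = "\<lambda>k. A (i + d, k) \<otimes>\<^bsub>R\<^esub> B (k, j + d)"
      have f: "?f \<in> {1..n+1} \<rightarrow> carrier R" using ij' Ad(2) Bd(2) by auto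
      have im: "(\<lambda>k. k + d) ` {1..m+1} = {1+d..m+1+d}" by (simp only: image_add_atLeastAtMost')
      \<comment> \<open>Left of the block the row of \<open>A\<close> vanishes, below it the column of \<open>B\<close> does.\<close>
      have "(\<Oplus>\<^bsub>R\<^esub>k\<in>{1..n+1}. ?f k) = (\<Oplus>\<^bsub>R\<^esub>k\<in>{1+d..m+1+d}. ?f k)"
      proof (rule add.finprod_mono_neutral_cong_right)
        show "?f k = \<zero>\<^bsub>R\<^esub>" if k: "k \<in> {1..n+1} - {1+d..m+1+d}" for k
        proof (cases "k < 1 + d")
          case True
          then show ?thesis using k ij ij' Ad(4)[of "i + d" k] Bd(2)[of k "j + d"] by simp
        next
          case False
          then show ?thesis using k ij ij' Bd(4)[of k "j + d"] Ad(2)[of "i + d" k] by simp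
        qed
      qed (use f d in auto)
      also have "\<dots> = (\<Oplus>\<^bsub>R\<^esub>k\<in>{1..m+1}. ?f (k + d))"
        unfolding im[symmetric] by (rule finsum_reindex) (use f d in \<open>auto simp: inj_on_def Pi_iff\<close>)
      also have "\<dots> = (\<Oplus>\<^bsub>R\<^esub>k\<in>{1..m+1}. diagonal_block d m A (i, k) \<otimes>\<^bsub>R\<^esub> diagonal_block d m B (k, j))"
        using f d ij Ad(2) Bd(2) by (intro finsum_cong') (auto simp: diagonal_block_apply)
      finally show "diagonal_block d m (A \<otimes>\<^bsub>unitri R n\<^esub> B) (i, j) = (diagonal_block d m A \<otimes>\<^bsub>unitri R m\<^esub> diagonal_block d m B) (i, j)"
        unfolding unitri_mult_apply[OF ij] diagonal_block_apply[OF ij] unitri_mult_apply[OF ij'] .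
    qed
  qed (use cl in simp)
  moreover have "continuous_map (gtop (unitri R n)) (gtop (unitri R m)) (diagonal_block d m)"
  proof (rule continuous_map_into_unitri)
    fix i j assume "i \<in> {1..m+1}" "j \<in> {1..m+1}"
    then show "continuous_map (gtop (unitri R n)) (rtop R) (\<lambda>A. diagonal_block d m A (i, j))"
      using continuous_map_unitri_component[of "i + d" n "j + d" R] d by (simp add: diagonal_block_apply)
  qed (use cl top in simp)
  ultimately show ?thesis by (simp add: chom_def)
qed

lemma proj_chom:
  assumes "pro_p_ring p R" "m \<le> n"
  shows "proj_ul n m \<in> chom (unitri R n) (unitri R m)" "proj_lr n m \<in> chom (unitri R n) (unitri R m)"
  using diagonal_block_chom[OF assms(1), of 0 m n] diagonal_block_chom[OF assms(1), of "n - m" m n] assms(2)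
  by (simp_all add: proj_ul_eq_diagonal_block proj_lr_eq_diagonal_block)

text \<open>The block misses the position \<open>(l, l + 1)\<close>.\<close>

lemma diagonal_block_unitri_elem_outside:
  assumes "l \<le> d \<or> m + d < l"
  shows "diagonal_block d m (unitri_elem R n l a) = diagonal_block d m \<one>\<^bsub>unitri R n\<^esub>"
  by (rule mat_eqI[OF diagonal_block_extensional diagonal_block_extensional])
    (use assms in \<open>auto simp: diagonal_block_apply unitri_elem_def\<close>)

lemma proj_lr_proj_ul:
  assumes "m1 \<le> n" "m2 \<le> n" "n \<le> m1 + m2"
  shows "proj_lr m1 (m1 + m2 - n) (proj_ul n m1 A) = proj_ul m2 (m1 + m2 - n) (proj_lr n m2 A)"
proof -
  have "m1 - (m1 + m2 - n) = n - m2" using assms by simp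
  then show ?thesis
    using assms by (simp add: proj_lr_eq_diagonal_block proj_ul_eq_diagonal_block diagonal_block_diagonal_block)
qed

definition glue_blocks ::
    "('r, 'b) ring_scheme \<Rightarrow> nat \<Rightarrow> nat \<Rightarrow> nat \<Rightarrow> (nat \<times> nat \<Rightarrow> 'r) \<Rightarrow> (nat \<times> nat \<Rightarrow> 'r) \<Rightarrow> (nat \<times> nat \<Rightarrow> 'r)" where
  "glue_blocks R n m1 m2 A B = (\<lambda>(i, j)\<in>mat_idx n.
     if i \<le> m1 + 1 \<and> j \<le> m1 + 1 then A (i, j)
     else if n - m2 < i \<and> n - m2 < j then B (i - (n - m2), j - (n - m2)) else \<zero>\<^bsub>R\<^esub>)"

text \<open>The two blocks overlap in a block of size \<open>m1 + m2 - n + 1\<close> and together cover the diagonal, which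
is why the glued matrix is unitriangular and the compatible overlap makes both projections
correct.\<close>

lemma unitri_glue_blocks:
  assumes R: "cring R" and m: "m1 \<le> n" "m2 \<le> n" "n \<le> m1 + m2"
    and A: "A \<in> unitri_carrier R m1" and B: "B \<in> unitri_carrier R m2"
    and compat: "proj_lr m1 (m1 + m2 - n) A = proj_ul m2 (m1 + m2 - n) B"
  shows "glue_blocks R n m1 m2 A B \<in> unitri_carrier R n"
    "proj_ul n m1 (glue_blocks R n m1 m2 A B) = A" "proj_lr n m2 (glue_blocks R n m1 m2 A B) = B"
proof -
  interpret cring R by fact
  note Ad = unitri_carrierD[OF A] and Bd = unitri_carrierD[OF B]
  let ?d = "n - m2" and ?C = "glue_blocks R n m1 m2 A B"
  have C: "?C (i, j) = (if i \<le> m1 + 1 \<and> j \<le> m1 + 1 then A (i, j)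
     else if ?d < i \<and> ?d < j then B (i - ?d, j - ?d) else \<zero>\<^bsub>R\<^esub>)" if "i \<in> {1..n+1}" "j \<in> {1..n+1}" for i j
    using that by (simp add: glue_blocks_def)
  show "?C \<in> unitri_carrier R n"
  proof (rule unitri_carrierI)
    show "?C \<in> extensional (mat_idx n)" by (simp add: glue_blocks_def)
    fix i j assume ij: "i \<in> {1..n+1}" "j \<in> {1..n+1}"
    show "?C (i, j) \<in> carrier R" unfolding C[OF ij] using ij m by (auto intro!: Ad(2) Bd(2))
    show "?C (i, j) = \<zero>\<^bsub>R\<^esub>" if "j < i"
      unfolding C[OF ij] using that ij m by (auto intro!: Ad(4) Bd(4))
  next
    fix i assume i: "i \<in> {1..n+1}"
    show "?C (i, i) = \<one>\<^bsub>R\<^esub>"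
    proof (cases "i \<le> m1 + 1")
      case True
      then show ?thesis using i Ad(3)[of i] by (simp add: C)
    next
      case False
      then have "i - ?d \<in> {1..m2+1}" "?d < i" using i m by auto
      then show ?thesis using False Bd(3)[of "i - ?d"] by (simp only: C[OF i i]) simp
    qed
  qed
  show "proj_ul n m1 ?C = A"
    unfolding proj_ul_eq_diagonal_block
    by (rule mat_eqI[OF diagonal_block_extensional Ad(1)])
      (use m in \<open>simp add: diagonal_block_apply C\<close>)
  show "proj_lr n m2 ?C = B"
    unfolding proj_lr_eq_diagonal_block
  proof (rule mat_eqI[OF diagonal_block_extensional Bd(1)])
    fix i j assume ij: "i \<in> {1..m2+1}" "j \<in> {1..m2+1}"
    have ij': "i + ?d \<in> {1..n+1}" "j + ?d \<in> {1..n+1}" using ij m by auto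
    have "A (i + ?d, j + ?d) = B (i, j)" if "i + ?d \<le> m1 + 1" "j + ?d \<le> m1 + 1"
    proof -
      have "m1 - (m1 + m2 - n) = ?d" using m by simp
      moreover have "i \<in> {1..m1+m2-n+1}" "j \<in> {1..m1+m2-n+1}" using ij that m by auto
      ultimately show ?thesis
        using fun_cong[OF compat, of "(i, j)"] by (simp add: proj_lr_def proj_ul_def)
    qed
    then show "diagonal_block ?d m2 ?C (i, j) = B (i, j)"
      unfolding diagonal_block_apply[OF ij] C[OF ij'] using ij by auto
  qed
qed

text \<open>The identification of \<open>U\<^sub>n / V\<close> with the fibre product: the pair of projections is a continuous
surjection (by gluing) with kernel \<open>V\<close>. Being a Hausdorff image of a pro-\<open>p\<close> group, the fibre product is
pro-\<open>p\<close>.\<close>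

lemma unitri_fiber:
  fixes R :: "('r, 'b) tring_scheme"
  assumes p: "Factorial_Ring.prime p" and R: "pro_p_ring p R"
    and m: "m1 \<le> n" "m2 \<le> n" "n \<le> m1 + m2"
  defines "\<theta> \<equiv> \<lambda>A. (proj_ul n m1 A, proj_lr n m2 A)" and "F \<equiv> unitri_fiber R m1 m2 (m1 + m2 - n)"
  shows "pro_p_group p F" "\<theta> \<in> chom (unitri R n) F" "\<theta> ` carrier (unitri R n) = carrier F"
    "kernel (unitri R n) F \<theta> = unitri_V R n m1 m2" "closed_normal (unitri_V R n m1 m2) (unitri R n)"
proof -
  let ?t = "m1 + m2 - n" and ?U = "\<lambda>n. unitri R n"
  note Rd = pro_p_ringD[OF R]
  have U: "pro_p_group p (?U n)" for n by (rule pro_p_group_unitri[OF p R])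
  note Ud = pro_p_groupD[OF U]
  have t: "?t \<le> m1" "?t \<le> m2" using m by auto
  have F: "F = fiber_product (?U m1) (?U m2) (proj_lr m1 ?t) (proj_ul m2 ?t)"
    by (simp add: F_def unitri_fiber_def)
  have gF: "group F"
    unfolding F using proj_chom[OF R] t
    by (intro group_fiber_product[where K = "?U ?t"] chom_group_hom Ud) auto
  have topF: "topspace (gtop F) = carrier F"
    unfolding F fiber_product_simps topspace_subtopology topspace_prod_topology Ud(2) by auto
  have HF: "Hausdorff_space (gtop F)"
    unfolding F fiber_product_simps using Ud(4)
    by (intro Hausdorff_space_subtopology) (simp add: Hausdorff_space_prod_topology)
  show \<theta>: "\<theta> \<in> chom (?U n) F"
    unfolding \<theta>_def F using proj_chom[OF R] m proj_lr_proj_ul[OF m]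
    by (intro chom_fiber_product Ud(2)) auto
  show surj: "\<theta> ` carrier (?U n) = carrier F"
  proof
    show "carrier F \<subseteq> \<theta> ` carrier (?U n)"
    proof
      fix z assume "z \<in> carrier F"
      then obtain A B where z: "z = (A, B)" and AB: "A \<in> unitri_carrier R m1" "B \<in> unitri_carrier R m2"
        "proj_lr m1 ?t A = proj_ul m2 ?t B"
        by (auto simp: F fiber_product_simps)
      note g = unitri_glue_blocks[OF Rd(1) m AB]
      show "z \<in> \<theta> ` carrier (?U n)"
        by (rule image_eqI[of _ _ "glue_blocks R n m1 m2 A B"]) (use g in \<open>simp_all add: z \<theta>_def\<close>)
    qed
  qed (use chom_carrier[OF \<theta>] in blast)
  show "pro_p_group p F"
    by (rule pro_p_group_image[OF p U gF topF HF \<theta> surj])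
  show ker: "kernel (?U n) F \<theta> = unitri_V R n m1 m2"
    by (auto simp: kernel_def unitri_V_def \<theta>_def F fiber_product_simps simp del: unitri_simps(2))
  show "closed_normal (unitri_V R n m1 m2) (?U n)"
    unfolding ker[symmetric] by (rule closed_normal_kernel[OF Ud(5) gF topF HF \<theta>])
qed

text \<open>The pair of projections is constant on cosets of its kernel \<open>V\<close>, so the singleton of which
\<open>unitri_ident\<close> takes the element really is one.\<close>

lemma unitri_ident_coset:
  fixes R :: "('r, 'b) tring_scheme"
  assumes p: "Factorial_Ring.prime p" and R: "pro_p_ring p R"
    and m: "m1 \<le> n" "m2 \<le> n" "n \<le> m1 + m2" and A: "A \<in> carrier (unitri R n)"
  shows "unitri_ident n m1 m2 (unitri_V R n m1 m2 #>\<^bsub>unitri R n\<^esub> A) = (proj_ul n m1 A, proj_lr n m2 A)"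
proof -
  let ?V = "unitri_V R n m1 m2" and ?U = "unitri R n" and ?F = "unitri_fiber R m1 m2 (m1 + m2 - n)"
  let ?\<theta> = "\<lambda>A. (proj_ul n m1 A, proj_lr n m2 A)"
  note f = unitri_fiber[OF p R m]
  have gU: "group ?U" by (rule group_unitri[OF pro_p_ringD(1)[OF R]])
  interpret \<theta>: group_hom ?U ?F ?\<theta>
    using f(2) gU pro_p_groupD(1)[OF f(1)] by (rule chom_group_hom)
  have V: "subgroup ?V ?U" using f(5) by (simp add: closed_normal_def normal_imp_subgroup)
  have im: "?\<theta> X = ?\<theta> A" if X: "X \<in> ?V #>\<^bsub>?U\<^esub> A" for X
  proof -
    obtain v where v: "v \<in> ?V" "X = v \<otimes>\<^bsub>?U\<^esub> A" using X unfolding r_coset_def by blast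
    have "?\<theta> v = \<one>\<^bsub>?F\<^esub>" using v(1) unfolding f(4)[symmetric] kernel_def by blast
    moreover have "?\<theta> X = ?\<theta> v \<otimes>\<^bsub>?F\<^esub> ?\<theta> A"
      unfolding v(2) using subgroup.mem_carrier[OF V v(1)] A by (rule \<theta>.hom_mult)
    moreover have "?\<theta> A \<in> carrier ?F" using A by (rule \<theta>.hom_closed)
    ultimately show ?thesis using \<theta>.H.l_one by presburger
  qed
  have "A \<in> ?V #>\<^bsub>?U\<^esub> A" by (rule \<theta>.G.rcos_self[OF A V])
  then have "?\<theta> ` (?V #>\<^bsub>?U\<^esub> A) = {?\<theta> A}" using im by blast
  then show ?thesis by (simp add: unitri_ident_def)
qed

section \<open>The quotients of a group with a family of subgroups\<close>

context
  fixes p :: nat and G :: "('g, 'b) tgroup_scheme" and T :: "'j \<Rightarrow> 'g set" and J :: "'j set"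
  assumes p: "Factorial_Ring.prime p" and G: "pro_p_group p G"
    and T: "\<And>j. j \<in> J \<Longrightarrow> T j \<subseteq> carrier G"
begin

lemma closed_normal_N_sub: "closed_normal (N_sub G T J X) G"
  unfolding N_sub_def using T by (intro closed_normal_generate pro_p_groupD(5)[OF G]) auto

lemma N_sub_antimono:
  assumes "X \<subseteq> Y"
  shows "N_sub G T J Y \<subseteq> N_sub G T J X"
proof -
  have "(\<Union>j\<in>J - Y. T j) \<subseteq> (\<Union>j\<in>J - X. T j)" using assms by auto
  also have "\<dots> \<subseteq> N_sub G T J X" unfolding N_sub_def by (rule closed_normal_generate_superset)
  finally show ?thesis
    using closed_normal_N_sub unfolding N_sub_def[of G T J Y] by (intro closed_normal_generate_subset)
qed

lemma pro_p_group_G_quot: "pro_p_group p (G_quot G T J X)"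
  unfolding G_quot_def by (rule pro_p_group_quot[OF p G closed_normal_N_sub])

lemma res_chom: "res G T J X \<in> chom G (G_quot G T J X)"
  and res_surj: "res G T J X ` carrier G = carrier (G_quot G T J X)"
  using coset_chom_quot[OF pro_p_groupD(5)[OF G], of "N_sub G T J X"] closed_normal_N_sub[of X]
  by (simp_all add: res_def[abs_def] G_quot_def closed_normal_def)

lemma res_trivial:
  assumes "j \<in> J - X" "\<tau> \<in> T j"
  shows "res G T J X \<tau> = \<one>\<^bsub>G_quot G T J X\<^esub>"
proof -
  have "\<tau> \<in> N_sub G T J X"
    unfolding N_sub_def by (rule subsetD[OF closed_normal_generate_superset]) (use assms in blast)
  moreover have "N_sub G T J X \<lhd> G" using closed_normal_N_sub by (simp add: closed_normal_def)
  ultimately have "N_sub G T J X #>\<^bsub>G\<^esub> \<tau> = N_sub G T J X"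
    using rcoset_eq_self_iff[of "N_sub G T J X" G \<tau>] T assms by blast
  then show ?thesis by (simp add: res_def G_quot_def FactGroup_def)
qed

lemma restriction_res:
  assumes "X \<subseteq> Y" "x \<in> carrier G"
  shows "restriction G T J X (res G T J Y x) = res G T J X x"
proof -
  let ?N = "N_sub G T J X" and ?M = "N_sub G T J Y"
  have N: "subgroup ?N G" and M: "subgroup ?M G"
    using closed_normal_N_sub by (simp_all add: closed_normal_def normal_imp_subgroup)
  interpret group G using pro_p_groupD(1)[OF G] .
  have MN: "?M \<subseteq> ?N" by (rule N_sub_antimono[OF assms(1)])
  have "?N <#>\<^bsub>G\<^esub> (?M #>\<^bsub>G\<^esub> x) = ?N #>\<^bsub>G\<^esub> x"
  proof (intro Set.set_eqI iffI)
    fix y assume "y \<in> ?N <#>\<^bsub>G\<^esub> (?M #>\<^bsub>G\<^esub> x)"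
    then obtain a b where ab: "a \<in> ?N" "b \<in> ?M" "y = a \<otimes>\<^bsub>G\<^esub> (b \<otimes>\<^bsub>G\<^esub> x)"
      by (auto simp: set_mult_def r_coset_def)
    then have "y = (a \<otimes>\<^bsub>G\<^esub> b) \<otimes>\<^bsub>G\<^esub> x"
      using subgroup.mem_carrier[OF N] MN assms(2) by (simp add: m_assoc subset_iff)
    moreover have "a \<otimes>\<^bsub>G\<^esub> b \<in> ?N" using ab MN subgroup.m_closed[OF N] by blast
    ultimately show "y \<in> ?N #>\<^bsub>G\<^esub> x" by (auto simp: r_coset_def)
  next
    fix y assume "y \<in> ?N #>\<^bsub>G\<^esub> x"
    then obtain a where "a \<in> ?N" "y = a \<otimes>\<^bsub>G\<^esub> x" by (auto simp: r_coset_def)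
    then show "y \<in> ?N <#>\<^bsub>G\<^esub> (?M #>\<^bsub>G\<^esub> x)"
      using rcos_self[OF assms(2) M] unfolding set_mult_def by blast
  qed
  then show ?thesis by (simp add: restriction_def res_def)
qed

text \<open>Shrinking the index set enlarges the subgroup that is divided out, so the projection to the
smaller quotient factors through the larger one.\<close>

lemma restriction_chom:
  assumes "X \<subseteq> Y"
  shows "restriction G T J X \<in> chom (G_quot G T J Y) (G_quot G T J X)"
proof -
  note Yd = pro_p_groupD[OF pro_p_group_G_quot[of Y]] and Xd = pro_p_groupD[OF pro_p_group_G_quot[of X]]
  have "kernel G (G_quot G T J Z) (res G T J Z) = N_sub G T J Z" for Z
  proof -
    have n: "N_sub G T J Z \<lhd> G" using closed_normal_N_sub by (simp add: closed_normal_def)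
    show ?thesis
      using rcoset_eq_self_iff[OF n] subgroup.subset[OF normal_imp_subgroup[OF n]]
      by (auto simp: kernel_def res_def G_quot_def FactGroup_def)
  qed
  then have "kernel G (G_quot G T J Y) (res G T J Y) \<subseteq> kernel G (G_quot G T J X) (res G T J X)"
    using N_sub_antimono[OF assms] by simp
  then obtain h where h: "h \<in> chom (G_quot G T J Y) (G_quot G T J X)"
      "\<And>x. x \<in> carrier G \<Longrightarrow> h (res G T J Y x) = res G T J X x"
    by (rule chom_factor[OF G pro_p_group_G_quot Xd(5) res_chom res_surj res_chom]) blast
  show ?thesis
  proof (rule chom_cong[OF h(1) Yd(1,2)])
    fix C assume "C \<in> carrier (G_quot G T J Y)"
    then obtain x where "x \<in> carrier G" "C = res G T J Y x" unfolding res_surj[symmetric] by blast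
    then show "restriction G T J X C = h C" using h(2) restriction_res[OF assms] by simp
  qed
qed

lemma pro_p_linking_structure_quot_linking:
  assumes U: "pro_p_group p U" and I: "I \<subseteq> J"
    and Z: "\<And>i. i \<in> I \<Longrightarrow> closed_subgroup (Z i) G" and Tc: "\<And>i. i \<in> I \<Longrightarrow> closed_subgroup (T i) G"
    and TZ: "\<And>i. i \<in> I \<Longrightarrow> T i \<lhd> sub_tgroup G (Z i)"
    and s: "\<And>i. i \<in> I \<Longrightarrow> hom_section (sub_tgroup G (Z i)) (T i) (s i)"
    and gen: "closed_generate (G_quot G T J X) (\<Union>i\<in>I. res G T J X ` T i) = carrier (G_quot G T J X)"
    and \<pi>: "\<And>i. i \<in> I \<Longrightarrow> \<pi> i \<in> chom (sub_tgroup G (T i)) U"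
  shows "pro_p_linking_structure p (quot_linking G Z T s J X I U \<pi>)"
proof -
  have sub: "T i \<subseteq> Z i" if "i \<in> I" for i
    using subgroup.subset[OF normal_imp_subgroup[OF TZ[OF that]]] by simp
  have "closed_normal (T i) (sub_tgroup G (Z i))" if "i \<in> I" for i
    using TZ[OF that] Tc[OF that] sub[OF that]
    by (auto simp: closed_normal_def closed_subgroup_def intro: closedin_subset_topspace)
  moreover have "res G T J X \<in> chom (sub_tgroup G (Z i)) (G_quot G T J X)" if "i \<in> I" for i
    using Z[OF that] by (intro chom_sub[OF res_chom] subgroup.subset) (simp add: closed_subgroup_def)
  moreover have "pro_p_group p (sub_tgroup G (Z i))" if "i \<in> I" for i
    by (rule pro_p_group_sub[OF p G Z[OF that]])
  moreover have "\<pi> i \<in> chom (sub_tgroup (sub_tgroup G (Z i)) (T i)) U" if "i \<in> I" for i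
    using \<pi>[OF that] sub_sub_tgroup[OF sub[OF that], of G] by simp
  ultimately show ?thesis
    using pro_p_group_G_quot U s gen
    by (simp add: pro_p_linking_structure_def quot_linking_def)
qed

end

section \<open>The two globalizations glue\<close>

theorem theorem4p3:
  fixes p n N m1 m2 t :: nat
    and R :: "'r tring" and G :: "'g tgroup"
    and J I Ih I1 I2 :: "'j set"
    and Z T :: "'j \<Rightarrow> 'g set" and s :: "'j \<Rightarrow> 'g set \<Rightarrow> 'g"
    and pibar :: "'j \<Rightarrow> 'g \<Rightarrow> 'r" and e :: "nat \<Rightarrow> 'j"
    and V :: "(nat \<times> nat \<Rightarrow> 'r) set"
    and \<rho>1 \<rho>2 :: "'g set \<Rightarrow> (nat \<times> nat \<Rightarrow> 'r)"
    and \<pi> :: "'j \<Rightarrow> 'g \<Rightarrow> (nat \<times> nat \<Rightarrow> 'r)"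
    and L L1 L2 :: "('j, 'g set, nat \<times> nat \<Rightarrow> 'r, 'g) linking"
    and Zbar :: "'j \<Rightarrow> 'g set"
  defines "\<pi> \<equiv> elementary_pi R n e pibar"
    and "I \<equiv> e ` {1..n}"
    and "Ih \<equiv> e ` {1..N}"
    and "I1 \<equiv> e ` ({1..m1} \<union> {n+1..N})"
    and "I2 \<equiv> e ` ({n-m2+1..n} \<union> {n+1..N})"
    and "t \<equiv> m1 + m2 - n"
    and "V \<equiv> unitri_V R n m1 m2"
    and "L \<equiv> quot_linking G Z T s J Ih I (unitri R n) \<pi>"
    and "L1 \<equiv> quot_linking G Z T s J I1 (I1 \<inter> I) (unitri R m1) (\<lambda>i. proj_ul n m1 \<circ> \<pi> i)"
    and "L2 \<equiv> quot_linking G Z T s J I2 (I2 \<inter> I) (unitri R m2) (\<lambda>i. proj_lr n m2 \<circ> \<pi> i)"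
    and "Zbar \<equiv> \<lambda>i. section_image (sub_tgroup G (Z i)) (T i) (s i)"
  assumes "Factorial_Ring.prime p"
    and "pro_p_ring p R"
    and "pro_p_group p G"
    and "\<And>j. j \<in> J \<Longrightarrow> closed_subgroup (Z j) G"
    and "\<And>j. j \<in> J \<Longrightarrow> closed_subgroup (T j) G"
    and "\<And>j. j \<in> J \<Longrightarrow> T j \<lhd> sub_tgroup G (Z j)"
    and "\<And>j. j \<in> J \<Longrightarrow> pibar j \<in> chom (sub_tgroup G (T j)) (additive_tgroup R)"
    and "\<And>j. j \<in> J \<Longrightarrow> pibar j ` T j = carrier R"
    and "2 \<le> n" and "n \<le> N"
    and "inj_on e {1..N}"
    and "e ` {1..N} \<subseteq> J"
    and "\<And>i. i \<in> I \<Longrightarrow> hom_section (sub_tgroup G (Z i)) (T i) (s i)"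
    and assumption_A: "closed_generate (G_quot G T J Ih) (\<Union>i\<in>I. res G T J Ih ` T i) = carrier (G_quot G T J Ih)"
    and "1 \<le> m1" and "m1 \<le> n" and "1 \<le> m2" and "m2 \<le> n" and "n \<le> m1 + m2"
    and "globalization p L1 \<rho>1"
    and "globalization p L2 \<rho>2"
  shows
    "(\<exists>\<rho>'. \<rho>' \<in> chom (G_quot G T J Ih) (unitri_fiber R m1 m2 t) \<and>
        (\<exists>\<sigma>. globalization p (linking_quot L V) \<sigma> \<and>
             (\<forall>x\<in>carrier (G_quot G T J Ih). \<rho>' x = unitri_ident n m1 m2 (\<sigma> x))) \<and>
        (\<forall>x\<in>carrier (G_quot G T J Ih).
           fst (\<rho>' x) = \<rho>1 (restriction G T J I1 x) \<and>
           snd (\<rho>' x) = \<rho>2 (restriction G T J I2 x))) \<and>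
     (V_link_type p L V \<and>
      (\<forall>i\<in>I. \<forall>z\<in>Zbar i. \<rho>1 (res G T J I1 z) = \<one>\<^bsub>unitri R m1\<^esub>) \<and>
      (\<forall>i\<in>I. \<forall>z\<in>Zbar i. \<rho>2 (res G T J I2 z) = \<one>\<^bsub>unitri R m2\<^esub>) \<longrightarrow>
      (\<exists>\<rho>. globalization p L \<rho> \<and> \<rho> ` carrier (G_quot G T J Ih) = carrier (unitri R n) \<and>
         (\<forall>x\<in>carrier (G_quot G T J Ih).
            proj_ul n m1 (\<rho> x) = \<rho>1 (restriction G T J I1 x) \<and>
            proj_lr n m2 (\<rho> x) = \<rho>2 (restriction G T J I2 x)) \<and>
         (\<forall>i\<in>I. \<rho> ` res G T J Ih ` Zbar i \<subseteq> V)))"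
proof -
  note p = \<open>Factorial_Ring.prime p\<close> and R = \<open>pro_p_ring p R\<close> and G = \<open>pro_p_group p G\<close>
    and Zc = \<open>\<And>j. j \<in> J \<Longrightarrow> closed_subgroup (Z j) G\<close>
    and Tcl = \<open>\<And>j. j \<in> J \<Longrightarrow> closed_subgroup (T j) G\<close>
    and TZ = \<open>\<And>j. j \<in> J \<Longrightarrow> T j \<lhd> sub_tgroup G (Z j)\<close>
    and pibar = \<open>\<And>j. j \<in> J \<Longrightarrow> pibar j \<in> chom (sub_tgroup G (T j)) (additive_tgroup R)\<close>
    and pibar_surj = \<open>\<And>j. j \<in> J \<Longrightarrow> pibar j ` T j = carrier R\<close>
    and sec = \<open>\<And>i. i \<in> I \<Longrightarrow> hom_section (sub_tgroup G (Z i)) (T i) (s i)\<close>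
    and m = \<open>m1 \<le> n\<close> \<open>m2 \<le> n\<close> \<open>n \<le> m1 + m2\<close>
    and gl1 = \<open>globalization p L1 \<rho>1\<close> and gl2 = \<open>globalization p L2 \<rho>2\<close>
  let ?Gh = "G_quot G T J Ih" and ?U = "unitri R n" and ?F = "unitri_fiber R m1 m2 t"
  let ?res = "res G T J Ih"
  let ?\<theta> = "\<lambda>A. (proj_ul n m1 A, proj_lr n m2 A)"
  have Tsub: "T j \<subseteq> carrier G" and Zsub: "Z j \<subseteq> carrier G" if "j \<in> J" for j
    using Tcl[OF that] Zc[OF that] by (auto simp: closed_subgroup_def dest: subgroup.subset)
  have IJ: "I \<subseteq> J" using \<open>e ` {1..N} \<subseteq> J\<close> \<open>n \<le> N\<close> by (auto simp: I_def)
  have I1h: "I1 \<subseteq> Ih" and I2h: "I2 \<subseteq> Ih"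
    using m \<open>n \<le> N\<close> by (auto simp: I1_def I2_def Ih_def)
  note lem = p G Tsub
  note resc = res_chom[OF lem] and ress = res_surj[OF lem]
  note U = pro_p_group_unitri[OF p R] and fib = unitri_fiber[OF p R m, folded t_def V_def]
  note Ud = pro_p_groupD[OF U]
  note Gh = pro_p_group_G_quot[OF lem, where X = Ih]
  note Ghd = pro_p_groupD[OF Gh]
  have nV: "V \<lhd> ?U" using fib(5) by (simp add: closed_normal_def)
  have \<pi>_e: "\<pi> (e l) = (\<lambda>\<tau>. unitri_elem R n l (pibar (e l) \<tau>))" if l: "l \<in> {1..n}" for l
  proof -
    have "inj_on e {1..n}"
      by (rule inj_on_subset[OF \<open>inj_on e {1..N}\<close>]) (use \<open>n \<le> N\<close> in auto)
    then have "the_inv_into {1..n} e (e l) = l" using l by (rule the_inv_into_f_f)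
    moreover have "e l \<in> e ` {1..n}" using l by (rule imageI)
    ultimately show ?thesis by (intro ext) (simp only: \<pi>_def elementary_pi_def if_True)
  qed
  have \<pi>: "\<pi> i \<in> chom (sub_tgroup G (T i)) ?U" if i: "i \<in> I" for i
  proof -
    obtain l where l: "l \<in> {1..n}" "i = e l" using i by (auto simp: I_def)
    show ?thesis
      unfolding l(2) \<pi>_e[OF l(1)] using pibar[of i] i IJ l
      by (intro chom_compose[OF _ unitri_elem_chom[OF R l(1)]]) auto
  qed
  have \<pi>c: "\<pi> i \<tau> \<in> carrier ?U" if "i \<in> I" "\<tau> \<in> T i" for i \<tau>
    using chom_carrier[OF \<pi>[OF that(1)], of \<tau>] that(2) by simp
  define r1 where "r1 x = \<rho>1 (restriction G T J I1 x)" for x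
  define r2 where "r2 x = \<rho>2 (restriction G T J I2 x)" for x
  have \<rho>1: "\<rho>1 \<in> chom (G_quot G T J I1) (unitri R m1)"
      "\<And>i \<tau>. i \<in> I1 \<inter> I \<Longrightarrow> \<tau> \<in> T i \<Longrightarrow> \<rho>1 (res G T J I1 \<tau>) = proj_ul n m1 (\<pi> i \<tau>)"
    using gl1 by (auto simp: globalization_def L1_def quot_linking_def)
  have \<rho>2: "\<rho>2 \<in> chom (G_quot G T J I2) (unitri R m2)"
      "\<And>i \<tau>. i \<in> I2 \<inter> I \<Longrightarrow> \<tau> \<in> T i \<Longrightarrow> \<rho>2 (res G T J I2 \<tau>) = proj_lr n m2 (\<pi> i \<tau>)"
    using gl2 by (auto simp: globalization_def L2_def quot_linking_def)
  interpret \<rho>1: group_hom "G_quot G T J I1" "unitri R m1" \<rho>1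
    using \<rho>1(1) pro_p_groupD(1)[OF pro_p_group_G_quot[OF lem]] Ud(1) by (rule chom_group_hom)
  interpret \<rho>2: group_hom "G_quot G T J I2" "unitri R m2" \<rho>2
    using \<rho>2(1) pro_p_groupD(1)[OF pro_p_group_G_quot[OF lem]] Ud(1) by (rule chom_group_hom)
  interpret ul: group_hom ?U "unitri R m1" "proj_ul n m1"
    using proj_chom(1)[OF R m(1)] Ud(1) Ud(1) by (rule chom_group_hom)
  interpret lr: group_hom ?U "unitri R m2" "proj_lr n m2"
    using proj_chom(2)[OF R m(2)] Ud(1) Ud(1) by (rule chom_group_hom)
  have r1_res: "r1 (?res x) = \<rho>1 (res G T J I1 x)" and r2_res: "r2 (?res x) = \<rho>2 (res G T J I2 x)"
    if "x \<in> carrier G" for x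
    using that restriction_res[OF lem I1h] restriction_res[OF lem I2h] by (simp_all add: r1_def r2_def)
  have r1: "r1 \<in> chom ?Gh (unitri R m1)"
    unfolding r1_def by (rule chom_compose[OF restriction_chom[OF lem I1h] \<rho>1(1)])
  have r2: "r2 \<in> chom ?Gh (unitri R m2)"
    unfolding r2_def by (rule chom_compose[OF restriction_chom[OF lem I2h] \<rho>2(1)])
  have r_T: "r1 (?res \<tau>) = proj_ul n m1 (\<pi> i \<tau>)" "r2 (?res \<tau>) = proj_lr n m2 (\<pi> i \<tau>)"
    if i: "i \<in> I" and \<tau>: "\<tau> \<in> T i" for i \<tau>
  proof -
    obtain l where l: "l \<in> {1..n}" "i = e l" using i by (auto simp: I_def)
    have c: "\<tau> \<in> carrier G" and iJ: "i \<in> J" using Tsub i IJ \<tau> by blast+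
    show "r1 (?res \<tau>) = proj_ul n m1 (\<pi> i \<tau>)"
    proof (cases "i \<in> I1")
      case True
      then show ?thesis using r1_res[OF c] \<rho>1(2) i \<tau> by simp
    next
      case False
      then have "0 + m1 < l" using l by (auto simp: I1_def)
      then have "proj_ul n m1 (\<pi> i \<tau>) = proj_ul n m1 \<one>\<^bsub>?U\<^esub>"
        unfolding l(2) \<pi>_e[OF l(1)] proj_ul_eq_diagonal_block
        by (intro diagonal_block_unitri_elem_outside) auto
      moreover have "r1 (?res \<tau>) = \<one>\<^bsub>unitri R m1\<^esub>"
        unfolding r1_res[OF c] using res_trivial[OF lem, where j = i and X = I1 and \<tau> = \<tau>] False iJ \<tau> \<rho>1.hom_one by simp
      ultimately show ?thesis using ul.hom_one by simp
    qed
    show "r2 (?res \<tau>) = proj_lr n m2 (\<pi> i \<tau>)"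
    proof (cases "i \<in> I2")
      case True
      then show ?thesis using r2_res[OF c] \<rho>2(2) i \<tau> by simp
    next
      case False
      then have "l \<le> n - m2" using l by (auto simp: I2_def)
      then have "proj_lr n m2 (\<pi> i \<tau>) = proj_lr n m2 \<one>\<^bsub>?U\<^esub>"
        unfolding l(2) \<pi>_e[OF l(1)] proj_lr_eq_diagonal_block
        by (intro diagonal_block_unitri_elem_outside) auto
      moreover have "r2 (?res \<tau>) = \<one>\<^bsub>unitri R m2\<^esub>"
        unfolding r2_res[OF c] using res_trivial[OF lem, where j = i and X = I2 and \<tau> = \<tau>] False iJ \<tau> \<rho>2.hom_one by simp
      ultimately show ?thesis using lr.hom_one by simp
    qed
  qed
  have res_T: "?res \<tau> \<in> carrier ?Gh" if "i \<in> I" "\<tau> \<in> T i" for i \<tau>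
    by (rule chom_carrier[OF resc subsetD[OF Tsub[OF subsetD[OF IJ that(1)]] that(2)]])
  have t: "t \<le> m1" "t \<le> m2" using m by (auto simp: t_def)
  \<comment> \<open>By assumption (A) it suffices to compare the overlap blocks on the images of the \<open>T i\<close>.\<close>
  have compat: "proj_lr m1 t (r1 x) = proj_ul m2 t (r2 x)" if "x \<in> carrier ?Gh" for x
  proof (rule chom_eq_on_closed_generate[OF Ghd(5) Ud(5,4)])
    show "(\<lambda>x. proj_lr m1 t (r1 x)) \<in> chom ?Gh (unitri R t)"
      by (rule chom_compose[OF r1 proj_chom(2)[OF R t(1)]])
    show "(\<lambda>x. proj_ul m2 t (r2 x)) \<in> chom ?Gh (unitri R t)"
      by (rule chom_compose[OF r2 proj_chom(1)[OF R t(2)]])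
    show "x \<in> closed_generate ?Gh (\<Union>i\<in>I. ?res ` T i)" using that assumption_A by simp
    show "(\<Union>i\<in>I. ?res ` T i) \<subseteq> carrier ?Gh"
      using res_T by (intro UN_least image_subsetI)
    fix y assume "y \<in> (\<Union>i\<in>I. ?res ` T i)"
    then show "proj_lr m1 t (r1 y) = proj_ul m2 t (r2 y)"
      using r_T proj_lr_proj_ul[OF m] by (auto simp: t_def)
  qed
  define \<rho>' where "\<rho>' x = (r1 x, r2 x)" for x
  have \<rho>': "\<rho>' \<in> chom ?Gh ?F"
    unfolding \<rho>'_def[abs_def] unitri_fiber_def using compat by (intro chom_fiber_product r1 r2 Ghd(2))
  have \<rho>'_T: "\<rho>' (?res \<tau>) = ?\<theta> (\<pi> i \<tau>)" if "i \<in> I" "\<tau> \<in> T i" for i \<tau>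
    using r_T[OF that] by (simp add: \<rho>'_def)
  let ?q = "\<lambda>A. V #>\<^bsub>?U\<^esub> A"
  have "kernel ?U ?F ?\<theta> \<subseteq> kernel ?U (quot_tgroup ?U V) ?q"
  proof
    fix A assume "A \<in> kernel ?U ?F ?\<theta>"
    then have "A \<in> V" "A \<in> carrier ?U" unfolding fib(4)[symmetric] by (auto simp: kernel_def)
    then show "A \<in> kernel ?U (quot_tgroup ?U V) ?q"
      using rcoset_eq_self_iff[OF nV, of A] by (simp add: kernel_def FactGroup_def)
  qed
  then obtain \<iota> where \<iota>: "\<iota> \<in> chom ?F (quot_tgroup ?U V)" "\<And>A. A \<in> carrier ?U \<Longrightarrow> \<iota> (?\<theta> A) = ?q A"
    by (rule chom_factor[OF U fib(1) pro_p_groupD(5)[OF pro_p_group_quot[OF p U fib(5)]] fib(2,3)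
        coset_chom_quot(2)[OF Ud(5) nV]]) blast
  define \<sigma> where "\<sigma> x = \<iota> (\<rho>' x)" for x
  have \<sigma>_chom: "\<sigma> \<in> chom ?Gh (quot_tgroup ?U V)"
    unfolding \<sigma>_def by (rule chom_compose[OF \<rho>' \<iota>(1)])
  have ident: "unitri_ident n m1 m2 (?q A) = ?\<theta> A" if "A \<in> carrier ?U" for A
    using unitri_ident_coset[OF p R m that] by (simp add: V_def)
  have \<rho>'_ident: "\<rho>' x = unitri_ident n m1 m2 (\<sigma> x)" if x: "x \<in> carrier ?Gh" for x
  proof -
    have "\<rho>' x \<in> ?\<theta> ` carrier ?U" unfolding fib(3) by (rule chom_carrier[OF \<rho>' x])
    then obtain A where "A \<in> carrier ?U" "\<rho>' x = ?\<theta> A" by (elim imageE) blast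
    then show ?thesis using ident \<iota>(2) by (simp add: \<sigma>_def)
  qed
  have L_link: "pro_p_linking_structure p L"
    unfolding L_def
    by (rule pro_p_linking_structure_quot_linking[OF lem U IJ _ _ _ sec assumption_A \<pi>])
      (use Zc Tcl TZ IJ in blast)+
  have L_simps: "lkG L = ?Gh" "lkU L = ?U" "lkI L = I" "lkT L = T" "lklam L = (\<lambda>i. ?res)" "lkpi L = \<pi>"
      "\<And>i. lkZbar L i = Zbar i"
    by (simp_all add: L_def quot_linking_def Zbar_def)
  have \<sigma>: "globalization p (linking_quot L V) \<sigma>"
  proof -
    have "\<sigma> (?res \<tau>) = ?q (\<pi> i \<tau>)" if "i \<in> I" "\<tau> \<in> T i" for i \<tau>
      using \<iota>(2)[OF \<pi>c[OF that]] \<rho>'_T[OF that] by (simp add: \<sigma>_def)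
    then show ?thesis
      using pro_p_linking_structure_quot[OF p L_link] fib(5) \<sigma>_chom
      by (simp add: globalization_def L_simps)
  qed
  show ?thesis
  proof (intro conjI impI)
    show "\<exists>\<rho>'. \<rho>' \<in> chom ?Gh ?F \<and>
        (\<exists>\<sigma>. globalization p (linking_quot L V) \<sigma> \<and> (\<forall>x\<in>carrier ?Gh. \<rho>' x = unitri_ident n m1 m2 (\<sigma> x))) \<and>
        (\<forall>x\<in>carrier ?Gh. fst (\<rho>' x) = \<rho>1 (restriction G T J I1 x) \<and> snd (\<rho>' x) = \<rho>2 (restriction G T J I2 x))"
    proof (intro exI[of _ \<rho>'] conjI ballI)
      show "\<exists>\<sigma>. globalization p (linking_quot L V) \<sigma> \<and> (\<forall>x\<in>carrier ?Gh. \<rho>' x = unitri_ident n m1 m2 (\<sigma> x))"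
        using \<sigma> \<rho>'_ident by blast
    qed (simp_all add: \<rho>' \<rho>'_def r1_def r2_def)
  next
    assume *: "V_link_type p L V \<and>
      (\<forall>i\<in>I. \<forall>z\<in>Zbar i. \<rho>1 (res G T J I1 z) = \<one>\<^bsub>unitri R m1\<^esub>) \<and>
      (\<forall>i\<in>I. \<forall>z\<in>Zbar i. \<rho>2 (res G T J I2 z) = \<one>\<^bsub>unitri R m2\<^esub>)"
    then have link: "V_link_type p L V" by blast
    have Zbar: "z \<in> carrier G" if "i \<in> I" "z \<in> Zbar i" for i z
      using section_image_subset[OF sec[OF that(1)]] that Zsub IJ by (auto simp: Zbar_def)
    have \<sigma>_Zbar: "\<sigma> (?res z) = V" if "i \<in> I" "z \<in> Zbar i" for i z
    proof -
      have "\<rho>' (?res z) = (\<one>\<^bsub>unitri R m1\<^esub>, \<one>\<^bsub>unitri R m2\<^esub>)"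
        using * that r1_res r2_res Zbar[OF that] by (simp add: \<rho>'_def del: unitri_simps)
      also have "\<dots> = ?\<theta> \<one>\<^bsub>?U\<^esub>" using ul.hom_one lr.hom_one by simp
      finally have "\<sigma> (?res z) = ?q \<one>\<^bsub>?U\<^esub>" unfolding \<sigma>_def using \<iota>(2)[OF ul.G.one_closed] by simp
      also have "\<dots> = V"
        using rcoset_eq_self_iff[OF nV ul.G.one_closed] subgroup.one_closed[OF normal_imp_subgroup[OF nV]] by blast
      finally show ?thesis .
    qed
    have triv: "\<sigma> (lklam L i z) = V" if "i \<in> lkI L" "z \<in> lkZbar L i" for i z
      using that \<sigma>_Zbar unfolding L_simps(3,5,7) by blast
    obtain \<rho> where \<rho>: "globalization p L \<rho>" "\<And>x. x \<in> carrier ?Gh \<Longrightarrow> ?q (\<rho> x) = \<sigma> x"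
      by (rule globalization_lift[OF p link \<sigma> triv]) (simp_all add: L_simps)
    have \<rho>c: "\<rho> \<in> chom ?Gh ?U" "\<And>i \<tau>. i \<in> I \<Longrightarrow> \<tau> \<in> T i \<Longrightarrow> \<rho> (?res \<tau>) = \<pi> i \<tau>"
      using \<rho>(1) by (simp_all add: globalization_def L_simps)
    have "?\<theta> (\<rho> x) = \<rho>' x" if "x \<in> carrier ?Gh" for x
      using ident[OF chom_carrier[OF \<rho>c(1) that]] \<rho>(2)[OF that] \<rho>'_ident[OF that] by simp
    then have lifts: "\<forall>x\<in>carrier ?Gh. proj_ul n m1 (\<rho> x) = \<rho>1 (restriction G T J I1 x) \<and>
        proj_lr n m2 (\<rho> x) = \<rho>2 (restriction G T J I2 x)"
      by (simp add: \<rho>'_def r1_def r2_def)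
    have surj: "\<rho> ` carrier ?Gh = carrier ?U"
    proof (rule unitri_generated_by_superdiagonal[OF pro_p_ringD(1)[OF R]])
      show "subgroup (\<rho> ` carrier ?Gh) ?U"
        using group_hom.img_is_subgroup[OF chom_group_hom[OF \<rho>c(1) Ghd(1) Ud(1)]] .
      fix l a assume l: "l \<in> {1..n}" and a: "a \<in> carrier R"
      have i: "e l \<in> I" using l by (auto simp: I_def)
      have "a \<in> pibar (e l) ` T (e l)" using pibar_surj[of "e l"] i IJ a by blast
      then obtain \<tau> where \<tau>: "\<tau> \<in> T (e l)" "a = pibar (e l) \<tau>" by (elim imageE) blast
      have "?res \<tau> \<in> carrier ?Gh" by (rule res_T[OF i \<tau>(1)])
      moreover have "\<rho> (?res \<tau>) = unitri_elem R n l a"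
        using \<rho>c(2)[OF i \<tau>(1)] \<pi>_e[OF l] \<tau>(2) by simp
      ultimately show "unitri_elem R n l a \<in> \<rho> ` carrier ?Gh" by (metis image_eqI)
    qed
    have "\<rho> ` ?res ` Zbar i \<subseteq> V" if i: "i \<in> I" for i
    proof clarify
      fix z assume z: "z \<in> Zbar i"
      have c: "?res z \<in> carrier ?Gh" by (rule chom_carrier[OF resc Zbar[OF i z]])
      show "\<rho> (?res z) \<in> V"
        using \<rho>(2)[OF c] \<sigma>_Zbar[OF i z] rcoset_eq_self_iff[OF nV chom_carrier[OF \<rho>c(1) c]] by simp
    qed
    then show "\<exists>\<rho>. globalization p L \<rho> \<and> \<rho> ` carrier ?Gh = carrier ?U \<and>
         (\<forall>x\<in>carrier ?Gh. proj_ul n m1 (\<rho> x) = \<rho>1 (restriction G T J I1 x) \<and>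
            proj_lr n m2 (\<rho> x) = \<rho>2 (restriction G T J I2 x)) \<and>
         (\<forall>i\<in>I. \<rho> ` ?res ` Zbar i \<subseteq> V)"
      using \<rho>(1) surj lifts by blast
  qed
qed

end
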